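(* Let $Q\subset H^\infty_+(\mathbb R)$ satisfy $$\sup_{q\in Q}\|q\|_{L^2}^2<2\pi$$ and be equicontinuous in $L^2(\mathbb R)$. For $q\in Q$ and $t\in\mathbb R$ let $e^{tJ\nabla H_+}q$ denote the value at time $t$ of the solution, with initial data $q$ at time $0$, of the focusing equation $$i\,\partial_t q=-\partial_x^2 q+2iq\,\partial_x C_+(|q|^2).$$ Then the set of orbits $$Q^*:=\{e^{tJ\nabla H_+}q: q\in Q,\ t\in\mathbb R\}$$ is bounded and equicontinuous in $L^2(\mathbb R)$.
   Context: Fourier transform: $\hat f(\xi)=\frac1{\sqrt{2\pi}}\int_{\mathbb R} e^{-i\xi x}f(x)\,dx$. $L^2_+(\mathbb R)=\{f\in L^2(\mathbb R):\hat f(\xi)=0 \text{ for }\xi<0\}$, and $C_+$ is the Cauchy--Szegő projection, $\widehat{C_+f}(\xi)=1_{[0,\infty)}(\xi)\hat f(\xi)$. $H^s_+(\mathbb R)$ is the space of $f\in H^s(\mathbb R)$ whose Fourier transform is supported in $[0,\infty)$, and $H^\infty_+(\mathbb R)=\bigcap_{n\ge 1}H^n_+(\mathbb R)$. It is known (Gérard--Lenzmann) that for each integer $n\ge1$ the focusing equation is globally well-posed on $\{q\in H^n_+(\mathbb R):\|q\|_{L^2}^2<2\pi\}$, so each $q^0\in H^\infty_+(\mathbb R)$ with $\|q^0\|_{L^2}^2<2\pi$ leads to a unique global solution in $C(\mathbb R;H^\infty_+(\mathbb R))$. A bounded set $Q\subset L^2_+(\mathbb R)$ is equicontinuous in $L^2(\mathbb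 R)$ if $\limsup_{\delta\to0}\sup_{q\in Q}\sup_{|y|<\delta}\|q(\cdot+y)-q(\cdot)\|_{L^2}=0$. *)

theory Defs
  imports "HOL-Analysis.Analysis"
begin

definition ennreal_sqrt :: "ennreal \<Rightarrow> ennreal" where
  "ennreal_sqrt a = (if a = \<infinity> then \<infinity> else ennreal (sqrt (enn2real a)))"

text \<open>Norms take values in \<^typ>\<open>ennreal\<close>, so that they are \<open>\<infinity>\<close>, and not a default
  value, outside the space, and so that suprema of norms need no side condition.\<close>

definition L2_norm :: "(real \<Rightarrow> complex) \<Rightarrow> ennreal" where
  "L2_norm f = ennreal_sqrt (\<integral>\<^sup>+x. ennreal ((cmod (f x))\<^sup>2) \<partial>lborel)"

definition L2 :: "(real \<Rightarrow> complex) set" where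
  "L2 = {f. f \<in> borel_measurable borel \<and> L2_norm f < \<infinity>}"

definition fourier_trunc :: "real \<Rightarrow> (real \<Rightarrow> complex) \<Rightarrow> real \<Rightarrow> complex" where
  "fourier_trunc R f \<xi> =
     complex_of_real (1 / sqrt (2 * pi)) * (LINT x:{-R..R}|lborel. exp (- \<i> * of_real (\<xi> * x)) * f x)"

text \<open>For \<open>f\<close> in \<open>L2\<close> the defining integral need not converge absolutely; as in Plancherel's
  theorem it is read as the limit in \<open>L2\<close> of the integrals over \<open>[-R, R]\<close>. The function
  \<open>fourier f\<close> is a representative of that limit, determined almost everywhere.\<close>

definition has_fourier :: "(real \<Rightarrow> complex) \<Rightarrow> (real \<Rightarrow> complex) \<Rightarrow> bool" where
  "has_fourier f g \<longleftrightarrow>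
     g \<in> L2 \<and> ((\<lambda>R. L2_norm (\<lambda>\<xi>. fourier_trunc R f \<xi> - g \<xi>)) \<longlongrightarrow> 0) at_top"

definition fourier :: "(real \<Rightarrow> complex) \<Rightarrow> real \<Rightarrow> complex" where
  "fourier f = (SOME g. has_fourier f g)"

definition fourier_supp_nonneg :: "(real \<Rightarrow> complex) \<Rightarrow> bool" where
  "fourier_supp_nonneg f \<longleftrightarrow> (AE \<xi> in lborel. \<xi> < 0 \<longrightarrow> fourier f \<xi> = 0)"

definition L2_plus :: "(real \<Rightarrow> complex) set" where
  "L2_plus = {f \<in> L2. fourier_supp_nonneg f}"

text \<open>\<open>is_szego_proj f g\<close>: the function \<open>g\<close> represents the Cauchy--Szego projection
  \<open>C\<^sub>+ f\<close>, which is a class of functions modulo equality almost everywhere.\<close>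

definition is_szego_proj :: "(real \<Rightarrow> complex) \<Rightarrow> (real \<Rightarrow> complex) \<Rightarrow> bool" where
  "is_szego_proj f g \<longleftrightarrow> f \<in> L2 \<and> g \<in> L2 \<and>
     (AE \<xi> in lborel. fourier g \<xi> = indicator {0..} \<xi> * fourier f \<xi>)"

definition Sobolev_norm :: "nat \<Rightarrow> (real \<Rightarrow> complex) \<Rightarrow> ennreal" where
  "Sobolev_norm n f =
     ennreal_sqrt (\<integral>\<^sup>+\<xi>. ennreal ((1 + \<xi>\<^sup>2) ^ n * (cmod (fourier f \<xi>))\<^sup>2) \<partial>lborel)"

definition H_plus :: "nat \<Rightarrow> (real \<Rightarrow> complex) set" where
  "H_plus n = {f \<in> L2. Sobolev_norm n f < \<infinity> \<and> fourier_supp_nonneg f}"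

text \<open>Every class in the intersection of the spaces \<open>H_plus n\<close>, \<open>n \<ge> 1\<close>, has exactly one
  continuous representative, which is smooth. The elements of \<open>Hinf_plus\<close> are these
  representatives, so that equality of elements is equality of functions and
  \<open>x\<close>-derivatives are classical ones.\<close>

definition Hinf_plus :: "(real \<Rightarrow> complex) set" where
  "Hinf_plus = {f. continuous_on UNIV f \<and> (\<forall>n\<ge>1. f \<in> H_plus n)}"

definition dx :: "(real \<Rightarrow> complex) \<Rightarrow> real \<Rightarrow> complex" where
  "dx f x = vector_derivative f (at x)"

text \<open>\<open>u t x\<close> is the value at time \<open>t\<close> and position \<open>x\<close>. A solution is a continuous curve in the
  Frechet space \<open>Hinf_plus\<close>, defined for all times, whose time derivative exists in \<open>L2\<close> and
  satisfies the equation. Here \<open>w\<close> is the continuous (hence smooth) representative of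
  \<open>C\<^sub>+ (|q|\<^sup>2)\<close>.\<close>

definition is_solution :: "(real \<Rightarrow> real \<Rightarrow> complex) \<Rightarrow> bool" where
  "is_solution u \<longleftrightarrow>
     (\<forall>t. u t \<in> Hinf_plus) \<and>
     (\<forall>n\<ge>1. \<forall>t. ((\<lambda>s. Sobolev_norm n (\<lambda>x. u s x - u t x)) \<longlongrightarrow> 0) (at t)) \<and>
     (\<forall>t. \<exists>w. is_szego_proj (\<lambda>x. of_real ((cmod (u t x))\<^sup>2)) w \<and> continuous_on UNIV w \<and>
        ((\<lambda>h. L2_norm (\<lambda>x. \<i> * ((u (t + h) x - u t x) / of_real h)
                 - (- dx (dx (u t)) x + 2 * \<i> * u t x * dx w x))) \<longlongrightarrow> 0) (at 0))"

text \<open>The values, at all times, of the solutions with initial data in \<open>Q\<close>. By well-posedness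
  there is exactly one solution for each datum with squared norm below \<open>2\<pi>\<close>, but the definition
  does not depend on this.\<close>

definition orbits :: "(real \<Rightarrow> complex) set \<Rightarrow> (real \<Rightarrow> complex) set" where
  "orbits Q = {u t | u t. is_solution u \<and> u 0 \<in> Q}"

definition bounded_L2 :: "(real \<Rightarrow> complex) set \<Rightarrow> bool" where
  "bounded_L2 Q \<longleftrightarrow> Q \<subseteq> L2 \<and> (SUP q\<in>Q. L2_norm q) < \<infinity>"

definition equicontinuous_L2 :: "(real \<Rightarrow> complex) set \<Rightarrow> bool" where
  "equicontinuous_L2 Q \<longleftrightarrow> Q \<subseteq> L2_plus \<and> bounded_L2 Q \<and>
     Limsup (at_right (0::real))
       (\<lambda>\<delta>. SUP q\<in>Q. SUP y\<in>{y. \<bar>y\<bar> < \<delta>}. L2_norm (\<lambda>x. q (x + y) - q x)) = 0"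

end

theory Submission
  imports Defs "HOL-Probability.Probability"
begin

text \<open>
Let \<open>D = - \<i> d/dx\<close> and, for a state \<open>q\<close>, let \<open>L\<^sub>q f = D f - q C\<^sub>+(cnj q f)\<close> be its Lax operator on the
Hardy space. Three facts give the theorem.

First, \<open>L\<^sub>q\<close> is comparable with \<open>D\<close>. The Fourier transform of \<open>C\<^sub>+(cnj q f)\<close> at \<open>\<xi> \<ge> 0\<close> is
\<open>1 / sqrt (2\<pi>)\<close> times the integral over \<open>\<eta> \<ge> 0\<close> of the transform of \<open>f\<close> at \<open>\<xi> + \<eta>\<close> against the
conjugate transform of \<open>q\<close> at \<open>\<eta>\<close>. By Cauchy--Schwarz in \<open>\<eta>\<close> and Tonelli in \<open>\<xi>\<close>, the squared
norm of \<open>C\<^sub>+(cnj q f)\<close> is at most \<open>\<parallel>q\<parallel>\<^sup>2 / (2\<pi>)\<close> times \<open>\<langle>f, D f\<rangle>\<close> (\<open>Kfun_bound\<close>). So if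
\<open>\<parallel>q\<parallel>\<^sup>2 \<le> 2\<pi>c\<close> with \<open>c < 1\<close>, then \<open>(1 - c) D \<le> L\<^sub>q \<le> D\<close> as quadratic forms. This is where the
threshold \<open>2\<pi>\<close> enters.

Secondly, along a solution the mass \<open>\<parallel>q\<parallel>\<^sup>2\<close> and, for each \<open>\<kappa> > 0\<close>, the energy
\<open>E\<^sub>\<kappa>(q) = \<langle>q, (L\<^sub>q + \<kappa>)\<^sup>-\<^sup>1 q\<rangle>\<close> are conserved (\<open>mass_conserved\<close>, \<open>energy_conserved\<close>).

Thirdly, \<open>\<parallel>q\<parallel>\<^sup>2 - \<kappa> E\<^sub>\<kappa>(q)\<close> measures the high frequencies of \<open>q\<close>. By the first fact it lies between the
values at \<open>q\<close> of the quadratic forms of \<open>(1 - c) D / ((1 - c) D + \<kappa>)\<close> and of \<open>D / (D + \<kappa>)\<close>. The lower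
one is at least half of the mass of \<open>q\<close> at frequencies above \<open>\<kappa> / (1 - c)\<close> (\<open>energy_upper\<close>); the upper
one is at most \<open>(N / \<kappa>) \<parallel>q\<parallel>\<^sup>2\<close> plus the mass above \<open>N\<close>, for any \<open>N\<close> (\<open>energy_lower\<close>). Comparing
a time \<open>t\<close> with time \<open>0\<close> through the conserved quantity, the mass at high frequencies stays small if it is
small initially (\<open>tail_propagation\<close>). For bounded sets in the Hardy space, equicontinuity means that this
mass is uniformly small (\<open>equicontinuous_uniform_tail\<close>, \<open>uniform_tail_equicontinuous\<close>).

The unbounded operator \<open>L\<^sub>q\<close> itself never appears. Put \<open>f = (L\<^sub>q + \<kappa>)\<^sup>-\<^sup>1 q\<close> and
\<open>F = (D + \<kappa>)\<^sup>1\<^sup>/\<^sup>2 f\<close>. Then \<open>F = G q + K\<^sub>q\<^sup>* K\<^sub>q F\<close> with \<open>G = (D + \<kappa>)\<^sup>-\<^sup>1\<^sup>/\<^sup>2\<close> and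
\<open>K\<^sub>q = C\<^sub>+ cnj q (D + \<kappa>)\<^sup>-\<^sup>1\<^sup>/\<^sup>2\<close>, whose norm is at most \<open>\<parallel>q\<parallel> / sqrt (2\<pi>) < 1\<close>. The contraction principle
gives \<open>F\<close>, and \<open>E\<^sub>\<kappa>(q) = \<langle>G q, F\<rangle>\<close> is differentiable in time as soon as \<open>q\<close> is differentiable in \<open>L\<^sup>2\<close>
(\<open>energy_derivative\<close>). That its derivative vanishes is an identity between integrals of smooth functions
(\<open>energy_identity\<close>), the trace left by the Lax pair; it needs \<open>f\<close> to be smooth, which follows from the
equation for \<open>F\<close> by improving decay on the Fourier side one power at a time (\<open>resolvent_regular\<close>).
\<close>

section \<open>The Hilbert space of square-integrable functions\<close>

lemma borel_measurable_cnj [measurable]: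
  assumes "f \<in> borel_measurable M" shows "(\<lambda>x. cnj (f x)) \<in> borel_measurable M"
  by (rule measurable_compose[OF assms]) (intro borel_measurable_continuous_onI continuous_intros)

definition sqint :: "(real \<Rightarrow> complex) \<Rightarrow> bool" where
  "sqint f \<longleftrightarrow> f \<in> borel_measurable borel \<and> integrable lborel (\<lambda>x. (cmod (f x))\<^sup>2)"

lemma sqint_measurable [measurable_dest]: "sqint f \<Longrightarrow> f \<in> borel_measurable borel"
  by (simp add: sqint_def)

lemma sqint_integrable: "sqint f \<Longrightarrow> integrable lborel (\<lambda>x. (cmod (f x))\<^sup>2)"
  by (simp add: sqint_def)

lemma sqint_iff_nn_integral:
  "sqint f \<longleftrightarrow> f \<in> borel_measurable borel \<and> (\<integral>\<^sup>+x. ennreal ((cmod (f x))\<^sup>2) \<partial>lborel) < \<infinity>"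
  by (auto simp: sqint_def integrable_iff_bounded)

lemma sqint_bound:
  assumes "sqint f" "g \<in> borel_measurable borel" "AE x in lborel. cmod (g x) \<le> C * cmod (f x)"
  shows "sqint g"
proof -
  have "integrable lborel (\<lambda>x. (cmod (g x))\<^sup>2)"
  proof (rule Bochner_Integration.integrable_bound)
    show "integrable lborel (\<lambda>x. C\<^sup>2 * (cmod (f x))\<^sup>2)"
      using sqint_integrable[OF assms(1)] by simp
    show "(\<lambda>x. (cmod (g x))\<^sup>2) \<in> borel_measurable lborel" using assms(2) by measurable
    show "AE x in lborel. norm ((cmod (g x))\<^sup>2) \<le> norm (C\<^sup>2 * (cmod (f x))\<^sup>2)"
      using assms(3)
    proof eventually_elim
      case (elim x)
      then have "(cmod (g x))\<^sup>2 \<le> (C * cmod (f x))\<^sup>2" by (intro power_mono) auto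
      then show ?case by (simp add: power_mult_distrib)
    qed
  qed
  then show ?thesis using assms(2) by (simp add: sqint_def)
qed

lemma integrable_mult_sqint:
  assumes "sqint f" "sqint g"
  shows "integrable lborel (\<lambda>x. f x * g x)"
proof (rule Bochner_Integration.integrable_bound)
  show "integrable lborel (\<lambda>x. (cmod (f x))\<^sup>2 + (cmod (g x))\<^sup>2)"
    using assms by (auto simp: sqint_def)
  show "(\<lambda>x. f x * g x) \<in> borel_measurable lborel"
    using sqint_measurable[OF assms(1)] sqint_measurable[OF assms(2)] by measurable
  show "AE x in lborel. norm (f x * g x) \<le> norm ((cmod (f x))\<^sup>2 + (cmod (g x))\<^sup>2)"
  proof (rule AE_I2)
    fix x
    have "0 \<le> (cmod (f x) - cmod (g x))\<^sup>2" "0 \<le> cmod (f x) * cmod (g x)" by simp_all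
    then have "cmod (f x) * cmod (g x) \<le> (cmod (f x))\<^sup>2 + (cmod (g x))\<^sup>2"
      unfolding power2_diff by linarith
    then show "norm (f x * g x) \<le> norm ((cmod (f x))\<^sup>2 + (cmod (g x))\<^sup>2)"
      by (simp add: norm_mult)
  qed
qed

lemma sqint_cnj: "sqint f \<Longrightarrow> sqint (\<lambda>x. cnj (f x))"
  unfolding sqint_def by auto

lemma sqint_cmult: "sqint f \<Longrightarrow> sqint (\<lambda>x. c * f x)"
  unfolding sqint_def by (auto simp: norm_mult power_mult_distrib)

lemma sqint_uminus: "sqint f \<Longrightarrow> sqint (\<lambda>x. - f x)"
  unfolding sqint_def by auto

lemma sqint_zero: "sqint (\<lambda>x. 0)"
  unfolding sqint_def by auto

lemma sqint_add:
  assumes "sqint f" "sqint g"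
  shows "sqint (\<lambda>x. f x + g x)"
proof -
  have "integrable lborel (\<lambda>x. (cmod (f x + g x))\<^sup>2)"
  proof (rule Bochner_Integration.integrable_bound)
    show "integrable lborel (\<lambda>x. 2 * (cmod (f x))\<^sup>2 + 2 * (cmod (g x))\<^sup>2)"
      using assms by (auto simp: sqint_def)
    show "(\<lambda>x. (cmod (f x + g x))\<^sup>2) \<in> borel_measurable lborel"
      using sqint_measurable[OF assms(1)] sqint_measurable[OF assms(2)] by measurable
    show "AE x in lborel. norm ((cmod (f x + g x))\<^sup>2) \<le> norm (2 * (cmod (f x))\<^sup>2 + 2 * (cmod (g x))\<^sup>2)"
    proof (rule AE_I2)
      fix x
      have "(cmod (f x + g x))\<^sup>2 \<le> (cmod (f x) + cmod (g x))\<^sup>2"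
        by (intro power_mono norm_triangle_ineq) auto
      also have "\<dots> \<le> 2 * (cmod (f x))\<^sup>2 + 2 * (cmod (g x))\<^sup>2"
        using zero_le_power2[of "cmod (f x) - cmod (g x)"] by (simp add: power2_diff power2_sum)
      finally show "norm ((cmod (f x + g x))\<^sup>2) \<le> norm (2 * (cmod (f x))\<^sup>2 + 2 * (cmod (g x))\<^sup>2)"
        by simp
    qed
  qed
  then show ?thesis using assms by (auto simp: sqint_def)
qed

lemma sqint_diff: "sqint f \<Longrightarrow> sqint g \<Longrightarrow> sqint (\<lambda>x. f x - g x)"
  using sqint_add[OF _ sqint_uminus] by simp

lemma sqint_bounded_mult:
  assumes "sqint f" "m \<in> borel_measurable borel" "\<And>x. cmod (m x) \<le> C"
  shows "sqint (\<lambda>x. m x * f x)"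
proof (rule sqint_bound[OF assms(1)])
  show "(\<lambda>x. m x * f x) \<in> borel_measurable borel"
    using sqint_measurable[OF assms(1)] assms(2) by measurable
  show "AE x in lborel. cmod (m x * f x) \<le> C * cmod (f x)"
    using assms(3) by (auto simp: norm_mult intro!: mult_right_mono)
qed

lemma sqint_restrict:
  "sqint f \<Longrightarrow> S \<in> sets borel \<Longrightarrow> sqint (\<lambda>x. indicator S x * f x)"
  by (rule sqint_bounded_mult[where C=1]) (auto simp: indicator_def)

text \<open>Modulo equality almost everywhere, the square-integrable functions form a type of the classes
  \<^class>\<open>real_inner\<close> and \<^class>\<open>complete_space\<close>, to which the contraction principle and the calculus of curves in
  normed spaces apply. The inner product is the real part of the Hermitian one: every functional
  considered below is real.\<close>

quotient_type ltwo = "real \<Rightarrow> complex" / partial: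
  "\<lambda>f g. sqint f \<and> sqint g \<and> (AE x in lborel. f x = g x)"
  morphisms rep_ltwo abs_ltwo
proof (rule part_equivpI)
  show "\<exists>x. sqint x \<and> sqint x \<and> (AE xa in lborel. x xa = x xa)"
    using sqint_zero by auto
  show "symp (\<lambda>f g. sqint f \<and> sqint g \<and> (AE x in lborel. f x = g x))"
    by (rule sympI) (auto elim: eventually_mono)
  show "transp (\<lambda>f g. sqint f \<and> sqint g \<and> (AE x in lborel. f x = g x))"
  proof (rule transpI)
    fix f g h
    assume 1: "sqint f \<and> sqint g \<and> (AE x in lborel. f x = g x)"
      and 2: "sqint g \<and> sqint h \<and> (AE x in lborel. g x = h x)"
    have "AE x in lborel. f x = g x" "AE x in lborel. g x = h x" using 1 2 by auto
    then have "AE x in lborel. f x = h x" by eventually_elim simp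
    then show "sqint f \<and> sqint h \<and> (AE x in lborel. f x = h x)" using 1 2 by simp
  qed
qed

lemma sqint_rep [simp]: "sqint (rep_ltwo x)"
  using Quotient3_rep_reflp[OF Quotient3_ltwo, of x] by simp

lemma abs_rep_ltwo [simp]: "abs_ltwo (rep_ltwo x) = x"
  by (rule Quotient3_abs_rep[OF Quotient3_ltwo])

lemma rep_abs_ltwo: "sqint f \<Longrightarrow> AE x in lborel. rep_ltwo (abs_ltwo f) x = f x"
  using Quotient3_rel_abs[OF Quotient3_ltwo] rep_abs_rsp_left[OF Quotient3_ltwo, of f f] by simp

lemma abs_ltwo_eq_iff:
  "sqint f \<Longrightarrow> sqint g \<Longrightarrow> abs_ltwo f = abs_ltwo g \<longleftrightarrow> (AE x in lborel. f x = g x)"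
  using Quotient3_rel[OF Quotient3_ltwo, of f g] by auto

lemma measurable_rep_ltwo [measurable]: "rep_ltwo x \<in> borel_measurable borel"
  by (rule sqint_measurable) simp

instantiation ltwo :: real_inner
begin

lift_definition zero_ltwo :: ltwo is "\<lambda>x. 0" by (simp add: sqint_zero)

lift_definition plus_ltwo :: "ltwo \<Rightarrow> ltwo \<Rightarrow> ltwo" is "\<lambda>f g x. f x + g x"
  by (auto intro: sqint_add elim: eventually_elim2)

lift_definition uminus_ltwo :: "ltwo \<Rightarrow> ltwo" is "\<lambda>f x. - f x"
  by (auto intro: sqint_uminus elim: eventually_mono)

definition minus_ltwo :: "ltwo \<Rightarrow> ltwo \<Rightarrow> ltwo" where "x - y = x + - (y :: ltwo)"

lift_definition scaleR_ltwo :: "real \<Rightarrow> ltwo \<Rightarrow> ltwo" is "\<lambda>r f x. of_real r * f x"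
  by (auto intro: sqint_cmult elim: eventually_mono)

lift_definition inner_ltwo :: "ltwo \<Rightarrow> ltwo \<Rightarrow> real" is
  "\<lambda>f g. LBINT x. Re (cnj (f x) * g x)"
proof -
  fix f g h k :: "real \<Rightarrow> complex"
  assume 1: "sqint f \<and> sqint g \<and> (AE x in lborel. f x = g x)"
    and 2: "sqint h \<and> sqint k \<and> (AE x in lborel. h x = k x)"
  have "AE x in lborel. f x = g x" "AE x in lborel. h x = k x" using 1 2 by auto
  then have *: "AE x in lborel. Re (cnj (f x) * h x) = Re (cnj (g x) * k x)"
    by eventually_elim simp
  have [measurable]: "f \<in> borel_measurable borel" "g \<in> borel_measurable borel"
    "h \<in> borel_measurable borel" "k \<in> borel_measurable borel"
    using 1 2 by (auto intro: sqint_measurable)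
  show "(LBINT x. Re (cnj (f x) * h x)) = (LBINT x. Re (cnj (g x) * k x))"
    by (rule integral_cong_AE[OF _ _ *]; measurable)
qed

definition norm_ltwo :: "ltwo \<Rightarrow> real" where "norm x = sqrt (x \<bullet> (x :: ltwo))"
definition dist_ltwo :: "ltwo \<Rightarrow> ltwo \<Rightarrow> real" where "dist x y = norm (x - y :: ltwo)"
definition sgn_ltwo :: "ltwo \<Rightarrow> ltwo" where "sgn_ltwo x = inverse (norm x) *\<^sub>R x"
definition uniformity_ltwo :: "(ltwo \<times> ltwo) filter" where
  "uniformity_ltwo = (INF e\<in>{0<..}. principal {(x, y). dist x y < e})"
definition open_ltwo :: "ltwo set \<Rightarrow> bool" where
  "open_ltwo U \<longleftrightarrow> (\<forall>x\<in>U. eventually (\<lambda>(x', y). x' = x \<longrightarrow> y \<in> U) uniformity)"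

lemma integrable_inner_sqint:
  assumes "sqint f" "sqint g" shows "integrable lborel (\<lambda>x. Re (cnj (f x) * g x))"
  using integrable_mult_sqint[OF sqint_cnj[OF assms(1)] assms(2)] by (rule integrable_Re)

instance
proof
  fix a b c :: ltwo and r s :: real
  show "a + b + c = a + (b + c)" by transfer (auto simp: add.assoc intro!: sqint_add)
  show "a + b = b + a" by transfer (auto simp: add.commute intro!: sqint_add)
  show "0 + a = a" by transfer auto
  show "- a + a = 0" by transfer (auto simp: sqint_zero)
  show "a - b = a + - b" by (simp add: minus_ltwo_def)
  show "r *\<^sub>R (a + b) = r *\<^sub>R a + r *\<^sub>R b"
    by transfer (auto simp: distrib_left distrib_right mult.assoc intro!: sqint_add sqint_cmult)
  show "(r + s) *\<^sub>R a = r *\<^sub>R a + s *\<^sub>R a"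
    by transfer (auto simp: distrib_right intro!: sqint_add sqint_cmult[of _ "of_real _"])
  show "r *\<^sub>R s *\<^sub>R a = (r * s) *\<^sub>R a"
    by transfer (auto simp: mult.assoc intro!: sqint_cmult)
  show "1 *\<^sub>R a = a" by transfer auto
  show "dist a b = norm (a - b)" by (simp add: dist_ltwo_def)
  show "sgn a = inverse (norm a) *\<^sub>R a" by (simp add: sgn_ltwo_def)
  show "uniformity = (INF e\<in>{0<..}. principal {(x, y). dist (x :: ltwo) y < e})"
    by (rule uniformity_ltwo_def)
  show "open U \<longleftrightarrow> (\<forall>x\<in>U. eventually (\<lambda>(x', y). x' = x \<longrightarrow> y \<in> U) uniformity)"
    for U :: "ltwo set" by (rule open_ltwo_def)
  show "a \<bullet> b = b \<bullet> a" by transfer (auto intro!: Bochner_Integration.integral_cong)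
  show "(a + b) \<bullet> c = a \<bullet> c + b \<bullet> c"
  proof transfer
    fix a b c :: "real \<Rightarrow> complex"
    assume *: "sqint a \<and> sqint a \<and> (AE x in lborel. a x = a x)"
      "sqint b \<and> sqint b \<and> (AE x in lborel. b x = b x)"
      "sqint c \<and> sqint c \<and> (AE x in lborel. c x = c x)"
    have "(LBINT x. Re (cnj (a x + b x) * c x)) =
      (LBINT x. Re (cnj (a x) * c x) + Re (cnj (b x) * c x))"
      by (rule Bochner_Integration.integral_cong) (auto simp: algebra_simps)
    also have "\<dots> = (LBINT x. Re (cnj (a x) * c x)) + (LBINT x. Re (cnj (b x) * c x))"
      using * by (intro Bochner_Integration.integral_add integrable_inner_sqint) auto
    finally show "(LBINT x. Re (cnj (a x + b x) * c x)) =
       (LBINT x. Re (cnj (a x) * c x)) + (LBINT x. Re (cnj (b x) * c x))" .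
  qed
  show "(r *\<^sub>R a) \<bullet> b = r * (a \<bullet> b)"
  proof transfer
    fix r and a b :: "real \<Rightarrow> complex"
    have "(LBINT x. Re (cnj (of_real r * a x) * b x)) = (LBINT x. r * Re (cnj (a x) * b x))"
      by (rule Bochner_Integration.integral_cong) (auto simp: algebra_simps)
    then show "(LBINT x. Re (cnj (of_real r * a x) * b x)) = r * (LBINT x. Re (cnj (a x) * b x))"
      by simp
  qed
  show "0 \<le> a \<bullet> a"
    by transfer (auto intro!: Bochner_Integration.integral_nonneg)
  show "a \<bullet> a = 0 \<longleftrightarrow> a = 0"
  proof transfer
    fix a :: "real \<Rightarrow> complex"
    assume "sqint a \<and> sqint a \<and> (AE x in lborel. a x = a x)"
    then have a: "sqint a" by simp
    have "((LBINT x. Re (cnj (a x) * a x)) = 0) \<longleftrightarrow> (AE x in lborel. Re (cnj (a x) * a x) = 0)"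
      by (rule integral_nonneg_eq_0_iff_AE[OF integrable_inner_sqint[OF a a]]) auto
    also have "(\<lambda>x. Re (cnj (a x) * a x) = 0) = (\<lambda>x. a x = 0)"
      by (auto simp: fun_eq_iff complex_eq_iff power2_eq_square[symmetric])
    finally show "((LBINT x. Re (cnj (a x) * a x)) = 0) \<longleftrightarrow>
      (sqint a \<and> sqint (\<lambda>x. 0) \<and> (AE x in lborel. a x = 0))"
      using a sqint_zero by auto
  qed
  show "norm a = sqrt (a \<bullet> a)" by (rule norm_ltwo_def)
qed

end

lemma abs_ltwo_add: "sqint f \<Longrightarrow> sqint g \<Longrightarrow> abs_ltwo (\<lambda>x. f x + g x) = abs_ltwo f + abs_ltwo g"
  by (simp add: plus_ltwo.abs_eq)

lemma abs_ltwo_uminus: "sqint f \<Longrightarrow> abs_ltwo (\<lambda>x. - f x) = - abs_ltwo f"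
  by (simp add: uminus_ltwo.abs_eq)

lemma abs_ltwo_diff: "sqint f \<Longrightarrow> sqint g \<Longrightarrow> abs_ltwo (\<lambda>x. f x - g x) = abs_ltwo f - abs_ltwo g"
  using abs_ltwo_add[OF _ sqint_uminus] abs_ltwo_uminus by simp

lemma abs_ltwo_scaleR: "sqint f \<Longrightarrow> abs_ltwo (\<lambda>x. of_real r * f x) = r *\<^sub>R abs_ltwo f"
  by (simp add: scaleR_ltwo.abs_eq)

lemma inner_abs_ltwo:
  "sqint f \<Longrightarrow> sqint g \<Longrightarrow> abs_ltwo f \<bullet> abs_ltwo g = (LBINT x. Re (cnj (f x) * g x))"
  by (simp add: inner_ltwo.abs_eq)

lemma norm_abs_ltwo:
  assumes "sqint f" shows "(norm (abs_ltwo f))\<^sup>2 = (LBINT x. (cmod (f x))\<^sup>2)"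
proof -
  have "Re (cnj z * z) = (cmod z)\<^sup>2" for z
    by (simp only: cmod_power2) (simp add: power2_eq_square)
  then show ?thesis
    unfolding power2_norm_eq_inner inner_abs_ltwo[OF assms assms] by simp
qed

lemma norm_ltwo_rep: "(norm x)\<^sup>2 = (LBINT t. (cmod (rep_ltwo x t))\<^sup>2)"
  using norm_abs_ltwo[of "rep_ltwo x"] by simp

lemma nn_integral_sqint:
  assumes "sqint f"
  shows "(\<integral>\<^sup>+x. ennreal ((cmod (f x))\<^sup>2) \<partial>lborel) = ennreal ((norm (abs_ltwo f))\<^sup>2)"
  using nn_integral_eq_integral[OF sqint_integrable[OF assms]] by (simp add: norm_abs_ltwo[OF assms])

lemma L2_norm_eq: "sqint f \<Longrightarrow> L2_norm f = ennreal (norm (abs_ltwo f))"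
  by (simp add: L2_norm_def ennreal_sqrt_def nn_integral_sqint)

lemma L2_iff_sqint: "f \<in> L2 \<longleftrightarrow> sqint f"
proof -
  have "L2_norm f < \<infinity> \<longleftrightarrow> (\<integral>\<^sup>+x. ennreal ((cmod (f x))\<^sup>2) \<partial>lborel) < \<infinity>"
    by (auto simp: L2_norm_def ennreal_sqrt_def less_top[symmetric])
  then show ?thesis by (simp add: L2_def sqint_iff_nn_integral)
qed

abbreviation nrm :: "(real \<Rightarrow> complex) \<Rightarrow> real" where
  "nrm f \<equiv> norm (abs_ltwo f)"

lemma Cauchy_Schwarz_sqint:
  assumes "sqint f" "sqint g"
  shows "(LBINT x. cmod (f x) * cmod (g x)) \<le> nrm f * nrm g"
proof -
  have s: "sqint (\<lambda>x. of_real (cmod (f x)))" "sqint (\<lambda>x. of_real (cmod (g x)))"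
    using assms by (auto simp: sqint_def)
  have n: "nrm (\<lambda>x. of_real (cmod (h x))) = nrm h"
    if "sqint (\<lambda>x. of_real (cmod (h x)))" "sqint h" for h
    using norm_abs_ltwo[OF that(1)] norm_abs_ltwo[OF that(2)] power2_eq_iff_nonneg[OF norm_ge_zero norm_ge_zero]
    by (metis (no_types, lifting) norm_of_real abs_norm_cancel Bochner_Integration.integral_cong)
  show ?thesis
    using Cauchy_Schwarz_ineq2[of "abs_ltwo (\<lambda>x. of_real (cmod (f x)))" "abs_ltwo (\<lambda>x. of_real (cmod (g x)))"]
    by (simp add: inner_abs_ltwo s n assms)
qed

lemma nn_integral_rep_diff:
  "(\<integral>\<^sup>+t. ennreal ((cmod (rep_ltwo x t - rep_ltwo y t))\<^sup>2) \<partial>lborel) = ennreal ((norm (x - y))\<^sup>2)"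
  using nn_integral_sqint[OF sqint_diff[OF sqint_rep sqint_rep], of x y]
  by (simp add: abs_ltwo_diff)

text \<open>Riesz--Fischer. Along a subsequence whose consecutive distances are at most \<open>4\<^sup>-\<^sup>k\<close>, the sum over \<open>k\<close>
  of \<open>4\<^sup>k\<close> times the squared modulus of the \<open>k\<close>-th difference has a finite integral. Where this sum is finite,
  the differences are at most a multiple of \<open>2\<^sup>-\<^sup>k\<close>, so the subsequence converges almost everywhere, and
  Fatou's lemma turns the pointwise limit into a limit in norm.\<close>

instance ltwo :: complete_space
proof
  fix X :: "nat \<Rightarrow> ltwo"
  assume X: "Cauchy X"
  have "\<forall>k. \<exists>N. \<forall>m\<ge>N. \<forall>n\<ge>N. norm (X m - X n) < (1/4) ^ k"
    using X by (auto simp: Cauchy_altdef2 dist_norm intro!: CauchyD[OF X])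
  then obtain N where N: "\<And>k m n. m \<ge> N k \<Longrightarrow> n \<ge> N k \<Longrightarrow> norm (X m - X n) < (1/4) ^ k"
    by metis
  \<comment> \<open>The sum makes \<open>r k\<close> at least \<open>N k\<close>; the summand \<open>k\<close> makes \<open>r\<close> strictly increasing.\<close>
  define r where "r k = (\<Sum>j\<le>k. N j) + k" for k
  have r: "strict_mono r" by (intro strict_monoI_Suc) (simp add: r_def)
  have rN: "r k \<ge> N k" for k
    using member_le_sum[of k "{..k}" N] by (simp add: r_def)
  define g where "g k = rep_ltwo (X (r k))" for k
  define d where "d k x = g (Suc k) x - g k x" for k x
  have [measurable]: "g k \<in> borel_measurable borel" for k by (simp add: g_def)
  have [measurable]: "d k \<in> borel_measurable borel" for k unfolding d_def by measurable
  have d: "(\<integral>\<^sup>+x. ennreal ((cmod (d k x))\<^sup>2) \<partial>lborel) \<le> ennreal ((1/16) ^ k)" for k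
  proof -
    have "r (Suc k) \<ge> N k" using rN[of k] r by (meson le_trans lessI less_imp_le strict_mono_less)
    then have "norm (X (r (Suc k)) - X (r k)) \<le> (1/4) ^ k"
      using N[OF _ rN] by (simp add: less_imp_le)
    then have "(norm (X (r (Suc k)) - X (r k)))\<^sup>2 \<le> ((1/4) ^ k)\<^sup>2"
      by (intro power_mono) auto
    also have "((1/4) ^ k)\<^sup>2 = (1/16 :: real) ^ k"
      by (simp add: power2_eq_square power_mult_distrib[symmetric])
    finally show ?thesis unfolding d_def g_def nn_integral_rep_diff by (rule ennreal_leI)
  qed
  have "(\<integral>\<^sup>+x. (\<Sum>k. ennreal (4 ^ k * (cmod (d k x))\<^sup>2)) \<partial>lborel)
      = (\<Sum>k. \<integral>\<^sup>+x. ennreal (4 ^ k * (cmod (d k x))\<^sup>2) \<partial>lborel)"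
    by (rule nn_integral_suminf) measurable
  also have "\<dots> \<le> (\<Sum>k. ennreal ((1/4) ^ k))"
  proof (intro suminf_le summableI)
    fix k
    have "(\<integral>\<^sup>+x. ennreal (4 ^ k * (cmod (d k x))\<^sup>2) \<partial>lborel)
        = ennreal (4 ^ k) * (\<integral>\<^sup>+x. ennreal ((cmod (d k x))\<^sup>2) \<partial>lborel)"
      by (subst nn_integral_cmult[symmetric]) (auto simp: ennreal_mult')
    also have "\<dots> \<le> ennreal (4 ^ k) * ennreal ((1/16) ^ k)"
      by (intro mult_left_mono d) auto
    also have "\<dots> = ennreal ((1/4) ^ k)"
      by (simp add: ennreal_mult[symmetric] power_mult_distrib[symmetric])
    finally show "(\<integral>\<^sup>+x. ennreal (4 ^ k * (cmod (d k x))\<^sup>2) \<partial>lborel) \<le> ennreal ((1/4) ^ k)" .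
  qed
  also have "\<dots> < \<infinity>"
    by (subst suminf_ennreal2) (auto simp: summable_geometric)
  finally have "AE x in lborel. (\<Sum>k. ennreal (4 ^ k * (cmod (d k x))\<^sup>2)) \<noteq> \<infinity>"
    by (intro nn_integral_PInf_AE) auto
  then have conv: "AE x in lborel. convergent (\<lambda>k. g k x)"
  proof eventually_elim
    case (elim x)
    then obtain C where C: "(\<Sum>k. ennreal (4 ^ k * (cmod (d k x))\<^sup>2)) = ennreal C" "C \<ge> 0"
      by (metis ennreal_enn2real enn2real_nonneg infinity_ennreal_def less_top)
    have "cmod (d k x) \<le> sqrt C * (1/2) ^ k" for k
    proof -
      have "ennreal (4 ^ k * (cmod (d k x))\<^sup>2) \<le> ennreal C"
      proof -
        have "s k \<le> suminf s" for s :: "nat \<Rightarrow> ennreal"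
          using sum_le_suminf[OF summableI, of "{k}" s] by simp
        from this[of "\<lambda>k. ennreal (4 ^ k * (cmod (d k x))\<^sup>2)"] show ?thesis unfolding C(1) .
      qed
      then have "4 ^ k * (cmod (d k x))\<^sup>2 \<le> C" using C(2) by simp
      moreover have "4 ^ k * (cmod (d k x))\<^sup>2 = (2 ^ k * cmod (d k x))\<^sup>2"
        by (simp add: power_mult_distrib power_mult[symmetric] mult.commute[of k] power_mult)
      ultimately have "2 ^ k * cmod (d k x) \<le> sqrt C" by (simp add: real_le_rsqrt)
      then show ?thesis by (simp add: field_simps power_divide)
    qed
    then have "summable (\<lambda>k. d k x)"
      by (intro summable_comparison_test[of "\<lambda>k. d k x" "\<lambda>k. sqrt C * (1/2) ^ k"])
         (auto intro: summable_mult summable_geometric)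
    then have "(\<lambda>n. \<Sum>k<n. d k x) \<longlonglongrightarrow> (\<Sum>k. d k x)" by (rule summable_LIMSEQ)
    also have "(\<lambda>n. \<Sum>k<n. d k x) = (\<lambda>n. g n x - g 0 x)"
      unfolding d_def by (intro ext sum_lessThan_telescope)
    finally have "(\<lambda>n. (g n x - g 0 x) + g 0 x) \<longlonglongrightarrow> (\<Sum>k. d k x) + g 0 x"
      by (intro tendsto_intros)
    then show ?case by (auto simp: convergent_def)
  qed
  define h where "h x = lim (\<lambda>k. g k x)" for x
  have [measurable]: "h \<in> borel_measurable borel"
    unfolding h_def by (rule borel_measurable_lim_metric) measurable
  have lim: "AE x in lborel. (\<lambda>k. g k x) \<longlonglongrightarrow> h x"
    using conv by eventually_elim (simp add: h_def convergent_LIMSEQ_iff)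
  have fatou: "(\<integral>\<^sup>+x. ennreal ((cmod (h x - g k x))\<^sup>2) \<partial>lborel) \<le> ennreal (e\<^sup>2)"
    if e: "\<And>j. j \<ge> k \<Longrightarrow> norm (X (r j) - X (r k)) \<le> e" for k e
  proof -
    have "(\<integral>\<^sup>+x. ennreal ((cmod (h x - g k x))\<^sup>2) \<partial>lborel)
        = (\<integral>\<^sup>+x. liminf (\<lambda>j. ennreal ((cmod (g j x - g k x))\<^sup>2)) \<partial>lborel)"
    proof (rule nn_integral_cong_AE)
      show "AE x in lborel. ennreal ((cmod (h x - g k x))\<^sup>2) = liminf (\<lambda>j. ennreal ((cmod (g j x - g k x))\<^sup>2))"
        using lim
      proof eventually_elim
        case (elim x)
        then have "(\<lambda>j. ennreal ((cmod (g j x - g k x))\<^sup>2)) \<longlonglongrightarrow> ennreal ((cmod (h x - g k x))\<^sup>2)"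
          by (intro tendsto_intros)
        then show ?case by (rule lim_imp_Liminf[OF sequentially_bot, symmetric])
      qed
    qed
    also have "\<dots> \<le> liminf (\<lambda>j. \<integral>\<^sup>+x. ennreal ((cmod (g j x - g k x))\<^sup>2) \<partial>lborel)"
      by (rule nn_integral_liminf) measurable
    also have "\<dots> = liminf (\<lambda>j. ennreal ((norm (X (r j) - X (r k)))\<^sup>2))"
      unfolding g_def nn_integral_rep_diff ..
    also have "\<dots> \<le> liminf (\<lambda>j. ennreal (e\<^sup>2))"
    proof (rule Liminf_mono)
      show "\<forall>\<^sub>F j in sequentially. ennreal ((norm (X (r j) - X (r k)))\<^sup>2) \<le> ennreal (e\<^sup>2)"
        using eventually_ge_at_top[of k]
        by eventually_elim (auto intro!: ennreal_leI power_mono e)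
    qed
    finally show ?thesis by (simp only: Liminf_const[OF sequentially_bot])
  qed
  have small: "\<exists>k. \<forall>j\<ge>k. norm (X (r j) - X (r k)) \<le> e" if "e > 0" for e
  proof -
    obtain M where M: "\<And>m n. m \<ge> M \<Longrightarrow> n \<ge> M \<Longrightarrow> norm (X m - X n) < e"
      using CauchyD[OF X \<open>e > 0\<close>] by blast
    have "r j \<ge> M" if "j \<ge> M" for j using seq_suble[OF r, of j] that by simp
    then show ?thesis using M by (intro exI[of _ M]) (auto intro: less_imp_le)
  qed
  obtain k0 where k0: "\<And>j. j \<ge> k0 \<Longrightarrow> norm (X (r j) - X (r k0)) \<le> 1" using small[of 1] by auto
  have "sqint (\<lambda>x. h x - g k0 x)"
    using fatou[OF k0] by (auto simp: sqint_iff_nn_integral intro: le_less_trans)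
  then have "sqint (\<lambda>x. (h x - g k0 x) + g k0 x)" by (rule sqint_add) (simp add: g_def)
  then have sh: "sqint h" by simp
  have "(\<lambda>k. X (r k)) \<longlonglongrightarrow> abs_ltwo h"
  proof (rule metric_LIMSEQ_I)
    fix e :: real assume e: "e > 0"
    then obtain k where k: "\<And>j. j \<ge> k \<Longrightarrow> norm (X (r j) - X (r k)) \<le> e / 3" using small[of "e/3"] by auto
    have "ennreal ((norm (abs_ltwo h - X (r k)))\<^sup>2) \<le> ennreal ((e/3)\<^sup>2)"
      using fatou[OF k] nn_integral_sqint[OF sqint_diff[OF sh sqint_rep], of "X (r k)"]
      by (simp add: g_def abs_ltwo_diff sh)
    then have hk: "norm (abs_ltwo h - X (r k)) \<le> e / 3"
      using e by (simp add: power2_le_iff_abs_le)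
    have "dist (X (r j)) (abs_ltwo h) < e" if "j \<ge> k" for j
    proof -
      have "norm ((X (r j) - X (r k)) - (abs_ltwo h - X (r k))) \<le> e / 3 + e / 3"
        using norm_triangle_ineq4 k[OF that] hk by (meson add_mono order_trans)
      then show ?thesis using e by (simp add: dist_norm)
    qed
    then show "\<exists>no. \<forall>n\<ge>no. dist (X (r n)) (abs_ltwo h) < e" by blast
  qed
  then have "X \<longlonglongrightarrow> abs_ltwo h"
    using Cauchy_converges_subseq[OF X r] by (simp add: o_def)
  then show "convergent X" by (auto simp: convergent_def)
qed

section \<open>Plancherel's theorem\<close>

lemma ltwo_dominated_convergence:
  fixes f :: "nat \<Rightarrow> real \<Rightarrow> complex"
  assumes [measurable]: "\<And>k. f k \<in> borel_measurable borel" "g \<in> borel_measurable borel"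
    and w: "sqint w"
    and bound: "\<And>k. AE x in lborel. cmod (f k x) \<le> cmod (w x)"
    and lim: "AE x in lborel. (\<lambda>k. f k x) \<longlonglongrightarrow> g x"
  shows "\<And>k. sqint (f k)" "sqint g" "(\<lambda>k. abs_ltwo (f k)) \<longlonglongrightarrow> abs_ltwo g"
proof -
  show f: "sqint (f k)" for k using bound[of k] by (intro sqint_bound[OF w, of _ 1]) auto
  have "AE x in lborel. \<forall>k. cmod (f k x) \<le> cmod (w x)" using bound by (simp add: AE_all_countable)
  then have bg: "AE x in lborel. (\<forall>k. cmod (f k x) \<le> cmod (w x)) \<and> cmod (g x) \<le> cmod (w x)"
    using lim by eventually_elim (auto intro: LIMSEQ_le_const2 tendsto_norm)
  show g: "sqint g" using bg by (intro sqint_bound[OF w, of _ 1]) (auto elim: eventually_mono)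
  have [measurable]: "w \<in> borel_measurable borel" using w by (rule sqint_measurable)
  have "(\<lambda>k. LBINT x. (cmod (f k x - g x))\<^sup>2) \<longlonglongrightarrow> (\<integral>x. 0 \<partial>(lborel :: real measure))"
  proof (rule integral_dominated_convergence)
    show "integrable lborel (\<lambda>x. 4 * (cmod (w x))\<^sup>2)" using sqint_integrable[OF w] by simp
    show "AE x in lborel. (\<lambda>k. (cmod (f k x - g x))\<^sup>2) \<longlonglongrightarrow> 0"
      using lim by eventually_elim (auto intro!: tendsto_eq_intros simp: LIM_zero tendsto_norm_zero)
    show "AE x in lborel. norm ((cmod (f k x - g x))\<^sup>2) \<le> 4 * (cmod (w x))\<^sup>2" for k
      using bg
    proof eventually_elim
      case (elim x)
      then have "cmod (f k x - g x) \<le> 2 * cmod (w x)"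
        using norm_triangle_ineq4[of "f k x" "g x"] by (metis add_mono mult_2 order_trans)
      then have "(cmod (f k x - g x))\<^sup>2 \<le> (2 * cmod (w x))\<^sup>2" by (intro power_mono) auto
      then show ?case by (simp add: power_mult_distrib)
    qed
  qed measurable
  then have "(\<lambda>k. (norm (abs_ltwo (f k) - abs_ltwo g))\<^sup>2) \<longlonglongrightarrow> 0"
    by (simp add: norm_abs_ltwo[OF sqint_diff[OF f g]] flip: abs_ltwo_diff[OF f g])
  then have "(\<lambda>k. sqrt ((norm (abs_ltwo (f k) - abs_ltwo g))\<^sup>2)) \<longlonglongrightarrow> sqrt 0"
    by (rule tendsto_real_sqrt)
  then have "(\<lambda>k. norm (abs_ltwo (f k) - abs_ltwo g)) \<longlonglongrightarrow> 0" by simp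
  then show "(\<lambda>k. abs_ltwo (f k)) \<longlonglongrightarrow> abs_ltwo g"
    using LIM_zero_iff tendsto_norm_zero_iff by blast
qed

lemma sqint_bounded_support:
  assumes "f \<in> borel_measurable borel" "\<And>x. cmod (f x) \<le> C * indicator {a..b} x"
  shows "sqint f" "integrable lborel f"
proof -
  have *: "integrable lborel (\<lambda>x. c * indicat_real {a..b} x)" for c
    by (intro integrable_mult_right integrable_real_indicator) (auto simp: emeasure_lborel_Icc_eq)
  have "integrable lborel (\<lambda>x. (cmod (f x))\<^sup>2)"
  proof (rule Bochner_Integration.integrable_bound[OF *[of "C\<^sup>2"]])
    show "AE x in lborel. norm ((cmod (f x))\<^sup>2) \<le> norm (C\<^sup>2 * indicat_real {a..b} x)"
    proof (rule AE_I2)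
      fix x
      have "(cmod (f x))\<^sup>2 \<le> (C * indicator {a..b} x)\<^sup>2" using assms(2) by (intro power_mono) auto
      then show "norm ((cmod (f x))\<^sup>2) \<le> norm (C\<^sup>2 * indicat_real {a..b} x)"
        by (auto simp: indicator_def power_mult_distrib split: if_splits)
    qed
  qed (use assms(1) in measurable)
  then show "sqint f" using assms(1) by (simp add: sqint_def)
  show "integrable lborel f"
    by (rule Bochner_Integration.integrable_bound[OF *[of C]])
       (use assms in \<open>auto intro!: AE_I2 intro: order_trans[OF _ abs_ge_self]\<close>)
qed

lemma sqint_translate:
  assumes "sqint f"
  shows "sqint (\<lambda>x. f (x + z))" "nrm (\<lambda>x. f (x + z)) = nrm f"
proof -
  show s: "sqint (\<lambda>x. f (x + z))"
    using assms lborel_integrable_real_affine[OF sqint_integrable[OF assms], of 1 z]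
    by (auto simp: sqint_def add.commute)
  have "(nrm (\<lambda>x. f (x + z)))\<^sup>2 = (nrm f)\<^sup>2"
    unfolding norm_abs_ltwo[OF s] norm_abs_ltwo[OF assms]
    using lborel_integral_real_affine[of 1 "\<lambda>x. (cmod (f x))\<^sup>2" z] by (simp add: add.commute)
  then show "nrm (\<lambda>x. f (x + z)) = nrm f" by simp
qed

lemma sqint_reflect:
  assumes "sqint f"
  shows "sqint (\<lambda>x. f (- x))" "nrm (\<lambda>x. f (- x)) = nrm f"
proof -
  show s: "sqint (\<lambda>x. f (- x))"
    using assms lborel_integrable_real_affine[OF sqint_integrable[OF assms], of "-1" 0]
    by (auto simp: sqint_def)
  have "(nrm (\<lambda>x. f (- x)))\<^sup>2 = (nrm f)\<^sup>2"
    unfolding norm_abs_ltwo[OF s] norm_abs_ltwo[OF assms]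
    using lborel_integral_real_affine[of "-1" "\<lambda>x. (cmod (f x))\<^sup>2" 0] by simp
  then show "nrm (\<lambda>x. f (- x)) = nrm f" by simp
qed

text \<open>A measurable function is almost everywhere a limit of continuous functions. Once the given function
  has been truncated to a bounded one on a bounded interval, those approximants can be clipped and cut
  off continuously without changing their limit, and dominated convergence applies.\<close>

lemma compact_support_dense:
  assumes f: "sqint f" and e: "e > 0"
  obtains \<phi> :: "real \<Rightarrow> complex" and C M where "continuous_on UNIV \<phi>"
    "\<And>x. cmod (\<phi> x) \<le> C * indicator {-M..M} x" "sqint \<phi>" "norm (abs_ltwo \<phi> - abs_ltwo f) < e"
proof -
  have [measurable]: "f \<in> borel_measurable borel" using f by (rule sqint_measurable)
  define t where "t n x = (if \<bar>x\<bar> \<le> real n \<and> cmod (f x) \<le> real n then f x else 0)" for n x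
  have [measurable]: "t n \<in> borel_measurable borel" for n unfolding t_def by measurable
  have tb: "AE x in lborel. cmod (t n x) \<le> cmod (f x)" for n by (auto simp: t_def)
  have tl: "AE x in lborel. (\<lambda>n. t n x) \<longlonglongrightarrow> f x"
  proof (rule AE_I2)
    fix x
    have "\<forall>\<^sub>F n in sequentially. t n x = f x"
      using eventually_ge_at_top[of "nat \<lceil>\<bar>x\<bar>\<rceil>"] eventually_ge_at_top[of "nat \<lceil>cmod (f x)\<rceil>"]
      by eventually_elim (auto simp: t_def nat_ceiling_le_eq)
    then show "(\<lambda>n. t n x) \<longlonglongrightarrow> f x" by (rule tendsto_eventually)
  qed
  have t: "\<And>n. sqint (t n)" "(\<lambda>n. abs_ltwo (t n)) \<longlonglongrightarrow> abs_ltwo f"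
    using ltwo_dominated_convergence(1,3)[OF _ _ f tb tl] by simp_all
  obtain n where n: "norm (abs_ltwo (t n) - abs_ltwo f) < e / 2"
    using metric_LIMSEQ_D[OF t(2), of "e/2"] e by (auto simp: dist_norm)
  have "t n measurable_on UNIV"
    by (rule lebesgue_measurable_imp_measurable_on) (auto intro: measurable_completion)
  then obtain N g where N: "negligible N" and g: "\<And>k. continuous_on UNIV (g k)"
    and lim: "\<And>x. x \<notin> N \<Longrightarrow> (\<lambda>k. g k x) \<longlonglongrightarrow> t n x"
    unfolding measurable_on_def by auto
  \<comment> \<open>\<open>t n\<close> lives where \<open>|x| \<le> n\<close> and has values of modulus at most \<open>n\<close>; there \<open>clip\<close> and \<open>cut\<close> change nothing.\<close>
  define m where "m = real n + 1"
  define clip where "clip z = of_real (m / max m (cmod z)) * z" for z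
  define cut where "cut x = complex_of_real (max 0 (min 1 (m - \<bar>x\<bar>)))" for x
  define \<phi> where "\<phi> k x = cut x * clip (g k x)" for k x
  have m: "m > 0" by (simp add: m_def)
  have cclip: "continuous_on UNIV clip"
    unfolding clip_def using m by (intro continuous_intros) auto
  have ccut: "continuous_on UNIV cut" unfolding cut_def by (intro continuous_intros)
  have c\<phi>: "continuous_on UNIV (\<phi> k)" for k
    unfolding \<phi>_def by (intro continuous_intros ccut continuous_on_compose2[OF cclip g]) auto
  then have [measurable]: "\<phi> k \<in> borel_measurable borel" for k
    by (rule borel_measurable_continuous_onI)
  have bclip: "cmod (clip z) \<le> m" for z
    using m by (auto simp: clip_def norm_mult norm_divide max_def)
  have b: "cmod (\<phi> k x) \<le> m * indicator {-m..m} x" for k x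
  proof -
    have "cmod (cut x) \<le> indicator {-m..m} x" by (auto simp: cut_def indicator_def)
    then have "cmod (cut x) * cmod (clip (g k x)) \<le> indicator {-m..m} x * m"
      using bclip m by (intro mult_mono) auto
    then show ?thesis by (simp add: \<phi>_def norm_mult mult.commute)
  qed
  define w where "w x = complex_of_real (m * indicator {-m..m} x)" for x
  have [measurable]: "w \<in> borel_measurable borel" unfolding w_def by measurable
  have w: "sqint w"
    by (rule sqint_bounded_support[of _ m "-m" m]) (use m in \<open>auto simp: w_def indicator_def\<close>)
  obtain N' where N': "N' \<in> null_sets lborel" "N \<subseteq> N'"
    using N by (auto simp: negligible_iff_null_sets null_sets_completion_iff2)
  have "AE x in lborel. x \<notin> N"
    using AE_not_in[OF N'(1)] by eventually_elim (use N'(2) in auto)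
  then have l: "AE x in lborel. (\<lambda>k. \<phi> k x) \<longlonglongrightarrow> t n x"
  proof eventually_elim
    case (elim x)
    have "isCont clip (t n x)" using cclip by (simp add: continuous_on_eq_continuous_at)
    then have "(\<lambda>k. clip (g k x)) \<longlonglongrightarrow> clip (t n x)"
      using isCont_tendsto_compose[OF _ lim[OF elim]] by blast
    then have "(\<lambda>k. \<phi> k x) \<longlonglongrightarrow> cut x * clip (t n x)"
      unfolding \<phi>_def by (intro tendsto_intros)
    also have "clip (t n x) = t n x"
    proof -
      have "cmod (t n x) \<le> m" by (auto simp: t_def m_def)
      then show ?thesis using m by (simp add: clip_def max_absorb1)
    qed
    also have "cut x * t n x = t n x" by (auto simp: cut_def t_def m_def)
    finally show ?case .
  qed
  have bw: "AE x in lborel. cmod (\<phi> k x) \<le> cmod (w x)" for k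
  proof (rule AE_I2)
    fix x
    have "cmod (w x) = m * indicator {-m..m} x" using m by (simp add: w_def norm_mult)
    then show "cmod (\<phi> k x) \<le> cmod (w x)" using b by simp
  qed
  have s: "sqint (\<phi> k)" for k
    by (rule ltwo_dominated_convergence(1)[OF _ _ w bw l]) measurable
  have "(\<lambda>k. abs_ltwo (\<phi> k)) \<longlonglongrightarrow> abs_ltwo (t n)"
    by (rule ltwo_dominated_convergence(3)[OF _ _ w bw l]) measurable
  then obtain k where k: "norm (abs_ltwo (\<phi> k) - abs_ltwo (t n)) < e / 2"
    using metric_LIMSEQ_D[of "\<lambda>k. abs_ltwo (\<phi> k)" "abs_ltwo (t n)" "e/2"] e by (auto simp: dist_norm)
  have "norm (abs_ltwo (\<phi> k) - abs_ltwo f) < e"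
    using norm_triangle_ineq[of "abs_ltwo (\<phi> k) - abs_ltwo (t n)" "abs_ltwo (t n) - abs_ltwo f"] k n
    by simp
  then show ?thesis using that[OF c\<phi> b s] by blast
qed

text \<open>For continuous functions of compact support this is dominated convergence. Translations are
  isometries, so it extends to the closure of these functions.\<close>

lemma translation_continuous:
  assumes f: "sqint f" and Z: "Z \<longlonglongrightarrow> (0::real)"
  shows "(\<lambda>k. abs_ltwo (\<lambda>x. f (x + Z k))) \<longlonglongrightarrow> abs_ltwo f"
proof (rule metric_LIMSEQ_I)
  fix e :: real assume e: "e > 0"
  obtain \<phi> C M where \<phi>: "continuous_on UNIV \<phi>" "\<And>x. cmod (\<phi> x) \<le> C * indicator {-M..M} x"
    "sqint \<phi>" "norm (abs_ltwo \<phi> - abs_ltwo f) < e / 3"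
    using compact_support_dense[OF f, of "e/3"] e by auto
  have [measurable]: "\<phi> \<in> borel_measurable borel" using \<phi>(3) by (rule sqint_measurable)
  obtain B where B: "\<And>k. \<bar>Z k\<bar> \<le> B"
    using Z convergent_imp_Bseq[of Z] by (auto simp: convergent_def Bseq_def)
  define w where "w x = complex_of_real (\<bar>C\<bar> * indicator {-(M+B)..M+B} x)" for x
  have [measurable]: "w \<in> borel_measurable borel" unfolding w_def by measurable
  have w: "sqint w"
    by (rule sqint_bounded_support[of _ "\<bar>C\<bar>" "-(M+B)" "M+B"]) (auto simp: w_def indicator_def)
  have "(\<lambda>k. abs_ltwo (\<lambda>x. \<phi> (x + Z k))) \<longlonglongrightarrow> abs_ltwo \<phi>"
  proof (rule ltwo_dominated_convergence[OF _ _ w])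
    show "AE x in lborel. cmod (\<phi> (x + Z k)) \<le> cmod (w x)" for k
    proof (rule AE_I2)
      fix x
      show "cmod (\<phi> (x + Z k)) \<le> cmod (w x)"
      proof (cases "x + Z k \<in> {-M..M}")
        case True
        then have "x \<in> {-(M+B)..M+B}" using B[of k] by auto
        then show ?thesis using \<phi>(2)[of "x + Z k"] True by (simp add: w_def)
      next
        case False
        then show ?thesis using \<phi>(2)[of "x + Z k"] by simp
      qed
    qed
    show "AE x in lborel. (\<lambda>k. \<phi> (x + Z k)) \<longlonglongrightarrow> \<phi> x"
    proof (rule AE_I2)
      fix x
      have "isCont \<phi> x" using \<phi>(1) by (simp add: continuous_on_eq_continuous_at)
      moreover have "(\<lambda>k. x + Z k) \<longlonglongrightarrow> x" using tendsto_add[OF tendsto_const Z, of x] by simp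
      ultimately show "(\<lambda>k. \<phi> (x + Z k)) \<longlonglongrightarrow> \<phi> x" by (rule isCont_tendsto_compose)
    qed
  qed measurable
  then obtain K where K: "\<And>k. k \<ge> K \<Longrightarrow> norm (abs_ltwo (\<lambda>x. \<phi> (x + Z k)) - abs_ltwo \<phi>) < e / 3"
    using metric_LIMSEQ_D[of "\<lambda>k. abs_ltwo (\<lambda>x. \<phi> (x + Z k))" "abs_ltwo \<phi>" "e/3"] e
    by (auto simp: dist_norm)
  have "dist (abs_ltwo (\<lambda>x. f (x + Z k))) (abs_ltwo f) < e" if "k \<ge> K" for k
  proof -
    have "norm (abs_ltwo (\<lambda>x. \<phi> (x + Z k)) - abs_ltwo (\<lambda>x. f (x + Z k))) = norm (abs_ltwo \<phi> - abs_ltwo f)"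
      using sqint_translate[OF sqint_diff[OF \<phi>(3) f], of "Z k"]
      by (simp add: abs_ltwo_diff \<phi>(3) f sqint_translate)
    then show ?thesis
      using K[OF that] \<phi>(4) norm_triangle_ineq4[of "abs_ltwo (\<lambda>x. \<phi> (x + Z k)) - abs_ltwo \<phi>"
          "abs_ltwo (\<lambda>x. \<phi> (x + Z k)) - abs_ltwo (\<lambda>x. f (x + Z k))"]
        norm_triangle_ineq[of "abs_ltwo (\<lambda>x. f (x + Z k)) - abs_ltwo \<phi>" "abs_ltwo \<phi> - abs_ltwo f"]
      by (simp add: dist_norm)
  qed
  then show "\<exists>no. \<forall>n\<ge>no. dist (abs_ltwo (\<lambda>x. f (x + Z n))) (abs_ltwo f) < e" by blast
qed

definition ft :: "(real \<Rightarrow> complex) \<Rightarrow> real \<Rightarrow> complex" where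
  "ft f \<xi> = of_real (1 / sqrt (2 * pi)) * (LBINT x. exp (- \<i> * of_real (\<xi> * x)) * f x)"

text \<open>The constant is the one for which \<open>ft\<close> takes \<open>conv\<close> to the pointwise product.\<close>

definition conv :: "(real \<Rightarrow> complex) \<Rightarrow> (real \<Rightarrow> complex) \<Rightarrow> real \<Rightarrow> complex" where
  "conv f g x = of_real (1 / sqrt (2 * pi)) * (LBINT y. f (x - y) * g y)"

lemma ft_measurable [measurable]:
  assumes [measurable]: "f \<in> borel_measurable borel" shows "ft f \<in> borel_measurable borel"
  unfolding ft_def by measurable

lemma conv_measurable [measurable]:
  assumes [measurable]: "f \<in> borel_measurable borel" "g \<in> borel_measurable borel"
  shows "conv f g \<in> borel_measurable borel"
  unfolding conv_def by measurable

lemma ft_integrable: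
  assumes "integrable lborel f"
  shows "integrable lborel (\<lambda>x. exp (- \<i> * of_real (\<xi> * x)) * f x)"
  by (rule Bochner_Integration.integrable_bound[OF assms])
     (use assms in \<open>auto simp: norm_mult norm_exp_eq_Re dest!: borel_measurable_integrable\<close>)

lemma ft_bound:
  assumes "integrable lborel f"
  shows "cmod (ft f \<xi>) \<le> 1 / sqrt (2 * pi) * (LBINT x. cmod (f x))"
proof -
  have "cmod (LBINT x. exp (- \<i> * of_real (\<xi> * x)) * f x)
      \<le> (LBINT x. cmod (exp (- \<i> * of_real (\<xi> * x)) * f x))"
    by (rule integral_norm_bound)
  also have "\<dots> = (LBINT x. cmod (f x))"
    by (simp add: norm_mult norm_exp_eq_Re)
  finally show ?thesis by (simp add: ft_def norm_mult divide_right_mono norm_divide)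
qed

lemma conv_integrable2:
  fixes f g :: "real \<Rightarrow> complex" and \<xi> :: real
  assumes f: "integrable lborel f" and g: "integrable lborel g"
  shows "integrable (lborel \<Otimes>\<^sub>M lborel) (\<lambda>(y, x). exp (- \<i> * of_real (\<xi> * x)) * (f (x - y) * g y))"
proof (rule lborel_pair.Fubini_integrable)
  have [measurable]: "f \<in> borel_measurable borel" "g \<in> borel_measurable borel"
    using f g by (auto dest: borel_measurable_integrable)
  show "(\<lambda>(y, x). exp (- \<i> * of_real (\<xi> * x)) * (f (x - y) * g y)) \<in> borel_measurable (lborel \<Otimes>\<^sub>M lborel)"
    by measurable
  have fs: "integrable lborel (\<lambda>x. f (x - y))" for y
    using lborel_integrable_real_affine[OF f, of 1 "- y"] by simp
  have "(LBINT x. cmod (f (x - y))) = (LBINT x. cmod (f x))" for y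
    using lborel_integral_real_affine[of 1 "\<lambda>x. cmod (f x)" "-y"] by simp
  then show "integrable lborel (\<lambda>y. LBINT x. norm (case (y, x) of (y, x) \<Rightarrow> exp (- \<i> * of_real (\<xi> * x)) * (f (x - y) * g y)))"
    using integrable_norm[OF g] by (simp add: norm_mult norm_exp_eq_Re)
  show "AE y in lborel. integrable lborel (\<lambda>x. case (y, x) of (y, x) \<Rightarrow> exp (- \<i> * of_real (\<xi> * x)) * (f (x - y) * g y))"
  proof (rule AE_I2)
    fix y
    have "integrable lborel (\<lambda>x. (exp (- \<i> * of_real (\<xi> * x)) * f (x - y)) * g y)"
      by (intro integrable_mult_left ft_integrable fs)
    then show "integrable lborel (\<lambda>x. case (y, x) of (y, x) \<Rightarrow> exp (- \<i> * of_real (\<xi> * x)) * (f (x - y) * g y))"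
      by (simp add: mult.assoc)
  qed
qed

lemma ft_conv:
  assumes f: "integrable lborel f" and g: "integrable lborel g"
  shows "integrable lborel (conv f g)" "ft (conv f g) \<xi> = ft f \<xi> * ft g \<xi>"
proof -
  let ?c = "complex_of_real (1 / sqrt (2 * pi))"
  have "integrable lborel (\<lambda>x. LBINT y. exp (- \<i> * of_real (0 * x)) * (f (x - y) * g y))"
    using lborel_pair.integrable_snd[OF conv_integrable2[OF f g, of 0]] by simp
  then show "integrable lborel (conv f g)" unfolding conv_def by simp
  have "(LBINT x. exp (- \<i> * of_real (\<xi> * x)) * conv f g x)
      = ?c * (LBINT x. (LBINT y. exp (- \<i> * of_real (\<xi> * x)) * (f (x - y) * g y)))"
  proof -
    have "exp (- \<i> * of_real (\<xi> * x)) * conv f g x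
        = ?c * (LBINT y. exp (- \<i> * of_real (\<xi> * x)) * (f (x - y) * g y))" for x
      unfolding conv_def integral_mult_right_zero by simp
    then show ?thesis by simp
  qed
  also have "(LBINT x. (LBINT y. exp (- \<i> * of_real (\<xi> * x)) * (f (x - y) * g y)))
     = (LBINT y. (LBINT x. exp (- \<i> * of_real (\<xi> * x)) * (f (x - y) * g y)))"
    by (rule lborel_pair.Fubini_integral[OF conv_integrable2[OF f g, of \<xi>]])
  also have "\<dots> = (LBINT y. (LBINT x. exp (- \<i> * of_real (\<xi> * x)) * f x) * (exp (- \<i> * of_real (\<xi> * y)) * g y))"
  proof (rule Bochner_Integration.integral_cong[OF refl])
    fix y
    have "(LBINT x. exp (- \<i> * of_real (\<xi> * x)) * (f (x - y) * g y))
        = (LBINT x. exp (- \<i> * of_real (\<xi> * (y + x))) * (f x * g y))"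
      using lborel_integral_real_affine[of 1 "\<lambda>x. exp (- \<i> * of_real (\<xi> * x)) * (f (x - y) * g y)" y] by simp
    also have "\<dots> = (LBINT x. (exp (- \<i> * of_real (\<xi> * x)) * f x) * (exp (- \<i> * of_real (\<xi> * y)) * g y))"
      by (intro Bochner_Integration.integral_cong) (auto simp: algebra_simps exp_add exp_diff exp_minus divide_inverse)
    finally show "(LBINT x. exp (- \<i> * of_real (\<xi> * x)) * (f (x - y) * g y)) =
      (LBINT x. exp (- \<i> * of_real (\<xi> * x)) * f x) * (exp (- \<i> * of_real (\<xi> * y)) * g y)" by simp
  qed
  finally show "ft (conv f g) \<xi> = ft f \<xi> * ft g \<xi>" by (simp add: ft_def)
qed

text \<open>Both sides are the double integral of \<open>exp (- \<i> \<xi> x) f x g \<xi>\<close>.\<close>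

lemma ft_multiplication_formula:
  assumes f: "integrable lborel f" and g: "integrable lborel g"
  shows "(LBINT \<xi>. ft f \<xi> * g \<xi>) = (LBINT x. f x * ft g x)"
proof -
  let ?c = "complex_of_real (1 / sqrt (2 * pi))"
  have [measurable]: "f \<in> borel_measurable borel" "g \<in> borel_measurable borel"
    using f g by (auto dest: borel_measurable_integrable)
  have i: "integrable (lborel \<Otimes>\<^sub>M lborel) (\<lambda>(x, \<xi>). exp (- \<i> * of_real (\<xi> * x)) * f x * g \<xi>)"
  proof (rule lborel_pair.Fubini_integrable)
    show "(\<lambda>(x, \<xi>). exp (- \<i> * of_real (\<xi> * x)) * f x * g \<xi>) \<in> borel_measurable (lborel \<Otimes>\<^sub>M lborel)"
      by measurable
    show "integrable lborel (\<lambda>x. LBINT \<xi>. norm (case (x, \<xi>) of (x, \<xi>) \<Rightarrow> exp (- \<i> * of_real (\<xi> * x)) * f x * g \<xi>))"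
      using integrable_norm[OF f] by (simp add: norm_mult norm_exp_eq_Re)
    show "AE x in lborel. integrable lborel (\<lambda>\<xi>. case (x, \<xi>) of (x, \<xi>) \<Rightarrow> exp (- \<i> * of_real (\<xi> * x)) * f x * g \<xi>)"
    proof (rule AE_I2)
      fix x
      have "integrable lborel (\<lambda>\<xi>. f x * (exp (- \<i> * of_real (x * \<xi>)) * g \<xi>))"
        by (intro integrable_mult_right ft_integrable g)
      then show "integrable lborel (\<lambda>\<xi>. case (x, \<xi>) of (x, \<xi>) \<Rightarrow> exp (- \<i> * of_real (\<xi> * x)) * f x * g \<xi>)"
        by (simp add: mult_ac)
    qed
  qed
  have "(LBINT \<xi>. ft f \<xi> * g \<xi>) = ?c * (LBINT \<xi>. (LBINT x. exp (- \<i> * of_real (\<xi> * x)) * f x * g \<xi>))"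
  proof -
    have "ft f \<xi> * g \<xi> = ?c * (LBINT x. exp (- \<i> * of_real (\<xi> * x)) * f x * g \<xi>)" for \<xi>
      unfolding ft_def integral_mult_left_zero by simp
    then show ?thesis by simp
  qed
  also have "(LBINT \<xi>. (LBINT x. exp (- \<i> * of_real (\<xi> * x)) * f x * g \<xi>))
    = (LBINT x. (LBINT \<xi>. exp (- \<i> * of_real (\<xi> * x)) * f x * g \<xi>))"
    by (rule lborel_pair.Fubini_integral[OF i])
  also have "\<dots> = (LBINT x. f x * (LBINT \<xi>. exp (- \<i> * of_real (x * \<xi>)) * g \<xi>))"
    by (intro Bochner_Integration.integral_cong[OF refl])
       (subst integral_mult_right_zero[symmetric], simp add: mult_ac)
  also have "?c * \<dots> = (LBINT x. f x * ft g x)"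
    unfolding ft_def by (subst integral_mult_right_zero[symmetric]) (simp add: mult_ac)
  finally show ?thesis .
qed

text \<open>Up to scaling this is the characteristic function of the standard normal distribution.\<close>

lemma ft_gaussian:
  assumes n: "n > 0"
  shows "integrable lborel (\<lambda>\<xi>. complex_of_real (exp (- (\<xi> / n)\<^sup>2 / 2)))"
    "ft (\<lambda>\<xi>. complex_of_real (exp (- (\<xi> / n)\<^sup>2 / 2))) z = of_real (n * sqrt (2 * pi) * std_normal_density (n * z))"
proof -
  have g: "exp (- (x / n)\<^sup>2 / 2) = sqrt (2 * pi) * std_normal_density (x / n)" for x
    by (simp add: std_normal_density_def)
  have "integrable lborel (\<lambda>x. sqrt (2 * pi) * std_normal_density (0 + (1 / n) * x))"
    by (intro integrable_mult_right lborel_integrable_real_affine) (use n in auto)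
  then have "integrable lborel (\<lambda>\<xi>. exp (- (\<xi> / n)\<^sup>2 / 2))" unfolding g by simp
  then show "integrable lborel (\<lambda>\<xi>. complex_of_real (exp (- (\<xi> / n)\<^sup>2 / 2)))"
    by (rule integrable_of_real)
  have "of_real (exp (- (n * z)\<^sup>2 / 2)) = char std_normal_distribution (- (n * z))"
    by (simp add: char_std_normal_distribution)
  also have "\<dots> = (LBINT x. std_normal_density x *\<^sub>R iexp (- (n * z) * x))"
    unfolding char_def by (subst integral_density) (auto simp: normal_density_nonneg)
  finally have c: "(LBINT x. std_normal_density x *\<^sub>R iexp (- (n * z) * x)) = of_real (exp (- (n * z)\<^sup>2 / 2))" ..
  have "(LBINT \<xi>. exp (- \<i> * of_real (z * \<xi>)) * of_real (exp (- (\<xi> / n)\<^sup>2 / 2)))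
     = n *\<^sub>R (LBINT x. exp (- \<i> * of_real (z * (n * x))) * of_real (exp (- x\<^sup>2 / 2)))"
    using lborel_integral_real_affine[of n "\<lambda>\<xi>. exp (- \<i> * of_real (z * \<xi>)) * complex_of_real (exp (- (\<xi> / n)\<^sup>2 / 2))" 0] n
    by simp
  also have "(LBINT x. exp (- \<i> * of_real (z * (n * x))) * of_real (exp (- x\<^sup>2 / 2)))
    = (LBINT x. of_real (sqrt (2 * pi)) * (std_normal_density x *\<^sub>R iexp (- (n * z) * x)))"
    by (intro Bochner_Integration.integral_cong[OF refl])
       (simp add: std_normal_density_def scaleR_conv_of_real mult_ac)
  also have "\<dots> = of_real (sqrt (2 * pi)) * of_real (exp (- (n * z)\<^sup>2 / 2))"
    unfolding integral_mult_right_zero c ..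
  finally show "ft (\<lambda>\<xi>. complex_of_real (exp (- (\<xi> / n)\<^sup>2 / 2))) z = of_real (n * sqrt (2 * pi) * std_normal_density (n * z))"
    by (simp add: ft_def std_normal_density_def scaleR_conv_of_real)
qed

text \<open>With \<open>f' x = cnj (f (- x))\<close>, the function \<open>|ft f|\<^sup>2\<close> is the transform of \<open>conv f f'\<close>. The
  multiplication formula therefore turns the integral of \<open>|ft f|\<^sup>2\<close> against a Gaussian of width \<open>n\<close> into the
  mean of the autocorrelation of \<open>f\<close> against a normal density of width \<open>1/n\<close>. As \<open>n\<close> grows, the first
  increases to the squared norm of \<open>ft f\<close>, and the second tends to the autocorrelation at \<open>0\<close>, which is the
  squared norm of \<open>f\<close>, because translations are continuous in \<open>L\<^sup>2\<close>.\<close>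

lemma plancherel_L1:
  assumes f: "integrable lborel f" and s: "sqint f"
  shows "sqint (ft f)" "nrm (ft f) = nrm f"
proof -
  have [measurable]: "f \<in> borel_measurable borel" using s by (rule sqint_measurable)
  define f' where "f' x = cnj (f (- x))" for x
  have f': "integrable lborel f'"
    using lborel_integrable_real_affine[OF f, of "-1" 0] unfolding f'_def by (simp add: integrable_cnj)
  have ftf': "ft f' \<xi> = cnj (ft f \<xi>)" for \<xi>
  proof -
    have "(LBINT x. exp (- \<i> * of_real (\<xi> * x)) * f' x)
      = (LBINT x. cnj (exp (- \<i> * of_real (\<xi> * x)) * f x))"
      using lborel_integral_real_affine[of "-1" "\<lambda>x. exp (- \<i> * of_real (\<xi> * x)) * f' x" 0]
      by (simp add: f'_def exp_cnj)
    also have "\<dots> = cnj (LBINT x. exp (- \<i> * of_real (\<xi> * x)) * f x)"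
      by (rule Bochner_Integration.integral_cnj)
    finally show ?thesis unfolding ft_def by simp
  qed
  define A where "A z = abs_ltwo f \<bullet> abs_ltwo (\<lambda>x. f (x + z))" for z
  have A: "A z = sqrt (2 * pi) * Re (conv f f' z)" for z
  proof -
    have i: "integrable lborel (\<lambda>y. cnj (f y) * f (y + z))"
      by (intro integrable_mult_sqint sqint_cnj s sqint_translate)
    have "A z = Re (LBINT y. cnj (f y) * f (y + z))"
      unfolding A_def inner_abs_ltwo[OF s sqint_translate(1)[OF s]] by (rule integral_Re[OF i])
    also have "(LBINT y. cnj (f y) * f (y + z)) = (LBINT y. f (z - y) * f' y)"
      using lborel_integral_real_affine[of "-1" "\<lambda>y. f (z - y) * f' y" 0]
      by (simp add: f'_def mult.commute add.commute)
    finally show ?thesis by (simp add: conv_def)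
  qed
  have [measurable]: "conv f f' \<in> borel_measurable borel" unfolding f'_def by measurable
  have Am [measurable]: "A \<in> borel_measurable borel" unfolding A by measurable
  have Ab: "\<bar>A z\<bar> \<le> (nrm f)\<^sup>2" for z
    using Cauchy_Schwarz_ineq2[of "abs_ltwo f" "abs_ltwo (\<lambda>x. f (x + z))"] sqint_translate[OF s, of z]
    by (simp add: A_def power2_eq_square)
  have key: "(LBINT \<xi>. (cmod (ft f \<xi>))\<^sup>2 * exp (- (\<xi> / n)\<^sup>2 / 2)) = (LBINT w. std_normal_density w * A (w / n))"
    "integrable lborel (\<lambda>\<xi>. (cmod (ft f \<xi>))\<^sup>2 * exp (- (\<xi> / n)\<^sup>2 / 2))" if n: "n > 0" for n
  proof -
    let ?G = "\<lambda>\<xi>. complex_of_real (exp (- (\<xi> / n)\<^sup>2 / 2))"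
    define B where "B = (1 / sqrt (2 * pi) * (LBINT x. cmod (f x)))\<^sup>2"
    have sq: "complex_of_real ((cmod (ft f \<xi>))\<^sup>2 * exp (- (\<xi> / n)\<^sup>2 / 2)) = ft (conv f f') \<xi> * ?G \<xi>" for \<xi>
      unfolding ft_conv[OF f f'] ftf' complex_norm_square of_real_mult by simp
    show i: "integrable lborel (\<lambda>\<xi>. (cmod (ft f \<xi>))\<^sup>2 * exp (- (\<xi> / n)\<^sup>2 / 2))"
    proof (rule Bochner_Integration.integrable_bound)
      show "integrable lborel (\<lambda>\<xi>. of_real B * ?G \<xi>)" by (intro integrable_mult_right ft_gaussian n)
      show "AE \<xi> in lborel. norm ((cmod (ft f \<xi>))\<^sup>2 * exp (- (\<xi> / n)\<^sup>2 / 2)) \<le> norm (of_real B * ?G \<xi>)"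
      proof (rule AE_I2)
        fix \<xi>
        have "(cmod (ft f \<xi>))\<^sup>2 \<le> B" unfolding B_def by (intro power_mono ft_bound f) auto
        then show "norm ((cmod (ft f \<xi>))\<^sup>2 * exp (- (\<xi> / n)\<^sup>2 / 2)) \<le> norm (of_real B * ?G \<xi>)"
          by (simp add: norm_mult)
      qed
    qed measurable
    have "complex_of_real (LBINT \<xi>. (cmod (ft f \<xi>))\<^sup>2 * exp (- (\<xi> / n)\<^sup>2 / 2))
        = (LBINT \<xi>. ft (conv f f') \<xi> * ?G \<xi>)"
      unfolding sq[symmetric] by (rule integral_complex_of_real[symmetric])
    also have "\<dots> = (LBINT z. conv f f' z * ft ?G z)"
      by (intro ft_multiplication_formula ft_conv f f' ft_gaussian n)
    also have "\<dots> = (1 / n) *\<^sub>R (LBINT w. conv f f' (w / n) * ft ?G (w / n))"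
      using lborel_integral_real_affine[of "1/n" "\<lambda>z. conv f f' z * ft ?G z" 0] n by simp
    also have "\<dots> = (LBINT w. of_real (sqrt (2 * pi) * std_normal_density w) * conv f f' (w / n))"
      unfolding ft_gaussian(2)[OF n] integral_scaleR_right[symmetric]
      using n by (intro Bochner_Integration.integral_cong) (auto simp: scaleR_conv_of_real field_simps)
    finally have e: "complex_of_real (LBINT \<xi>. (cmod (ft f \<xi>))\<^sup>2 * exp (- (\<xi> / n)\<^sup>2 / 2))
      = (LBINT w. of_real (sqrt (2 * pi) * std_normal_density w) * conv f f' (w / n))" .
    have "integrable lborel (\<lambda>w. of_real (sqrt (2 * pi) * std_normal_density w) * conv f f' (w / n))"
    proof (rule Bochner_Integration.integrable_bound)
      show "integrable lborel (\<lambda>w. conv f f' (0 + (1/n) * w))"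
        by (intro lborel_integrable_real_affine ft_conv f f') (use n in auto)
      show "AE w in lborel. norm (of_real (sqrt (2 * pi) * std_normal_density w) * conv f f' (w / n))
         \<le> norm (conv f f' (0 + (1/n) * w))"
        by (auto simp: norm_mult std_normal_density_def real_sqrt_mult intro!: mult_left_le_one_le AE_I2)
    qed measurable
    from integral_Re[OF this] arg_cong[OF e, of Re]
    show "(LBINT \<xi>. (cmod (ft f \<xi>))\<^sup>2 * exp (- (\<xi> / n)\<^sup>2 / 2)) = (LBINT w. std_normal_density w * A (w / n))"
      by (simp add: A mult_ac)
  qed
  \<comment> \<open>The Gaussian means of \<open>|ft f|\<^sup>2\<close>, which increase with \<open>k\<close>.\<close>
  define J where "J k \<xi> = (cmod (ft f \<xi>))\<^sup>2 * exp (- (\<xi> / real (Suc k))\<^sup>2 / 2)" for k \<xi>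
  have lim: "(\<lambda>k. LBINT \<xi>. J k \<xi>) \<longlonglongrightarrow> (LBINT w. std_normal_density w * (nrm f)\<^sup>2)"
    unfolding J_def key(1)[OF of_nat_0_less_iff[THEN iffD2, OF zero_less_Suc]]
  proof (rule integral_dominated_convergence)
    show "integrable lborel (\<lambda>w. std_normal_density w * (nrm f)\<^sup>2)" by simp
    show "AE w in lborel. norm (std_normal_density w * A (w / real (Suc k))) \<le> std_normal_density w * (nrm f)\<^sup>2" for k
      using Ab by (auto simp: abs_mult intro!: AE_I2 mult_left_mono)
    show "AE w in lborel. (\<lambda>k. std_normal_density w * A (w / real (Suc k))) \<longlonglongrightarrow> std_normal_density w * (nrm f)\<^sup>2"
    proof (rule AE_I2)
      fix w
      have "(\<lambda>k. w / real (Suc k)) \<longlonglongrightarrow> 0"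
        using tendsto_mult[OF tendsto_const LIMSEQ_inverse_real_of_nat, of w] by (simp add: divide_inverse)
      then have "(\<lambda>k. A (w / real (Suc k))) \<longlonglongrightarrow> abs_ltwo f \<bullet> abs_ltwo f"
        unfolding A_def by (intro tendsto_intros translation_continuous s)
      then show "(\<lambda>k. std_normal_density w * A (w / real (Suc k))) \<longlonglongrightarrow> std_normal_density w * (nrm f)\<^sup>2"
        unfolding power2_norm_eq_inner by (intro tendsto_intros)
    qed
  qed measurable
  have mono: "AE \<xi> in lborel. mono (\<lambda>k. J k \<xi>)"
  proof (intro AE_I2 monoI)
    fix \<xi> and k l :: nat assume "k \<le> l"
    then have "\<bar>\<xi> / real (Suc l)\<bar> \<le> \<bar>\<xi> / real (Suc k)\<bar>" by (auto intro!: divide_left_mono)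
    then have "(\<xi> / real (Suc l))\<^sup>2 \<le> (\<xi> / real (Suc k))\<^sup>2" by (simp only: abs_le_square_iff)
    then show "J k \<xi> \<le> J l \<xi>" unfolding J_def by (intro mult_left_mono) auto
  qed
  have pt: "AE \<xi> in lborel. (\<lambda>k. J k \<xi>) \<longlonglongrightarrow> (cmod (ft f \<xi>))\<^sup>2"
  proof (rule AE_I2)
    fix \<xi>
    have "(\<lambda>k. \<xi> / real (Suc k)) \<longlonglongrightarrow> 0"
      using tendsto_mult[OF tendsto_const LIMSEQ_inverse_real_of_nat, of \<xi>] by (simp add: divide_inverse)
    then have "(\<lambda>k. (cmod (ft f \<xi>))\<^sup>2 * exp (- (\<xi> / real (Suc k))\<^sup>2 / 2)) \<longlonglongrightarrow> (cmod (ft f \<xi>))\<^sup>2 * exp (- 0\<^sup>2 / 2)"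
      by (intro tendsto_intros) auto
    then show "(\<lambda>k. J k \<xi>) \<longlonglongrightarrow> (cmod (ft f \<xi>))\<^sup>2" by (simp add: J_def)
  qed
  have Ji: "integrable lborel (J k)" for k unfolding J_def by (rule key(2)) simp
  have m: "(\<lambda>\<xi>. (cmod (ft f \<xi>))\<^sup>2) \<in> borel_measurable lborel" by measurable
  have i: "integrable lborel (\<lambda>\<xi>. (cmod (ft f \<xi>))\<^sup>2)"
    by (rule integrable_monotone_convergence[OF Ji mono pt lim m])
  then show sf: "sqint (ft f)" by (simp add: sqint_def)
  have "(nrm (ft f))\<^sup>2 = (nrm f)\<^sup>2"
    unfolding norm_abs_ltwo[OF sf] integral_monotone_convergence[OF Ji mono pt lim m] by simp
  then show "nrm (ft f) = nrm f" by simp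
qed

lemma ft_linear:
  assumes "integrable lborel f" "integrable lborel g"
  shows "ft (\<lambda>x. f x + g x) = (\<lambda>\<xi>. ft f \<xi> + ft g \<xi>)" "ft (\<lambda>x. f x - g x) = (\<lambda>\<xi>. ft f \<xi> - ft g \<xi>)"
    "ft (\<lambda>x. c * f x) = (\<lambda>\<xi>. c * ft f \<xi>)"
proof -
  have i: "integrable lborel (\<lambda>x. exp (- \<i> * of_real (\<xi> * x)) * f x)"
     "integrable lborel (\<lambda>x. exp (- \<i> * of_real (\<xi> * x)) * g x)" for \<xi>
    by (rule ft_integrable[OF assms(1)], rule ft_integrable[OF assms(2)])
  show "ft (\<lambda>x. f x + g x) = (\<lambda>\<xi>. ft f \<xi> + ft g \<xi>)"
    using i unfolding ft_def distrib_left by (subst Bochner_Integration.integral_add) (auto simp: distrib_left)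
  show "ft (\<lambda>x. f x - g x) = (\<lambda>\<xi>. ft f \<xi> - ft g \<xi>)"
    using i unfolding ft_def right_diff_distrib by (subst Bochner_Integration.integral_diff) (auto simp: right_diff_distrib)
  have "(LBINT x. exp (- \<i> * of_real (\<xi> * x)) * (c * f x))
    = c * (LBINT x. exp (- \<i> * of_real (\<xi> * x)) * f x)" for \<xi>
    unfolding integral_mult_right_zero[symmetric] by (simp only: mult.left_commute)
  then show "ft (\<lambda>x. c * f x) = (\<lambda>\<xi>. c * ft f \<xi>)"
    unfolding ft_def by (simp only: mult.left_commute)
qed

definition trunc :: "real \<Rightarrow> (real \<Rightarrow> complex) \<Rightarrow> real \<Rightarrow> complex" where
  "trunc R f x = indicator {-R..R} x * f x"

lemma fourier_trunc_eq: "fourier_trunc R f = ft (trunc R f)"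
  by (auto simp: fun_eq_iff fourier_trunc_def ft_def trunc_def set_lebesgue_integral_def indicator_def
      intro!: Bochner_Integration.integral_cong arg_cong2[where f="(*)"])

lemma sqint_trunc:
  assumes "sqint f" shows "sqint (trunc R f)" "integrable lborel (trunc R f)"
proof -
  show "sqint (trunc R f)" unfolding trunc_def by (rule sqint_restrict[OF assms]) simp
  have "sqint (\<lambda>x. indicator {-R..R} x)"
    by (rule sqint_bounded_support[of _ 1 "-R" R]) (auto simp: indicator_def)
  then show "integrable lborel (trunc R f)"
    unfolding trunc_def by (rule integrable_mult_sqint[OF _ assms])
qed

lemma trunc_tendsto:
  assumes f: "sqint f" and X: "filterlim X at_top sequentially"
  shows "(\<lambda>k. abs_ltwo (trunc (X k) f)) \<longlonglongrightarrow> abs_ltwo f"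
proof (rule ltwo_dominated_convergence(3)[OF _ _ f])
  show "trunc (X k) f \<in> borel_measurable borel" for k by (rule sqint_measurable[OF sqint_trunc(1)[OF f]])
  show "f \<in> borel_measurable borel" using f by (rule sqint_measurable)
  show "AE x in lborel. cmod (trunc (X k) f x) \<le> cmod (f x)" for k
    by (auto simp: trunc_def indicator_def)
  show "AE x in lborel. (\<lambda>k. trunc (X k) f x) \<longlonglongrightarrow> f x"
  proof (rule AE_I2)
    fix x
    have "\<forall>\<^sub>F k in sequentially. \<bar>x\<bar> \<le> X k" using X by (simp add: filterlim_at_top)
    then have "\<forall>\<^sub>F k in sequentially. trunc (X k) f x = f x"
      by eventually_elim (auto simp: trunc_def indicator_def)
    then show "(\<lambda>k. trunc (X k) f x) \<longlonglongrightarrow> f x" by (rule tendsto_eventually)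
  qed
qed

lemma sqint_fourier_trunc: "sqint f \<Longrightarrow> sqint (fourier_trunc R f)"
  unfolding fourier_trunc_eq by (intro plancherel_L1 sqint_trunc)

lemma norm_ft_diff:
  assumes "integrable lborel f" "sqint f" "integrable lborel g" "sqint g"
  shows "norm (abs_ltwo (ft f) - abs_ltwo (ft g)) = norm (abs_ltwo f - abs_ltwo g)"
  using plancherel_L1[of "\<lambda>x. f x - g x"] assms
  by (simp add: sqint_diff ft_linear abs_ltwo_diff[symmetric] plancherel_L1)

definition four :: "ltwo \<Rightarrow> ltwo" where
  "four x = lim (\<lambda>n::nat. abs_ltwo (fourier_trunc (real n) (rep_ltwo x)))"

lemma fourier_trunc_cong:
  assumes "sqint f" "sqint g" "AE x in lborel. f x = g x"
  shows "fourier_trunc R f = fourier_trunc R g"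
proof -
  have [measurable]: "f \<in> borel_measurable borel" "g \<in> borel_measurable borel"
    using assms by (auto intro: sqint_measurable)
  have "(LBINT x. exp (- \<i> * of_real (\<xi> * x)) * (indicator {-R..R} x * f x)) =
      (LBINT x. exp (- \<i> * of_real (\<xi> * x)) * (indicator {-R..R} x * g x))" for \<xi>
    by (rule integral_cong_AE) (use assms(3) in \<open>auto elim: eventually_mono\<close>)
  then show ?thesis unfolding fourier_trunc_eq ft_def trunc_def by simp
qed

text \<open>Truncations converge in norm, and \<open>ft\<close> preserves the distances between them.\<close>

lemma four_tendsto:
  assumes f: "sqint f"
  shows "((\<lambda>R. abs_ltwo (fourier_trunc R f)) \<longlongrightarrow> four (abs_ltwo f)) at_top"
proof -
  have d: "norm (abs_ltwo (fourier_trunc R f) - abs_ltwo (fourier_trunc S f))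
      = norm (abs_ltwo (trunc R f) - abs_ltwo (trunc S f))" for R S
    unfolding fourier_trunc_eq by (intro norm_ft_diff sqint_trunc f)
  have t: "(\<lambda>n. abs_ltwo (trunc (real n) f)) \<longlonglongrightarrow> abs_ltwo f"
    by (rule trunc_tendsto[OF f filterlim_real_sequentially])
  have "Cauchy (\<lambda>n. abs_ltwo (trunc (real n) f))" using t by (rule LIMSEQ_imp_Cauchy)
  then have "Cauchy (\<lambda>n. abs_ltwo (fourier_trunc (real n) f))"
    by (simp add: Cauchy_def dist_norm d)
  then have "convergent (\<lambda>n. abs_ltwo (fourier_trunc (real n) f))" by (simp add: Cauchy_convergent_iff)
  then have l: "(\<lambda>n. abs_ltwo (fourier_trunc (real n) f)) \<longlonglongrightarrow> four (abs_ltwo f)"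
    unfolding four_def convergent_LIMSEQ_iff
    using fourier_trunc_cong[OF sqint_rep f rep_abs_ltwo[OF f]] by simp
  have dl: "norm (abs_ltwo (fourier_trunc R f) - four (abs_ltwo f)) = norm (abs_ltwo (trunc R f) - abs_ltwo f)" for R
  proof (rule LIMSEQ_unique)
    show "(\<lambda>n. norm (abs_ltwo (fourier_trunc R f) - abs_ltwo (fourier_trunc (real n) f)))
      \<longlonglongrightarrow> norm (abs_ltwo (fourier_trunc R f) - four (abs_ltwo f))"
      by (intro tendsto_intros l)
    show "(\<lambda>n. norm (abs_ltwo (fourier_trunc R f) - abs_ltwo (fourier_trunc (real n) f)))
      \<longlonglongrightarrow> norm (abs_ltwo (trunc R f) - abs_ltwo f)"
      unfolding d by (intro tendsto_intros t)
  qed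
  show ?thesis
  proof (rule tendsto_at_topI_sequentially)
    fix X :: "nat \<Rightarrow> real" assume X: "filterlim X at_top sequentially"
    have "(\<lambda>k. norm (abs_ltwo (trunc (X k) f) - abs_ltwo f)) \<longlonglongrightarrow> 0"
      using trunc_tendsto[OF f X] LIM_zero tendsto_norm_zero by blast
    then have "(\<lambda>k. norm (abs_ltwo (fourier_trunc (X k) f) - four (abs_ltwo f))) \<longlonglongrightarrow> 0" by (simp add: dl)
    then show "(\<lambda>k. abs_ltwo (fourier_trunc (X k) f)) \<longlonglongrightarrow> four (abs_ltwo f)"
      by (rule LIM_zero_cancel[OF tendsto_norm_zero_cancel])
  qed
qed

lemma has_fourier_iff:
  assumes f: "sqint f"
  shows "has_fourier f g \<longleftrightarrow> sqint g \<and> abs_ltwo g = four (abs_ltwo f)"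
proof -
  have "((\<lambda>R. L2_norm (\<lambda>\<xi>. fourier_trunc R f \<xi> - g \<xi>)) \<longlongrightarrow> 0) at_top \<longleftrightarrow> abs_ltwo g = four (abs_ltwo f)"
    if g: "sqint g"
  proof -
    have "L2_norm (\<lambda>\<xi>. fourier_trunc R f \<xi> - g \<xi>) = ennreal (norm (abs_ltwo (fourier_trunc R f) - abs_ltwo g))" for R
      using L2_norm_eq[OF sqint_diff[OF sqint_fourier_trunc[OF f] g]]
      by (simp add: abs_ltwo_diff g sqint_fourier_trunc f)
    then have "((\<lambda>R. L2_norm (\<lambda>\<xi>. fourier_trunc R f \<xi> - g \<xi>)) \<longlongrightarrow> 0) at_top \<longleftrightarrow>
      ((\<lambda>R. ennreal (norm (abs_ltwo (fourier_trunc R f) - abs_ltwo g))) \<longlongrightarrow> ennreal 0) at_top" by simp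
    also have "\<dots> \<longleftrightarrow> ((\<lambda>R. norm (abs_ltwo (fourier_trunc R f) - abs_ltwo g)) \<longlongrightarrow> 0) at_top"
      by (rule tendsto_ennreal_iff) auto
    also have "\<dots> \<longleftrightarrow> ((\<lambda>R. abs_ltwo (fourier_trunc R f)) \<longlongrightarrow> abs_ltwo g) at_top"
      by (simp add: tendsto_norm_zero_iff LIM_zero_iff)
    also have "\<dots> \<longleftrightarrow> abs_ltwo g = four (abs_ltwo f)"
    proof
      assume "((\<lambda>R. abs_ltwo (fourier_trunc R f)) \<longlongrightarrow> abs_ltwo g) at_top"
      then show "abs_ltwo g = four (abs_ltwo f)"
        using four_tendsto[OF f] by (rule tendsto_unique[OF trivial_limit_at_top_linorder])
    next
      assume "abs_ltwo g = four (abs_ltwo f)"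
      then show "((\<lambda>R. abs_ltwo (fourier_trunc R f)) \<longlongrightarrow> abs_ltwo g) at_top"
        using four_tendsto[OF f] by simp
    qed
    finally show ?thesis .
  qed
  then show ?thesis unfolding has_fourier_def L2_iff_sqint by blast
qed

text \<open>The choice operator in \<^const>\<open>fourier\<close> therefore selects a representative of the class given
  by \<open>four\<close>.\<close>

lemma fourier_sqint:
  assumes f: "sqint f"
  shows "sqint (fourier f)" "abs_ltwo (fourier f) = four (abs_ltwo f)"
proof -
  have "has_fourier f (rep_ltwo (four (abs_ltwo f)))" by (simp add: has_fourier_iff[OF f])
  then have "has_fourier f (fourier f)" unfolding fourier_def by (rule someI[of "has_fourier f"])
  then show "sqint (fourier f)" "abs_ltwo (fourier f) = four (abs_ltwo f)"
    by (simp_all add: has_fourier_iff[OF f])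
qed

lemma four_ft:
  assumes "integrable lborel f" "sqint f"
  shows "four (abs_ltwo f) = abs_ltwo (ft f)"
proof (rule LIMSEQ_unique)
  show "(\<lambda>n. abs_ltwo (fourier_trunc (real n) f)) \<longlonglongrightarrow> four (abs_ltwo f)"
    by (rule filterlim_compose[OF four_tendsto[OF assms(2)] filterlim_real_sequentially])
  have "(\<lambda>n. norm (abs_ltwo (trunc (real n) f) - abs_ltwo f)) \<longlonglongrightarrow> 0"
    using trunc_tendsto[OF assms(2) filterlim_real_sequentially] LIM_zero tendsto_norm_zero by blast
  then have "(\<lambda>n. norm (abs_ltwo (fourier_trunc (real n) f) - abs_ltwo (ft f))) \<longlonglongrightarrow> 0"
    unfolding fourier_trunc_eq by (simp add: norm_ft_diff assms sqint_trunc)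
  then show "(\<lambda>n. abs_ltwo (fourier_trunc (real n) f)) \<longlonglongrightarrow> abs_ltwo (ft f)"
    by (rule LIM_zero_cancel[OF tendsto_norm_zero_cancel])
qed

text \<open>Truncations are integrable, so a closed property needs checking only where \<open>ft\<close> is an integral.\<close>

lemma ltwo_dense_induct:
  assumes "\<And>f. integrable lborel f \<Longrightarrow> sqint f \<Longrightarrow> P (abs_ltwo f)"
    and "\<And>X x. X \<longlonglongrightarrow> x \<Longrightarrow> (\<And>n::nat. P (X n)) \<Longrightarrow> P x"
  shows "P x"
proof (rule assms(2))
  show "(\<lambda>n. abs_ltwo (trunc (real n) (rep_ltwo x))) \<longlonglongrightarrow> x"
    using trunc_tendsto[OF sqint_rep filterlim_real_sequentially, of x] by simp
  show "P (abs_ltwo (trunc (real n) (rep_ltwo x)))" for n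
    by (intro assms(1) sqint_trunc) simp_all
qed

lemma norm_four_diff: "norm (four x - four y) = norm (x - y)"
proof -
  have "norm (four (abs_ltwo f) - four (abs_ltwo g)) = norm (abs_ltwo f - abs_ltwo g)"
    if f: "sqint f" and g: "sqint g" for f g
  proof (rule tendsto_unique[OF sequentially_bot])
    show "(\<lambda>n. norm (abs_ltwo (fourier_trunc (real n) f) - abs_ltwo (fourier_trunc (real n) g)))
      \<longlonglongrightarrow> norm (four (abs_ltwo f) - four (abs_ltwo g))"
      using f g by (intro tendsto_intros filterlim_compose[OF four_tendsto filterlim_real_sequentially])
    have "(\<lambda>n. norm (abs_ltwo (trunc (real n) f) - abs_ltwo (trunc (real n) g)))
      \<longlonglongrightarrow> norm (abs_ltwo f - abs_ltwo g)"
      using f g by (intro tendsto_intros trunc_tendsto filterlim_real_sequentially)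
    then show "(\<lambda>n. norm (abs_ltwo (fourier_trunc (real n) f) - abs_ltwo (fourier_trunc (real n) g)))
      \<longlonglongrightarrow> norm (abs_ltwo f - abs_ltwo g)"
      unfolding fourier_trunc_eq by (simp add: norm_ft_diff sqint_trunc f g)
  qed
  from this[of "rep_ltwo x" "rep_ltwo y"] show ?thesis by simp
qed

lemma four_continuous: "X \<longlonglongrightarrow> x \<Longrightarrow> (\<lambda>n. four (X n)) \<longlonglongrightarrow> four x"
  unfolding tendsto_dist_iff[of _ "four x"] tendsto_dist_iff[of _ x] by (simp add: dist_norm norm_four_diff)

lemma four_add: "four (x + y) = four x + four y"
proof -
  have 1: "four (abs_ltwo f + abs_ltwo g) = four (abs_ltwo f) + four (abs_ltwo g)"
    if "integrable lborel f" "sqint f" "integrable lborel g" "sqint g" for f g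
    using that by (simp add: abs_ltwo_add[symmetric] four_ft sqint_add ft_linear plancherel_L1)
  have 2: "four (abs_ltwo f + y) = four (abs_ltwo f) + four y" if "integrable lborel f" "sqint f" for f
  proof (induct y rule: ltwo_dense_induct)
    case (2 X x)
    have "(\<lambda>n. four (abs_ltwo f + X n)) \<longlonglongrightarrow> four (abs_ltwo f + x)"
      by (intro four_continuous tendsto_intros 2)
    moreover have "(\<lambda>n. four (abs_ltwo f) + four (X n)) \<longlonglongrightarrow> four (abs_ltwo f) + four x"
      by (intro four_continuous tendsto_intros 2)
    ultimately show ?case unfolding 2(2) by (rule LIMSEQ_unique)
  qed (use 1 that in auto)
  show ?thesis
  proof (induct x rule: ltwo_dense_induct)
    case (2 X x)
    have "(\<lambda>n. four (X n + y)) \<longlonglongrightarrow> four (x + y)"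
      by (intro four_continuous tendsto_intros 2)
    moreover have "(\<lambda>n. four (X n) + four y) \<longlonglongrightarrow> four x + four y"
      by (intro four_continuous tendsto_intros 2)
    ultimately show ?case unfolding 2(2) by (rule LIMSEQ_unique)
  qed (use 2 in auto)
qed

lemma four_scaleR: "four (r *\<^sub>R x) = r *\<^sub>R four x"
proof (induct x rule: ltwo_dense_induct)
  case (1 f)
  then show ?case
    by (simp add: abs_ltwo_scaleR[symmetric] four_ft sqint_cmult ft_linear plancherel_L1)
next
  case (2 X x)
  have "(\<lambda>n. four (r *\<^sub>R X n)) \<longlonglongrightarrow> four (r *\<^sub>R x)"
    by (intro four_continuous tendsto_intros 2)
  moreover have "(\<lambda>n. r *\<^sub>R four (X n)) \<longlonglongrightarrow> r *\<^sub>R four x"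
    by (intro four_continuous tendsto_intros 2)
  ultimately show ?case unfolding 2(2) by (rule LIMSEQ_unique)
qed

lemma linear_four: "linear four"
  by (intro linearI four_add four_scaleR)

lemma norm_four [simp]: "norm (four x) = norm x"
  using norm_four_diff[of x 0] linear_0[OF linear_four] by simp

definition invft :: "(real \<Rightarrow> complex) \<Rightarrow> real \<Rightarrow> complex" where
  "invft g x = ft g (- x)"

lemma invft_sqint:
  assumes "integrable lborel g" "sqint g"
  shows "sqint (invft g)" "nrm (invft g) = nrm g"
  using sqint_reflect[of "ft g"] plancherel_L1[OF assms] unfolding invft_def by auto

text \<open>On integrable functions this is the multiplication formula; the general case follows by density.\<close>

lemma invft_inner:
  assumes g: "integrable lborel g" "sqint g"
  shows "four x \<bullet> abs_ltwo g = x \<bullet> abs_ltwo (invft g)"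
proof (induct x rule: ltwo_dense_induct)
  case (1 f)
  have c: "cnj (ft (\<lambda>x. cnj (g x)) x) = invft g x" for x
  proof -
    have "cnj (LBINT \<xi>. exp (- \<i> * of_real (x * \<xi>)) * cnj (g \<xi>)) = (LBINT \<xi>. cnj (exp (- \<i> * of_real (x * \<xi>)) * cnj (g \<xi>)))"
      by (rule Bochner_Integration.integral_cnj[symmetric])
    also have "\<dots> = (LBINT \<xi>. exp (- \<i> * of_real (- x * \<xi>)) * g \<xi>)"
      by (simp add: exp_cnj)
    finally show ?thesis unfolding ft_def invft_def by simp
  qed
  have "four (abs_ltwo f) \<bullet> abs_ltwo g = abs_ltwo g \<bullet> abs_ltwo (ft f)"
    using four_ft 1 by (simp add: inner_commute)
  also have "\<dots> = (LBINT x. Re (ft f x * cnj (g x)))"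
    using 1 by (simp add: inner_abs_ltwo plancherel_L1 g mult.commute)
  also have "\<dots> = Re (LBINT x. ft f x * cnj (g x))"
    by (intro integral_Re integrable_mult_sqint plancherel_L1 1 sqint_cnj g)
  also have "(LBINT x. ft f x * cnj (g x)) = (LBINT x. f x * ft (\<lambda>x. cnj (g x)) x)"
    using 1 g by (intro ft_multiplication_formula) auto
  also have "\<dots> = (LBINT x. f x * cnj (invft g x))" by (simp flip: c)
  also have "Re \<dots> = (LBINT x. Re (f x * cnj (invft g x)))"
    by (intro integral_Re[symmetric] integrable_mult_sqint 1 sqint_cnj invft_sqint g)
  also have "\<dots> = abs_ltwo (invft g) \<bullet> abs_ltwo f"
    using 1 by (simp add: inner_abs_ltwo invft_sqint g mult.commute)
  finally show ?case by (simp add: inner_commute)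
next
  case (2 X x)
  have "(\<lambda>n. four (X n) \<bullet> abs_ltwo g) \<longlonglongrightarrow> four x \<bullet> abs_ltwo g"
    by (intro four_continuous tendsto_intros 2)
  moreover have "(\<lambda>n. X n \<bullet> abs_ltwo (invft g)) \<longlonglongrightarrow> x \<bullet> abs_ltwo (invft g)"
    by (intro tendsto_intros 2)
  ultimately show ?case unfolding 2(2) by (rule LIMSEQ_unique)
qed

text \<open>Both maps are isometric and they are adjoint to each other, so the square of the distance between
  the two sides expands to zero.\<close>

lemma four_invft:
  assumes g: "integrable lborel g" "sqint g"
  shows "four (abs_ltwo (invft g)) = abs_ltwo g"
proof -
  have "(norm (a - b))\<^sup>2 = (norm a)\<^sup>2 + (norm b)\<^sup>2 - 2 * (a \<bullet> b)" for a b :: ltwo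
    by (simp add: power2_norm_eq_inner inner_simps inner_commute)
  from this[of "four (abs_ltwo (invft g))" "abs_ltwo g"]
  have "(norm (four (abs_ltwo (invft g)) - abs_ltwo g))\<^sup>2 = 0"
    unfolding norm_four invft_inner[OF g] invft_sqint[OF g]
    by (simp add: invft_sqint[OF g] flip: power2_norm_eq_inner)
  then show ?thesis by simp
qed

lemma four_inj: "four x = four y \<Longrightarrow> x = y"
  using norm_four_diff[of x y] by simp

lemma fourier_inversion:
  assumes f: "sqint f" and g: "integrable lborel g" "sqint g" and "AE \<xi> in lborel. fourier f \<xi> = g \<xi>"
  shows "AE x in lborel. f x = invft g x"
proof -
  have "four (abs_ltwo f) = abs_ltwo g"
    using assms fourier_sqint[OF f] abs_ltwo_eq_iff by metis
  then have "four (abs_ltwo f) = four (abs_ltwo (invft g))" using four_invft[OF g] by simp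
  then have "abs_ltwo f = abs_ltwo (invft g)" by (rule four_inj)
  then show ?thesis using abs_ltwo_eq_iff[OF f invft_sqint(1)[OF g]] by simp
qed

section \<open>Smooth functions and the Hardy space\<close>

lemma sqint_shift_reflect:
  assumes "sqint f"
  shows "sqint (\<lambda>y. f (x - y))" "nrm (\<lambda>y. f (x - y)) = nrm f"
  using sqint_translate[OF sqint_reflect(1)[OF assms], of "- x"] sqint_reflect(2)[OF assms] by simp_all

lemma conv_abs_bound:
  assumes f: "sqint f" and g: "sqint g"
  shows "integrable lborel (\<lambda>y. f (x - y) * g y)"
    "(LBINT y. cmod (f (x - y)) * cmod (g y)) \<le> nrm f * nrm g"
    "cmod (conv f g x) \<le> nrm f * nrm g"
proof -
  show i: "integrable lborel (\<lambda>y. f (x - y) * g y)"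
    by (intro integrable_mult_sqint sqint_shift_reflect assms)
  show b: "(LBINT y. cmod (f (x - y)) * cmod (g y)) \<le> nrm f * nrm g"
    using Cauchy_Schwarz_sqint[OF sqint_shift_reflect(1)[OF f] g] by (simp add: sqint_shift_reflect(2)[OF f])
  have "cmod (LBINT y. f (x - y) * g y) \<le> (LBINT y. cmod (f (x - y)) * cmod (g y))"
    using integral_norm_bound[of lborel "\<lambda>y. f (x - y) * g y"] by (simp add: norm_mult)
  then have "1 / sqrt (2 * pi) * cmod (LBINT y. f (x - y) * g y) \<le> 1 * (nrm f * nrm g)"
    using b pi_ge_two by (intro mult_mono) auto
  then show "cmod (conv f g x) \<le> nrm f * nrm g"
    by (simp add: conv_def norm_mult norm_divide)
qed

abbreviation wt :: "nat \<Rightarrow> real \<Rightarrow> real" where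
  "wt n \<xi> \<equiv> (1 + \<bar>\<xi>\<bar>) ^ n"

text \<open>The Fourier transforms of the functions that lie in every \<open>H\<^sup>n\<close>.\<close>

definition rapid :: "(real \<Rightarrow> complex) \<Rightarrow> bool" where
  "rapid g \<longleftrightarrow> (\<forall>n. sqint (\<lambda>\<xi>. of_real (wt n \<xi>) * g \<xi>))"

lemma sqint_inverse_weight: "sqint (\<lambda>\<xi>. of_real (inverse (1 + \<bar>\<xi>\<bar>)))"
proof -
  have "integrable lborel (\<lambda>\<xi>::real. (cmod (of_real (inverse (1 + \<bar>\<xi>\<bar>))))\<^sup>2)"
  proof (rule Bochner_Integration.integrable_bound)
    show "integrable lborel (\<lambda>\<xi>::real. inverse (1 + \<xi>\<^sup>2))"
      using integrable_inverse_1_plus_square by (simp add: set_integrable_def)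
    show "AE \<xi>::real in lborel. norm ((cmod (of_real (inverse (1 + \<bar>\<xi>\<bar>))))\<^sup>2) \<le> norm (inverse (1 + \<xi>\<^sup>2))"
    proof (rule AE_I2)
      fix \<xi> :: real
      have "1 + \<xi>\<^sup>2 \<le> (1 + \<bar>\<xi>\<bar>)\<^sup>2" by (simp add: power2_sum)
      then have "inverse ((1 + \<bar>\<xi>\<bar>)\<^sup>2) \<le> inverse (1 + \<xi>\<^sup>2)" by (intro le_imp_inverse_le) (auto simp: add_pos_nonneg)
      then show "norm ((cmod (of_real (inverse (1 + \<bar>\<xi>\<bar>))))\<^sup>2) \<le> norm (inverse (1 + \<xi>\<^sup>2))"
        unfolding norm_of_real by (simp add: power_inverse add_nonneg_nonneg)
    qed
  qed measurable
  then show ?thesis by (simp add: sqint_def)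
qed

lemma rapid_sqint_weight: "rapid g \<Longrightarrow> sqint (\<lambda>\<xi>. of_real (wt n \<xi>) * g \<xi>)"
  by (simp add: rapid_def)

lemma rapid_sqint: "rapid g \<Longrightarrow> sqint g"
  using rapid_sqint_weight[of g 0] by simp

lemma rapid_measurable [measurable_dest]: "rapid g \<Longrightarrow> g \<in> borel_measurable borel"
  by (intro sqint_measurable rapid_sqint)

text \<open>Cauchy--Schwarz against \<open>1 / (1 + |\<xi>|)\<close>, at the price of one power of the weight.\<close>

lemma rapid_integrable_weight:
  assumes "rapid g"
  shows "integrable lborel (\<lambda>\<xi>. of_real (wt n \<xi>) * g \<xi>)"
proof -
  have nz: "1 + \<bar>\<xi>\<bar> \<noteq> 0" for \<xi> :: real by linarith
  have "integrable lborel (\<lambda>\<xi>. of_real (inverse (1 + \<bar>\<xi>\<bar>)) * (of_real (wt (Suc n) \<xi>) * g \<xi>))"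
    by (intro integrable_mult_sqint sqint_inverse_weight rapid_sqint_weight assms)
  also have "(\<lambda>\<xi>. of_real (inverse (1 + \<bar>\<xi>\<bar>)) * (of_real (wt (Suc n) \<xi>) * g \<xi>))
    = (\<lambda>\<xi>. complex_of_real (inverse (1 + \<bar>\<xi>\<bar>) * wt (Suc n) \<xi>) * g \<xi>)"
    by (simp only: of_real_mult mult.assoc)
  also have "(\<lambda>\<xi> :: real. inverse (1 + \<bar>\<xi>\<bar>) * wt (Suc n) \<xi>) = (\<lambda>\<xi>. wt n \<xi>)"
    by (intro ext) (simp only: power_Suc mult.assoc[symmetric] left_inverse[OF nz] mult_1_left)
  then have "(\<lambda>\<xi>. complex_of_real (inverse (1 + \<bar>\<xi>\<bar>) * wt (Suc n) \<xi>) * g \<xi>) = (\<lambda>\<xi>. of_real (wt n \<xi>) * g \<xi>)"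
    by (metis (no_types))
  finally show ?thesis .
qed

lemma rapid_integrable: "rapid g \<Longrightarrow> integrable lborel g"
  using rapid_integrable_weight[of g 0] by simp

lemma rapidI_bounded:
  assumes [measurable]: "g \<in> borel_measurable borel"
    and b: "\<And>n. \<exists>C. \<forall>\<xi>. wt n \<xi> * cmod (g \<xi>) \<le> C"
  shows "rapid g"
  unfolding rapid_def
proof
  fix n
  obtain C where C: "\<And>\<xi>. wt (Suc n) \<xi> * cmod (g \<xi>) \<le> C" using b[of "Suc n"] by auto
  show "sqint (\<lambda>\<xi>. of_real (wt n \<xi>) * g \<xi>)"
  proof (rule sqint_bound[OF sqint_inverse_weight])
    show "AE \<xi> in lborel. cmod (of_real (wt n \<xi>) * g \<xi>) \<le> C * cmod (of_real (inverse (1 + \<bar>\<xi>\<bar>)))"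
    proof (rule AE_I2)
      fix \<xi> :: real
      have p: "1 + \<bar>\<xi>\<bar> > 0" by linarith
      have "cmod (of_real (wt n \<xi>) * g \<xi>) = wt n \<xi> * cmod (g \<xi>)"
        using p by (simp add: norm_mult del: of_real_power of_real_add)
      also have "\<dots> \<le> C / (1 + \<bar>\<xi>\<bar>)" using C[of \<xi>] p by (simp add: field_simps)
      also have "\<dots> = C * cmod (of_real (inverse (1 + \<bar>\<xi>\<bar>)))"
        using p by (simp add: divide_inverse del: of_real_add of_real_inverse)
      finally show "cmod (of_real (wt n \<xi>) * g \<xi>) \<le> C * cmod (of_real (inverse (1 + \<bar>\<xi>\<bar>)))" .
    qed
  qed measurable
qed

lemma rapid_dominated:
  assumes "rapid f" "g \<in> borel_measurable borel" "AE \<xi> in lborel. cmod (g \<xi>) \<le> C * wt m \<xi> * cmod (f \<xi>)"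
  shows "rapid g"
  unfolding rapid_def
proof
  fix n
  have [measurable]: "g \<in> borel_measurable borel" by fact
  show "sqint (\<lambda>\<xi>. of_real (wt n \<xi>) * g \<xi>)"
  proof (rule sqint_bound[OF rapid_sqint_weight[OF assms(1), of "n + m"]])
    show "AE \<xi> in lborel. cmod (of_real (wt n \<xi>) * g \<xi>) \<le> C * cmod (of_real (wt (n + m) \<xi>) * f \<xi>)"
      using assms(3)
    proof eventually_elim
      case (elim \<xi>)
      have "wt n \<xi> * cmod (g \<xi>) \<le> wt n \<xi> * (C * wt m \<xi> * cmod (f \<xi>))"
        by (intro mult_left_mono elim) auto
      then show ?case
        by (simp add: norm_mult power_add mult_ac del: of_real_power of_real_add of_real_mult)
    qed
  qed measurable
qed

lemma rapid_add:
  assumes "rapid f" "rapid g" shows "rapid (\<lambda>x. f x + g x)"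
  using assms sqint_add unfolding rapid_def distrib_left by blast

lemma rapid_bounded_mult:
  assumes "rapid f" "m \<in> borel_measurable borel" "\<And>x. cmod (m x) \<le> C * wt k x"
  shows "rapid (\<lambda>x. m x * f x)"
proof (rule rapid_dominated[OF assms(1), of _ C k])
  have [measurable]: "f \<in> borel_measurable borel" "m \<in> borel_measurable borel"
    using assms rapid_measurable by auto
  show "(\<lambda>x. m x * f x) \<in> borel_measurable borel" by measurable
  show "AE x in lborel. cmod (m x * f x) \<le> C * wt k x * cmod (f x)"
    using assms(3) by (auto simp: norm_mult intro!: mult_right_mono)
qed

lemma rapid_cmult: "rapid f \<Longrightarrow> rapid (\<lambda>x. c * f x)"
  by (rule rapid_bounded_mult[of _ "\<lambda>_. c" "cmod c" 0]) auto

lemma rapid_times: "rapid f \<Longrightarrow> rapid (\<lambda>x. \<i> * of_real x * f x)"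
  by (rule rapid_bounded_mult[of _ "\<lambda>x. \<i> * of_real x" 1 1]) (auto simp: norm_mult)

text \<open>On the Fourier side, the Cauchy--Szego projection.\<close>

definition pos_part :: "(real \<Rightarrow> complex) \<Rightarrow> real \<Rightarrow> complex" where
  "pos_part g x = (if x \<ge> 0 then g x else 0)"

lemma pos_part_measurable [measurable]:
  assumes [measurable]: "g \<in> borel_measurable borel"
  shows "pos_part g \<in> borel_measurable borel"
  unfolding pos_part_def[abs_def] by measurable

lemma rapid_pos_part:
  assumes "rapid g" shows "rapid (pos_part g)"
proof (rule rapid_dominated[OF assms, of _ 1 0])
  have [measurable]: "g \<in> borel_measurable borel" using assms by (rule rapid_measurable)
  show "pos_part g \<in> borel_measurable borel" by measurable
qed (auto simp: pos_part_def)

text \<open>On the Fourier side, complex conjugation.\<close>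

definition star :: "(real \<Rightarrow> complex) \<Rightarrow> real \<Rightarrow> complex" where
  "star g x = cnj (g (- x))"

lemma star_measurable [measurable]:
  assumes [measurable]: "g \<in> borel_measurable borel"
  shows "star g \<in> borel_measurable borel"
  unfolding star_def[abs_def] by measurable

lemma sqint_star:
  assumes "sqint g" shows "sqint (star g)" "nrm (star g) = nrm g"
proof -
  show s: "sqint (star g)" unfolding star_def[abs_def] by (intro sqint_cnj sqint_reflect assms)
  have "nrm (star g) = nrm (\<lambda>x. g (- x))"
    using norm_abs_ltwo[OF s] norm_abs_ltwo[OF sqint_reflect(1)[OF assms]]
    by (simp add: star_def) (metis norm_ge_zero power2_eq_iff_nonneg)
  then show "nrm (star g) = nrm g" using sqint_reflect(2)[OF assms] by simp
qed

lemma rapid_star: "rapid g \<Longrightarrow> rapid (star g)"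
proof -
  assume g: "rapid g"
  have "sqint (\<lambda>\<xi>. of_real (wt n \<xi>) * star g \<xi>)" for n
    using sqint_star(1)[OF rapid_sqint_weight[OF g, of n]] by (simp add: star_def[abs_def])
  then show ?thesis by (simp add: rapid_def)
qed

lemma weight_submult: "wt n x \<le> wt n (x - y) * wt n (y :: real)"
proof -
  have "1 + \<bar>x\<bar> \<le> 1 + \<bar>x - y\<bar> + \<bar>y\<bar> + \<bar>x - y\<bar> * \<bar>y\<bar>"
  proof -
    have "0 \<le> \<bar>x - y\<bar> * \<bar>y\<bar>" by simp
    then show ?thesis using abs_triangle_ineq[of "x - y" y] by linarith
  qed
  then have "1 + \<bar>x\<bar> \<le> (1 + \<bar>x - y\<bar>) * (1 + \<bar>y\<bar>)" by (simp add: algebra_simps)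
  then show ?thesis unfolding power_mult_distrib[symmetric] by (intro power_mono) auto
qed

text \<open>The weight is submultiplicative, so it can be distributed over the two factors.\<close>

lemma conv_weight_le:
  assumes [measurable]: "a \<in> borel_measurable borel" "k \<in> borel_measurable borel"
    and i: "integrable lborel (\<lambda>\<eta>. (wt n (\<xi> - \<eta>) * cmod (a (\<xi> - \<eta>))) * (wt n \<eta> * cmod (k \<eta>)))"
  shows "wt n \<xi> * cmod (conv a k \<xi>)
    \<le> (LBINT \<eta>. (wt n (\<xi> - \<eta>) * cmod (a (\<xi> - \<eta>))) * (wt n \<eta> * cmod (k \<eta>)))"
proof -
  have pt: "wt n \<xi> * cmod (a (\<xi> - \<eta>) * k \<eta>) \<le> (wt n (\<xi> - \<eta>) * cmod (a (\<xi> - \<eta>))) * (wt n \<eta> * cmod (k \<eta>))" for \<eta>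
    using mult_right_mono[OF weight_submult[of \<xi> n \<eta>], of "cmod (a (\<xi> - \<eta>) * k \<eta>)"]
    by (simp add: norm_mult mult_ac)
  have "cmod (conv a k \<xi>) \<le> cmod (LBINT \<eta>. a (\<xi> - \<eta>) * k \<eta>)"
    using pi_ge_two mult_right_mono[of "1 / sqrt (2 * pi)" 1 "cmod (LBINT \<eta>. a (\<xi> - \<eta>) * k \<eta>)"]
    by (simp add: conv_def norm_mult norm_divide)
  also have "\<dots> \<le> (LBINT \<eta>. cmod (a (\<xi> - \<eta>) * k \<eta>))" by (rule integral_norm_bound)
  finally have "wt n \<xi> * cmod (conv a k \<xi>) \<le> (LBINT \<eta>. wt n \<xi> * cmod (a (\<xi> - \<eta>) * k \<eta>))"
    unfolding integral_mult_right_zero by (rule mult_left_mono) simp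
  also have "\<dots> \<le> (LBINT \<eta>. (wt n (\<xi> - \<eta>) * cmod (a (\<xi> - \<eta>))) * (wt n \<eta> * cmod (k \<eta>)))"
  proof (rule integral_mono[OF _ i pt])
    show "integrable lborel (\<lambda>\<eta>. wt n \<xi> * cmod (a (\<xi> - \<eta>) * k \<eta>))"
      by (rule Bochner_Integration.integrable_bound[OF i], measurable)
         (intro AE_I2, use pt in \<open>auto intro: order_trans[OF _ abs_ge_self]\<close>)
  qed
  finally show ?thesis .
qed

lemma rapid_conv_bounded:
  assumes g: "rapid g" and k: "rapid k"
  shows "\<exists>C. \<forall>\<xi>. wt n \<xi> * cmod (conv g k \<xi>) \<le> C"
proof -
  let ?w = "\<lambda>f \<xi>. complex_of_real (wt n \<xi>) * f \<xi>"
  have w: "cmod (?w f \<xi>) = wt n \<xi> * cmod (f \<xi>)" for f \<xi>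
    by (simp add: norm_mult del: of_real_power of_real_add)
  have sq: "sqint (?w g)" "sqint (?w k)" by (intro rapid_sqint_weight g k)+
  have "wt n \<xi> * cmod (conv g k \<xi>) \<le> nrm (?w g) * nrm (?w k)" for \<xi>
  proof (rule order_trans[OF conv_weight_le])
    show "integrable lborel (\<lambda>\<eta>. (wt n (\<xi> - \<eta>) * cmod (g (\<xi> - \<eta>))) * (wt n \<eta> * cmod (k \<eta>)))"
      using integrable_norm[OF conv_abs_bound(1)[OF sq, of \<xi>]] unfolding norm_mult[of "?w g _"] w .
  qed (use g k conv_abs_bound(2)[OF sq, of \<xi>, unfolded w] in \<open>auto intro: rapid_measurable\<close>)
  then show ?thesis by blast
qed

text \<open>Convolution with a rapid function preserves every rate of pointwise polynomial decay: the weighted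
  \<open>L\<^sup>1\<close> norm of one factor meets the weighted supremum of the other.\<close>

lemma conv_weight_bounded:
  assumes a: "rapid a" and k: "k \<in> borel_measurable borel" and b: "\<And>\<eta>. wt n \<eta> * cmod (k \<eta>) \<le> C"
  shows "\<exists>C'. \<forall>\<xi>. wt n \<xi> * cmod (conv a k \<xi>) \<le> C'"
proof -
  let ?w = "\<lambda>\<xi>. wt n \<xi> * cmod (a \<xi>)"
  have [measurable]: "a \<in> borel_measurable borel" "k \<in> borel_measurable borel"
    using a k by (auto intro: rapid_measurable)
  have C: "0 \<le> C" using b[of 0] by (rule order_trans[rotated]) simp
  have iw: "integrable lborel ?w"
    using integrable_norm[OF rapid_integrable_weight[OF a, of n]]
    by (simp add: norm_mult del: of_real_power of_real_add)
  have "wt n \<xi> * cmod (conv a k \<xi>) \<le> (LBINT \<eta>. ?w \<eta>) * C" for \<xi>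
  proof -
    have iw': "integrable lborel (\<lambda>\<eta>. ?w (\<xi> - \<eta>) * C)"
      using lborel_integrable_real_affine[OF iw, of "-1" \<xi>] by simp
    have pt: "?w (\<xi> - \<eta>) * (wt n \<eta> * cmod (k \<eta>)) \<le> ?w (\<xi> - \<eta>) * C" for \<eta>
      by (intro mult_left_mono b) simp
    have i: "integrable lborel (\<lambda>\<eta>. ?w (\<xi> - \<eta>) * (wt n \<eta> * cmod (k \<eta>)))"
      by (rule Bochner_Integration.integrable_bound[OF iw'], measurable)
         (intro AE_I2, use pt C in simp)
    have "wt n \<xi> * cmod (conv a k \<xi>) \<le> (LBINT \<eta>. ?w (\<xi> - \<eta>) * (wt n \<eta> * cmod (k \<eta>)))"
      by (rule conv_weight_le[OF _ _ i]) measurable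
    also have "\<dots> \<le> (LBINT \<eta>. ?w (\<xi> - \<eta>) * C)" by (rule integral_mono[OF i iw' pt])
    also have "\<dots> = (LBINT \<eta>. ?w \<eta>) * C"
      using lborel_integral_real_affine[of "-1" ?w \<xi>] by simp
    finally show ?thesis .
  qed
  then show ?thesis by blast
qed

lemma rapid_conv:
  assumes g: "rapid g" and k: "rapid k"
  shows "rapid (conv g k)"
proof (rule rapidI_bounded)
  have [measurable]: "g \<in> borel_measurable borel" "k \<in> borel_measurable borel"
    using g k by (auto intro: rapid_measurable)
  show "conv g k \<in> borel_measurable borel" by measurable
qed (rule rapid_conv_bounded[OF g k])

lemma conv_pos:
  assumes "\<And>\<xi>. \<xi> < 0 \<Longrightarrow> g \<xi> = 0" "\<And>\<xi>. \<xi> < 0 \<Longrightarrow> k \<xi> = 0" "\<xi> < 0"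
  shows "conv g k \<xi> = 0"
proof -
  have z: "g (\<xi> - \<eta>) * k \<eta> = 0" for \<eta>
    using assms(1)[of "\<xi> - \<eta>"] assms(2)[of \<eta>] assms(3) by (cases "\<eta> < 0") auto
  show ?thesis unfolding conv_def z by simp
qed

text \<open>Both arguments are square-integrable, so the value of the convolution at every single point depends
  only on their classes.\<close>

lemma conv_cong_AE:
  assumes f: "sqint f" "sqint f'" "AE x in lborel. f x = f' x"
    and g: "sqint g" "sqint g'" "AE x in lborel. g x = g' x"
  shows "conv f g = conv f' g'"
proof
  fix x
  have "abs_ltwo (\<lambda>y. f (x - y)) = abs_ltwo (\<lambda>y. f' (x - y))"
    using sqint_shift_reflect[OF sqint_diff[OF f(1,2)], of x] f
    by (simp add: abs_ltwo_diff sqint_shift_reflect abs_ltwo_eq_iff[symmetric])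
  then have a: "AE y in lborel. f (x - y) = f' (x - y)"
    by (simp add: abs_ltwo_eq_iff sqint_shift_reflect f)
  have [measurable]: "f \<in> borel_measurable borel" "f' \<in> borel_measurable borel"
    "g \<in> borel_measurable borel" "g' \<in> borel_measurable borel"
    using f g by (auto intro: sqint_measurable)
  have "(LBINT y. f (x - y) * g y) = (LBINT y. f' (x - y) * g' y)"
  proof (rule integral_cong_AE)
    show "AE y in lborel. f (x - y) * g y = f' (x - y) * g' y"
      using a g(3) by eventually_elim simp
  qed measurable
  then show "conv f g x = conv f' g' x" by (simp add: conv_def)
qed

lemma conv_linear:
  assumes "sqint f" "sqint f'" "sqint g" "sqint g'"
  shows "conv (\<lambda>x. f x + f' x) g = (\<lambda>x. conv f g x + conv f' g x)"
    "conv f (\<lambda>x. g x + g' x) = (\<lambda>x. conv f g x + conv f g' x)"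
    "conv (\<lambda>x. c * f x) g = (\<lambda>x. c * conv f g x)"
    "conv f (\<lambda>x. c * g x) = (\<lambda>x. c * conv f g x)"
proof -
  have i: "integrable lborel (\<lambda>y. f (x - y) * g y)" "integrable lborel (\<lambda>y. f' (x - y) * g y)"
    "integrable lborel (\<lambda>y. f (x - y) * g' y)" for x
    using assms by (auto intro: conv_abs_bound(1))
  show "conv (\<lambda>x. f x + f' x) g = (\<lambda>x. conv f g x + conv f' g x)"
    unfolding conv_def distrib_right using i by (simp add: distrib_left)
  show "conv f (\<lambda>x. g x + g' x) = (\<lambda>x. conv f g x + conv f g' x)"
    unfolding conv_def distrib_left using i by (simp add: distrib_left)
  show "conv (\<lambda>x. c * f x) g = (\<lambda>x. c * conv f g x)"
    unfolding conv_def mult.assoc integral_mult_right_zero by (simp only: mult.left_commute)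
  show "conv f (\<lambda>x. c * g x) = (\<lambda>x. c * conv f g x)"
    unfolding conv_def mult.left_commute[of _ c] integral_mult_right_zero by (rule refl)
qed

lemma sqint_pos_part: "sqint f \<Longrightarrow> sqint (pos_part f)"
proof -
  assume f: "sqint f"
  have [measurable]: "f \<in> borel_measurable borel" using f by (rule sqint_measurable)
  show ?thesis by (rule sqint_bound[OF f, of _ 1]) (auto simp: pos_part_def)
qed

lemma norm_pos_part_le:
  assumes f: "sqint f" shows "nrm (pos_part f) \<le> nrm f"
proof -
  have "(nrm (pos_part f))\<^sup>2 \<le> (nrm f)\<^sup>2"
    unfolding norm_abs_ltwo[OF sqint_pos_part[OF f]] norm_abs_ltwo[OF f]
    by (intro integral_mono sqint_integrable sqint_pos_part f) (auto simp: pos_part_def)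
  then show ?thesis by (simp add: power2_le_iff_abs_le)
qed

section \<open>Calculus of the inverse Fourier transform\<close>

lemma invft_conv:
  assumes "rapid g" "rapid k" shows "invft (conv g k) = (\<lambda>x. invft g x * invft k x)"
  using assms by (simp add: invft_def[abs_def] ft_conv rapid_integrable)

lemma invft_add:
  assumes "rapid g" "rapid k" shows "invft (\<lambda>\<xi>. g \<xi> + k \<xi>) = (\<lambda>x. invft g x + invft k x)"
  using assms by (simp add: invft_def[abs_def] ft_linear rapid_integrable)

lemma invft_cmult:
  assumes "rapid g" shows "invft (\<lambda>\<xi>. c * g \<xi>) = (\<lambda>x. c * invft g x)"
  using assms by (simp add: invft_def[abs_def] ft_linear(3)[OF rapid_integrable rapid_integrable])

lemma invft_eq: "invft g x = of_real (1 / sqrt (2 * pi)) * (LBINT \<xi>. iexp (x * \<xi>) * g \<xi>)"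
  by (simp add: invft_def ft_def)

lemma invft_star: "invft (star g) = (\<lambda>x. cnj (invft g x))"
proof
  fix x
  have "(LBINT \<xi>. iexp (x * \<xi>) * star g \<xi>) = (LBINT \<xi>. cnj (iexp (x * \<xi>) * g \<xi>))"
    using lborel_integral_real_affine[of "-1" "\<lambda>\<xi>. iexp (x * \<xi>) * star g \<xi>" 0]
    by (simp add: star_def exp_cnj)
  also have "\<dots> = cnj (LBINT \<xi>. iexp (x * \<xi>) * g \<xi>)"
    by (rule Bochner_Integration.integral_cnj)
  finally show "invft (star g) x = cnj (invft g x)" unfolding invft_eq by simp
qed

lemma invft_translate: "invft (\<lambda>\<xi>. iexp (y * \<xi>) * g \<xi>) x = invft g (x + y)"
  unfolding invft_eq by (simp add: distrib_right exp_add distrib_left mult_ac)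

lemma invft_cong_AE:
  assumes [measurable]: "g \<in> borel_measurable borel" "k \<in> borel_measurable borel"
    and "AE \<xi> in lborel. g \<xi> = k \<xi>"
  shows "invft g = invft k"
proof
  fix x
  have "(LBINT \<xi>. iexp (x * \<xi>) * g \<xi>) = (LBINT \<xi>. iexp (x * \<xi>) * k \<xi>)"
    by (rule integral_cong_AE) (use assms(3) in \<open>auto elim: eventually_mono\<close>)
  then show "invft g x = invft k x" by (simp add: invft_eq)
qed

text \<open>By \<open>|exp (\<i> s) - 1 - \<i> s| \<le> s\<^sup>2 / 2\<close> the remainder is quadratic in the increment, with a weighted
  \<open>L\<^sup>1\<close> norm of \<open>g\<close> as the constant.\<close>

lemma invft_has_vector_derivative:
  assumes g: "rapid g"
  shows "(invft g has_vector_derivative invft (\<lambda>\<xi>. \<i> * of_real \<xi> * g \<xi>) x) (at x)"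
  unfolding has_vector_derivative_def
proof (rule has_derivativeI_sandwich[of 1])
  let ?c = "complex_of_real (1 / sqrt (2 * pi))" and ?w = "\<lambda>\<xi>. cmod (of_real (wt 2 \<xi>) * g \<xi>)"
  let ?g' = "\<lambda>\<xi>. \<i> * of_real \<xi> * g \<xi>"
  have iw: "integrable lborel ?w" by (intro integrable_norm rapid_integrable_weight g)
  have i1: "integrable lborel (\<lambda>\<xi>. iexp (y * \<xi>) * k \<xi>)" if "rapid k" for k y
    using ft_integrable[OF rapid_integrable[OF that], of "- y"] by simp
  show "bounded_linear (\<lambda>y. y *\<^sub>R invft ?g' x)" by (rule bounded_linear_scaleR_left)
  fix y :: real assume y: "y \<noteq> x"
  define d where "d = y - x"
  define R where "R \<xi> = iexp (y * \<xi>) * g \<xi> - iexp (x * \<xi>) * g \<xi> - of_real d * (iexp (x * \<xi>) * ?g' \<xi>)" for \<xi>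
  have iR: "integrable lborel R"
    unfolding R_def by (intro Bochner_Integration.integrable_diff integrable_mult_right i1 g rapid_times)
  have "(LBINT \<xi>. R \<xi>) = (LBINT \<xi>. iexp (y * \<xi>) * g \<xi>) - (LBINT \<xi>. iexp (x * \<xi>) * g \<xi>)
      - of_real d * (LBINT \<xi>. iexp (x * \<xi>) * ?g' \<xi>)"
    unfolding R_def using i1[OF g, of x] i1[OF g, of y] i1[OF rapid_times[OF g], of x]
    by (subst Bochner_Integration.integral_diff Bochner_Integration.integral_diff integral_mult_right_zero)+ auto
  then have "invft g y - invft g x - d *\<^sub>R invft ?g' x = ?c * (LBINT \<xi>. R \<xi>)"
    unfolding invft_eq scaleR_conv_of_real by (simp only: right_diff_distrib mult.left_commute)
  also have "norm \<dots> \<le> 1 * (LBINT \<xi>. cmod (R \<xi>))"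
    unfolding norm_mult using pi_ge_two by (intro mult_mono integral_norm_bound) (auto simp: norm_divide)
  also have "\<dots> \<le> 1 * (LBINT \<xi>. d\<^sup>2 * ?w \<xi>)"
  proof (intro mult_left_mono integral_mono integrable_norm[OF iR] integrable_mult_right iw)
    fix \<xi>
    have "R \<xi> = iexp (x * \<xi>) * (iexp (d * \<xi>) - (1 + \<i> * of_real (d * \<xi>))) * g \<xi>"
      by (simp add: R_def d_def algebra_simps exp_add[symmetric])
    then have "cmod (R \<xi>) = cmod (iexp (d * \<xi>) - (1 + \<i> * of_real (d * \<xi>))) * cmod (g \<xi>)"
      by (simp add: norm_mult norm_exp_eq_Re)
    also have "\<dots> \<le> (d\<^sup>2 * wt 2 \<xi>) * cmod (g \<xi>)"
    proof (rule mult_right_mono)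
      have "cmod (iexp (d * \<xi>) - (1 + \<i> * of_real (d * \<xi>))) \<le> \<bar>d * \<xi>\<bar>\<^sup>2 / 2"
        using iexp_approx1[of "d * \<xi>" 1] by (simp add: numeral_2_eq_2)
      also have "\<dots> \<le> d\<^sup>2 * \<xi>\<^sup>2" by (simp add: power_mult_distrib)
      also have "\<dots> \<le> d\<^sup>2 * wt 2 \<xi>" by (intro mult_left_mono) (simp_all add: power2_sum)
      finally show "cmod (iexp (d * \<xi>) - (1 + \<i> * of_real (d * \<xi>))) \<le> d\<^sup>2 * wt 2 \<xi>" .
    qed simp
    finally show "cmod (R \<xi>) \<le> d\<^sup>2 * ?w \<xi>"
      by (simp add: norm_mult del: of_real_power of_real_add)
  qed simp_all
  finally have "norm (invft g y - invft g x - d *\<^sub>R invft ?g' x) / norm d \<le> d\<^sup>2 * (LBINT \<xi>. ?w \<xi>) / norm d"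
    by (intro divide_right_mono) simp_all
  also have "\<dots> = norm d * (LBINT \<xi>. ?w \<xi>)"
  proof -
    have "a\<^sup>2 * C / norm a = norm a * C" if "a \<noteq> 0" for a C :: real
      using that by (simp add: power2_eq_square abs_if)
    then show ?thesis using y by (simp add: d_def)
  qed
  finally show "norm (invft g y - invft g x - (y - x) *\<^sub>R invft ?g' x) / norm (y - x) \<le> norm (y - x) * (LBINT \<xi>. ?w \<xi>)"
    unfolding d_def .
next
  show "((\<lambda>y. norm (y - x) * (LBINT \<xi>. cmod (of_real (wt 2 \<xi>) * g \<xi>))) \<longlongrightarrow> 0) (at x)"
    by (auto intro!: tendsto_eq_intros)
qed simp

lemma dx_invft: "rapid g \<Longrightarrow> dx (invft g) = invft (\<lambda>\<xi>. \<i> * of_real \<xi> * g \<xi>)"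
  using vector_derivative_at[OF invft_has_vector_derivative] by (auto simp: dx_def)

lemma continuous_invft: "rapid g \<Longrightarrow> continuous_on UNIV (invft g)"
  using invft_has_vector_derivative
  by (auto simp: continuous_on_eq_continuous_at intro!: has_vector_derivative_continuous)

text \<open>The set where they differ is open and negligible.\<close>

lemma continuous_AE_eq:
  fixes f g :: "real \<Rightarrow> complex"
  assumes "continuous_on UNIV f" "continuous_on UNIV g" "AE x in lborel. f x = g x"
  shows "f = g"
proof (rule ccontr)
  assume "f \<noteq> g"
  then have ne: "{x. f x \<noteq> g x} \<noteq> {}" by auto
  have "open {x. f x \<noteq> g x}" by (rule open_Collect_neq[OF assms(1,2)])
  then have "\<not> negligible {x. f x \<noteq> g x}" "{x. f x \<noteq> g x} \<in> sets lborel"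
    using open_not_negligible[OF _ ne] by auto
  moreover have "{x. f x \<noteq> g x} \<in> null_sets lborel"
    using assms(3) AE_iff_null[of lborel "\<lambda>x. f x = g x"] calculation(2) by simp
  ultimately show False by (auto simp: negligible_iff_null_sets null_sets_completionI)
qed

text \<open>The smooth functions in every \<open>H\<^sup>n\<close>, and those of them with nonnegative frequencies. Being
  given as inverse transforms, they are the continuous representatives of their classes.\<close>

definition Hinf :: "(real \<Rightarrow> complex) set" where
  "Hinf = {invft g | g. rapid g}"

definition Hpos :: "(real \<Rightarrow> complex) set" where
  "Hpos = {invft g | g. rapid g \<and> (\<forall>\<xi><0. g \<xi> = 0)}"

text \<open>The inner product on representatives, where pointwise factors can be moved from one side to the
  other.\<close>

definition ip :: "(real \<Rightarrow> complex) \<Rightarrow> (real \<Rightarrow> complex) \<Rightarrow> real" where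
  "ip u v = (LBINT x. Re (cnj (u x) * v x))"

lemma Hpos_Hinf: "u \<in> Hpos \<Longrightarrow> u \<in> Hinf"
  unfolding Hpos_def Hinf_def by auto

lemma Hinf_sqint: "u \<in> Hinf \<Longrightarrow> sqint u"
  unfolding Hinf_def by (auto intro: invft_sqint dest: rapid_integrable rapid_sqint)

lemma HinfI: "rapid g \<Longrightarrow> u = invft g \<Longrightarrow> u \<in> Hinf"
  unfolding Hinf_def by blast

lemma HinfE:
  assumes "u \<in> Hinf" obtains g where "rapid g" "u = invft g"
  using assms unfolding Hinf_def by blast

lemma HposI: "rapid g \<Longrightarrow> (\<And>\<xi>. \<xi> < 0 \<Longrightarrow> g \<xi> = 0) \<Longrightarrow> u = invft g \<Longrightarrow> u \<in> Hpos"
  unfolding Hpos_def by blast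

lemma HposE:
  assumes "u \<in> Hpos" obtains g where "rapid g" "\<And>\<xi>. \<xi> < 0 \<Longrightarrow> g \<xi> = 0" "u = invft g"
  using assms unfolding Hpos_def by blast

lemma Hinf_add: "u \<in> Hinf \<Longrightarrow> v \<in> Hinf \<Longrightarrow> (\<lambda>x. u x + v x) \<in> Hinf"
  by (elim HinfE) (hypsubst, rule HinfI[OF rapid_add invft_add[symmetric]]; assumption)

lemma Hinf_cmult: "u \<in> Hinf \<Longrightarrow> (\<lambda>x. c * u x) \<in> Hinf"
  by (elim HinfE) (hypsubst, rule HinfI[OF rapid_cmult invft_cmult[symmetric]]; assumption)

lemma Hinf_mult: "u \<in> Hinf \<Longrightarrow> v \<in> Hinf \<Longrightarrow> (\<lambda>x. u x * v x) \<in> Hinf"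
  by (elim HinfE) (hypsubst, rule HinfI[OF rapid_conv invft_conv[symmetric]]; assumption)

lemma Hinf_cnj: "u \<in> Hinf \<Longrightarrow> (\<lambda>x. cnj (u x)) \<in> Hinf"
  by (elim HinfE) (hypsubst, rule HinfI[OF rapid_star invft_star[symmetric]]; assumption)

lemma Hinf_dx: "u \<in> Hinf \<Longrightarrow> dx u \<in> Hinf"
  by (elim HinfE) (hypsubst, rule HinfI[OF rapid_times dx_invft]; assumption)

lemma Hpos_add: "u \<in> Hpos \<Longrightarrow> v \<in> Hpos \<Longrightarrow> (\<lambda>x. u x + v x) \<in> Hpos"
  by (elim HposE) (hypsubst, rule HposI[OF rapid_add _ invft_add[symmetric]]; simp add: conv_pos)

lemma Hpos_cmult: "u \<in> Hpos \<Longrightarrow> (\<lambda>x. c * u x) \<in> Hpos"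
  by (elim HposE) (hypsubst, rule HposI[OF rapid_cmult _ invft_cmult[symmetric]]; simp add: conv_pos)

lemma Hpos_mult: "u \<in> Hpos \<Longrightarrow> v \<in> Hpos \<Longrightarrow> (\<lambda>x. u x * v x) \<in> Hpos"
  by (elim HposE) (hypsubst, rule HposI[OF rapid_conv _ invft_conv[symmetric]]; simp add: conv_pos)

lemma Hpos_dx: "u \<in> Hpos \<Longrightarrow> dx u \<in> Hpos"
  by (elim HposE) (hypsubst, rule HposI[OF rapid_times _ dx_invft]; simp add: conv_pos)

lemma Hinf_has_vector_derivative: "u \<in> Hinf \<Longrightarrow> (u has_vector_derivative dx u x) (at x)"
  unfolding Hinf_def using invft_has_vector_derivative dx_invft by auto

lemma dx_eqI: "(\<And>x. (f has_vector_derivative f' x) (at x)) \<Longrightarrow> dx f = f'"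
  by (rule ext) (simp add: dx_def vector_derivative_at)

lemma dx_add: "u \<in> Hinf \<Longrightarrow> v \<in> Hinf \<Longrightarrow> dx (\<lambda>x. u x + v x) = (\<lambda>x. dx u x + dx v x)"
  by (intro dx_eqI has_vector_derivative_add Hinf_has_vector_derivative)

lemma dx_cmult: "u \<in> Hinf \<Longrightarrow> dx (\<lambda>x. c * u x) = (\<lambda>x. c * dx u x)"
  by (intro dx_eqI has_vector_derivative_mult_right Hinf_has_vector_derivative)

lemma dx_mult: "u \<in> Hinf \<Longrightarrow> v \<in> Hinf \<Longrightarrow> dx (\<lambda>x. u x * v x) = (\<lambda>x. u x * dx v x + dx u x * v x)"
  by (intro dx_eqI has_vector_derivative_mult Hinf_has_vector_derivative)

lemma dx_cnj: "u \<in> Hinf \<Longrightarrow> dx (\<lambda>x. cnj (u x)) = (\<lambda>x. cnj (dx u x))"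
  by (intro dx_eqI has_vector_derivative_cnj Hinf_has_vector_derivative)

lemma ip_eq_inner: "sqint u \<Longrightarrow> sqint v \<Longrightarrow> ip u v = abs_ltwo u \<bullet> abs_ltwo v"
  by (simp add: ip_def inner_abs_ltwo)

lemma ip_commute: "ip u v = ip v u"
  unfolding ip_def by (intro Bochner_Integration.integral_cong) auto

lemma ip_add_right:
  assumes "sqint u" "sqint v" "sqint w"
  shows "ip u (\<lambda>x. v x + w x) = ip u v + ip u w"
  using assms by (simp add: ip_eq_inner sqint_add abs_ltwo_add inner_simps)

lemma ip_scale_right: "ip u (\<lambda>x. of_real r * v x) = r * ip u v"
proof -
  have "Re (cnj (u x) * (of_real r * v x)) = r * Re (cnj (u x) * v x)" for x by (simp add: algebra_simps)
  then show ?thesis unfolding ip_def by simp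
qed

lemma ip_i_self: "ip u (\<lambda>x. \<i> * u x) = 0"
  unfolding ip_def by (simp add: mult.commute)

text \<open>Plancherel's theorem in polarised form.\<close>

lemma ip_invft:
  assumes "rapid g" "rapid k" shows "ip (invft g) (invft k) = ip g k"
proof -
  have s: "integrable lborel g" "sqint g" "integrable lborel k" "sqint k"
    using assms by (auto intro: rapid_integrable rapid_sqint)
  have "ip (invft g) (invft k) = four (abs_ltwo (invft g)) \<bullet> abs_ltwo k"
    using s by (simp add: ip_eq_inner invft_sqint invft_inner)
  also have "\<dots> = ip g k" using s by (simp add: four_invft ip_eq_inner)
  finally show ?thesis .
qed

text \<open>Integration by parts: on the Fourier side \<open>dx\<close> is multiplication by the imaginary number \<open>\<i> \<xi>\<close>.\<close>

lemma ip_dx: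
  assumes "u \<in> Hinf" "v \<in> Hinf" shows "ip (dx u) v = - ip u (dx v)"
proof -
  obtain g where g: "rapid g" "u = invft g" using assms unfolding Hinf_def by auto
  obtain k where k: "rapid k" "v = invft k" using assms unfolding Hinf_def by auto
  have "ip (dx u) v = ip (\<lambda>\<xi>. \<i> * of_real \<xi> * g \<xi>) k"
    unfolding g k dx_invft[OF g(1)] by (intro ip_invft rapid_times g k)
  also have "\<dots> = - ip g (\<lambda>\<xi>. \<i> * of_real \<xi> * k \<xi>)"
    unfolding ip_def Bochner_Integration.integral_minus[symmetric]
    by (intro Bochner_Integration.integral_cong) (auto simp: algebra_simps)
  also have "ip g (\<lambda>\<xi>. \<i> * of_real \<xi> * k \<xi>) = ip u (dx v)"
    unfolding g k dx_invft[OF k(1)] by (intro ip_invft[symmetric] rapid_times g k)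
  finally show ?thesis .
qed

lemma ip_dx_self: "u \<in> Hinf \<Longrightarrow> ip u (dx u) = 0"
  using ip_dx[of u u] ip_commute[of u "dx u"] by simp

lemma invft_pos_part_Hpos: "rapid g \<Longrightarrow> invft (pos_part g) \<in> Hpos"
  unfolding Hpos_def using rapid_pos_part by (auto simp: pos_part_def)

text \<open>The projection changes only negative frequencies, and \<open>v\<close> has none.\<close>

lemma ip_pos_part:
  assumes "v \<in> Hpos" "rapid g"
  shows "ip v (invft (pos_part g)) = ip v (invft g)"
proof -
  obtain k where k: "rapid k" "\<forall>\<xi><0. k \<xi> = 0" "v = invft k" using assms unfolding Hpos_def by auto
  show ?thesis
    unfolding k(3) ip_invft[OF k(1) rapid_pos_part[OF assms(2)]] ip_invft[OF k(1) assms(2)]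
    unfolding ip_def by (intro Bochner_Integration.integral_cong) (use k in \<open>auto simp: pos_part_def not_le\<close>)
qed

text \<open>The transform of a real function is fixed by \<open>star\<close>, so its negative frequencies are the image of
  the positive ones. The two halves overlap only at the frequency \<open>0\<close>, a null set.\<close>

lemma real_part_pos_part:
  assumes g: "rapid g" and real: "\<And>x. cnj (invft g x) = invft g x"
  shows "invft (pos_part g) x + cnj (invft (pos_part g) x) = invft g x"
proof -
  have [measurable]: "g \<in> borel_measurable borel" using g by (rule rapid_measurable)
  have s: "AE \<xi> in lborel. star g \<xi> = g \<xi>"
  proof -
    have "invft (star g) = invft g" using real by (simp add: invft_star)
    then have "abs_ltwo (star g) = abs_ltwo g"
      using four_invft[OF rapid_integrable[OF g] rapid_sqint[OF g]]
        four_invft[OF rapid_integrable[OF rapid_star[OF g]] rapid_sqint[OF rapid_star[OF g]]] by simp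
    then show ?thesis by (simp add: abs_ltwo_eq_iff rapid_sqint rapid_star g)
  qed
  have "invft (\<lambda>\<xi>. pos_part g \<xi> + star (pos_part g) \<xi>) = invft g"
  proof (rule invft_cong_AE)
    show "AE \<xi> in lborel. pos_part g \<xi> + star (pos_part g) \<xi> = g \<xi>"
      using s AE_lborel_singleton[of 0]
      by eventually_elim (auto simp: pos_part_def star_def)
  qed measurable
  then show ?thesis
    using invft_add[OF rapid_pos_part[OF g] rapid_star[OF rapid_pos_part[OF g]]]
    by (simp add: invft_star fun_eq_iff)
qed

section \<open>The equation on smooth functions\<close>

text \<open>The Sobolev norms control the weighted norms in \<open>rapid\<close>, and Fourier inversion, valid almost
  everywhere, holds everywhere by continuity.\<close>

lemma Hinf_plus_rapid:
  assumes u: "u \<in> Hinf_plus"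
  obtains g where "rapid g" "\<And>\<xi>. \<xi> < 0 \<Longrightarrow> g \<xi> = 0" "u = invft g" "AE \<xi> in lborel. fourier u \<xi> = g \<xi>"
proof -
  have H: "u \<in> H_plus n" if "n \<ge> 1" for n using u that by (simp add: Hinf_plus_def)
  have su: "sqint u" using H[of 1] by (simp add: H_plus_def L2_iff_sqint)
  have sf: "sqint (fourier u)" by (rule fourier_sqint[OF su])
  have [measurable]: "fourier u \<in> borel_measurable borel" using sf by (rule sqint_measurable)
  have fin: "(\<integral>\<^sup>+\<xi>. ennreal ((1 + \<xi>\<^sup>2) ^ n * (cmod (fourier u \<xi>))\<^sup>2) \<partial>lborel) < \<infinity>" if "n \<ge> 1" for n
  proof -
    have "Sobolev_norm n u < \<infinity>" using H[OF that] by (simp add: H_plus_def)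
    then show ?thesis by (auto simp: Sobolev_norm_def ennreal_sqrt_def less_top[symmetric] split: if_splits)
  qed
  have r: "rapid (fourier u)"
    unfolding rapid_def
  proof
    fix n
    let ?f = "\<lambda>\<xi>. complex_of_real (wt n \<xi>) * fourier u \<xi>"
    have "(\<integral>\<^sup>+\<xi>. ennreal ((cmod (?f \<xi>))\<^sup>2) \<partial>lborel)
      \<le> (\<integral>\<^sup>+\<xi>. ennreal (2 ^ Suc n) * ennreal ((1 + \<xi>\<^sup>2) ^ Suc n * (cmod (fourier u \<xi>))\<^sup>2) \<partial>lborel)"
    proof (rule nn_integral_mono)
      fix \<xi> :: real
      have "(1 + \<bar>\<xi>\<bar>)\<^sup>2 \<le> 2 * (1 + \<xi>\<^sup>2)"
        using zero_le_power2[of "1 - \<bar>\<xi>\<bar>"] by (simp add: power2_sum power2_diff)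
      then have "((1 + \<bar>\<xi>\<bar>)\<^sup>2) ^ n \<le> (2 * (1 + \<xi>\<^sup>2)) ^ n" by (rule power_mono) simp
      also have "\<dots> \<le> (2 * (1 + \<xi>\<^sup>2)) ^ Suc n" by (rule power_increasing) (auto simp: add_increasing)
      finally have "((1 + \<bar>\<xi>\<bar>)\<^sup>2) ^ n * (cmod (fourier u \<xi>))\<^sup>2 \<le> (2 * (1 + \<xi>\<^sup>2)) ^ Suc n * (cmod (fourier u \<xi>))\<^sup>2"
        by (rule mult_right_mono) simp
      moreover have "(cmod (?f \<xi>))\<^sup>2 = ((1 + \<bar>\<xi>\<bar>)\<^sup>2) ^ n * (cmod (fourier u \<xi>))\<^sup>2"
        by (simp add: norm_mult power_mult_distrib power_mult[symmetric] mult.commute del: of_real_power of_real_add)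
      ultimately have "(cmod (?f \<xi>))\<^sup>2 \<le> 2 ^ Suc n * ((1 + \<xi>\<^sup>2) ^ Suc n * (cmod (fourier u \<xi>))\<^sup>2)"
        by (simp only: power_mult_distrib mult.assoc)
      then show "ennreal ((cmod (?f \<xi>))\<^sup>2) \<le> ennreal (2 ^ Suc n) * ennreal ((1 + \<xi>\<^sup>2) ^ Suc n * (cmod (fourier u \<xi>))\<^sup>2)"
        by (subst ennreal_mult[symmetric]) (auto intro!: ennreal_leI)
    qed
    also have "\<dots> = ennreal (2 ^ Suc n) * (\<integral>\<^sup>+\<xi>. ennreal ((1 + \<xi>\<^sup>2) ^ Suc n * (cmod (fourier u \<xi>))\<^sup>2) \<partial>lborel)"
      by (rule nn_integral_cmult) measurable
    also have "\<dots> < \<infinity>" using fin[of "Suc n"] by (simp add: ennreal_mult_less_top)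
    finally have "(\<integral>\<^sup>+\<xi>. ennreal ((cmod (?f \<xi>))\<^sup>2) \<partial>lborel) < \<infinity>" .
    moreover have "?f \<in> borel_measurable borel" by measurable
    ultimately show "sqint ?f" unfolding sqint_iff_nn_integral by blast
  qed
  have a: "AE \<xi> in lborel. fourier u \<xi> = pos_part (fourier u) \<xi>"
    using H[of 1] unfolding H_plus_def fourier_supp_nonneg_def
    by (auto simp: pos_part_def elim!: eventually_mono)
  have "AE x in lborel. u x = invft (pos_part (fourier u)) x"
    by (rule fourier_inversion[OF su _ _ a]) (intro rapid_integrable rapid_sqint rapid_pos_part r)+
  then have "u = invft (pos_part (fourier u))"
    using u by (intro continuous_AE_eq continuous_invft rapid_pos_part r) (auto simp: Hinf_plus_def)
  then show ?thesis
    using a that[of "pos_part (fourier u)"] rapid_pos_part[OF r] by (auto simp: pos_part_def)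
qed

lemma Hinf_plus_Hpos: "u \<in> Hinf_plus \<Longrightarrow> u \<in> Hpos"
  by (elim Hinf_plus_rapid) (rule HposI)

lemma fourier_invft:
  assumes "rapid g" shows "AE \<xi> in lborel. fourier (invft g) \<xi> = g \<xi>"
proof -
  have s: "integrable lborel g" "sqint g" using assms by (auto intro: rapid_integrable rapid_sqint)
  have "abs_ltwo (fourier (invft g)) = abs_ltwo g"
    using fourier_sqint(2)[OF invft_sqint(1)[OF s]] four_invft[OF s] by simp
  then show ?thesis using s fourier_sqint(1)[OF invft_sqint(1)[OF s]] by (simp add: abs_ltwo_eq_iff)
qed

text \<open>The density \<open>|u|\<^sup>2\<close> is an inverse transform of a rapid function \<open>r\<close>, and then \<open>w\<close> is the one of
  \<open>pos_part r\<close>. All three properties of the projection used later can be read off from this.\<close>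

lemma szego_proj_density:
  assumes u: "u \<in> Hinf" and w: "is_szego_proj (\<lambda>x. of_real ((cmod (u x))\<^sup>2)) w" "continuous_on UNIV w"
  shows "w \<in> Hpos" "\<And>v. v \<in> Hpos \<Longrightarrow> ip v (\<lambda>x. u x * cnj (u x)) = ip v w"
    "\<And>x. u x * cnj (u x) = w x + cnj (w x)"
proof -
  have eq: "(\<lambda>x. complex_of_real ((cmod (u x))\<^sup>2)) = (\<lambda>x. u x * cnj (u x))"
    by (simp only: complex_norm_square)
  obtain r where r: "rapid r" "(\<lambda>x. u x * cnj (u x)) = invft r"
    using Hinf_mult[OF u Hinf_cnj[OF u]] by (rule HinfE)
  have sw: "sqint w" using w(1) by (simp add: is_szego_proj_def L2_iff_sqint)
  have "AE \<xi> in lborel. fourier w \<xi> = indicator {0..} \<xi> * fourier (invft r) \<xi>"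
    using w(1) unfolding is_szego_proj_def eq r(2) by simp
  then have "AE \<xi> in lborel. fourier w \<xi> = pos_part r \<xi>"
    using fourier_invft[OF r(1)] by eventually_elim (auto simp: pos_part_def indicator_def)
  then have "AE x in lborel. w x = invft (pos_part r) x"
    by (rule fourier_inversion[OF sw rapid_integrable[OF rapid_pos_part[OF r(1)]]
        rapid_sqint[OF rapid_pos_part[OF r(1)]]])
  then have wr: "w = invft (pos_part r)"
    by (intro continuous_AE_eq continuous_invft rapid_pos_part r w)
  show "w \<in> Hpos" unfolding wr by (rule invft_pos_part_Hpos[OF r(1)])
  show "ip v (\<lambda>x. u x * cnj (u x)) = ip v w" if "v \<in> Hpos" for v
    unfolding wr r(2) using ip_pos_part[OF that r(1)] by simp
  show "u x * cnj (u x) = w x + cnj (w x)" for x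
  proof -
    have "cnj (invft r x) = invft r x" for x
      using fun_cong[OF r(2), of x] by (metis complex_cnj_cnj complex_cnj_mult mult.commute)
    then show ?thesis unfolding wr using real_part_pos_part[OF r(1)] fun_cong[OF r(2), of x] by simp
  qed
qed

text \<open>Solving the equation for the time derivative gives
  \<open>\<i> q'' + 2 q w'\<close>, where \<open>w = C\<^sub>+(|q|\<^sup>2)\<close>. The convergence of difference quotients in the definition of a
  solution is differentiability of the curve of classes in \<open>ltwo\<close>.\<close>

lemma solution_at:
  assumes u: "is_solution u"
  obtains w where "u t \<in> Hpos" "w \<in> Hpos"
    "\<forall>v\<in>Hpos. ip v (\<lambda>x. u t x * cnj (u t x)) = ip v w"
    "\<forall>x. u t x * cnj (u t x) = w x + cnj (w x)"
    "((\<lambda>s. abs_ltwo (u s)) has_vector_derivative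
        abs_ltwo (\<lambda>x. \<i> * dx (dx (u t)) x + 2 * (u t x * dx w x))) (at t)"
proof -
  have H: "u s \<in> Hpos" for s using u by (auto simp: is_solution_def intro: Hinf_plus_Hpos)
  obtain w where w: "is_szego_proj (\<lambda>x. of_real ((cmod (u t x))\<^sup>2)) w" "continuous_on UNIV w"
    "((\<lambda>h. L2_norm (\<lambda>x. \<i> * ((u (t + h) x - u t x) / of_real h)
                 - (- dx (dx (u t)) x + 2 * \<i> * u t x * dx w x))) \<longlongrightarrow> 0) (at 0)"
    using u unfolding is_solution_def by blast
  note dens = szego_proj_density[OF Hpos_Hinf[OF H] w(1,2)]
  define V where "V x = \<i> * dx (dx (u t)) x + 2 * (u t x * dx w x)" for x
  have V: "V \<in> Hpos" unfolding V_def[abs_def] by (intro Hpos_add Hpos_cmult Hpos_mult Hpos_dx H dens)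
  have s: "sqint (u s)" "sqint V" for s using H V by (auto intro: Hinf_sqint Hpos_Hinf)
  have L: "L2_norm (\<lambda>x. \<i> * ((u (t + h) x - u t x) / of_real h)
                 - (- dx (dx (u t)) x + 2 * \<i> * u t x * dx w x))
      = ennreal (norm ((abs_ltwo (u (t + h)) - abs_ltwo (u t)) /\<^sub>R h - abs_ltwo V))" for h
  proof -
    let ?D = "\<lambda>x. of_real (inverse h) * (u (t + h) x - u t x) - V x"
    have sD: "sqint ?D" by (intro sqint_diff sqint_cmult s)
    have "\<i> * ((u (t + h) x - u t x) / of_real h) - (- dx (dx (u t)) x + 2 * \<i> * u t x * dx w x) = \<i> * ?D x" for x
      by (simp add: V_def field_simps divide_inverse[symmetric])
    then have "L2_norm (\<lambda>x. \<i> * ((u (t + h) x - u t x) / of_real h)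
                 - (- dx (dx (u t)) x + 2 * \<i> * u t x * dx w x)) = L2_norm ?D"
      by (simp only: L2_norm_def norm_mult) simp
    also have "\<dots> = ennreal (norm ((abs_ltwo (u (t + h)) - abs_ltwo (u t)) /\<^sub>R h - abs_ltwo V))"
      using L2_norm_eq[OF sD] by (simp only: abs_ltwo_diff abs_ltwo_scaleR sqint_diff sqint_cmult s)
    finally show ?thesis .
  qed
  have "((\<lambda>h. ennreal (norm ((abs_ltwo (u (t + h)) - abs_ltwo (u t)) /\<^sub>R h - abs_ltwo V))) \<longlongrightarrow> ennreal 0) (at 0)"
    using w(3) unfolding L by simp
  then have "((\<lambda>h. norm ((abs_ltwo (u (t + h)) - abs_ltwo (u t)) /\<^sub>R h - abs_ltwo V)) \<longlongrightarrow> 0) (at 0)"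
    by (subst (asm) tendsto_ennreal_iff) auto
  then have l: "((\<lambda>h. (abs_ltwo (u (t + h)) - abs_ltwo (u t)) /\<^sub>R h - abs_ltwo V) \<longlongrightarrow> 0) (at 0)"
    by (rule tendsto_norm_zero_cancel)
  have "((\<lambda>s. abs_ltwo (u s)) has_vector_derivative abs_ltwo V) (at t)"
    unfolding has_vector_derivative_def has_derivative_at
  proof
    show "bounded_linear (\<lambda>x. x *\<^sub>R abs_ltwo V)" by (rule bounded_linear_scaleR_left)
    have "\<forall>\<^sub>F h in at 0. norm ((abs_ltwo (u (t + h)) - abs_ltwo (u t)) /\<^sub>R h - abs_ltwo V) =
      norm (abs_ltwo (u (t + h)) - abs_ltwo (u t) - h *\<^sub>R abs_ltwo V) / norm h"
      unfolding eventually_at_filter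
    proof (rule always_eventually, intro allI impI)
      fix h :: real assume h: "h \<noteq> 0"
      have "(abs_ltwo (u (t + h)) - abs_ltwo (u t)) /\<^sub>R h - abs_ltwo V
        = (abs_ltwo (u (t + h)) - abs_ltwo (u t) - h *\<^sub>R abs_ltwo V) /\<^sub>R h"
        using h by (simp add: scaleR_diff_right)
      then show "norm ((abs_ltwo (u (t + h)) - abs_ltwo (u t)) /\<^sub>R h - abs_ltwo V) =
        norm (abs_ltwo (u (t + h)) - abs_ltwo (u t) - h *\<^sub>R abs_ltwo V) / norm h"
        by (simp add: divide_inverse mult.commute)
    qed
    then show "(\<lambda>h. norm (abs_ltwo (u (t + h)) - abs_ltwo (u t) - h *\<^sub>R abs_ltwo V) / norm h) \<midarrow>0\<rightarrow> 0"
      by (rule tendsto_cong[THEN iffD1, OF _ tendsto_norm_zero[OF l]])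
  qed
  then show ?thesis unfolding V_def[abs_def] by (intro that[of w] H dens ballI allI)
qed

section \<open>Conservation laws\<close>

lemma ip_cong: "(\<And>x. Re (cnj (a x) * b x) = Re (cnj (c x) * d x)) \<Longrightarrow> ip a b = ip c d"
  unfolding ip_def by simp

lemma dx_i: "u \<in> Hinf \<Longrightarrow> dx (\<lambda>x. \<i> * u x) = (\<lambda>x. \<i> * dx u x)"
  by (rule dx_cmult)

lemma ip_i_dx_dx:
  assumes u: "u \<in> Hinf" shows "ip u (\<lambda>x. \<i> * dx (dx u) x) = 0"
proof -
  have "ip u (\<lambda>x. \<i> * dx (dx u) x) = ip u (dx (\<lambda>x. \<i> * dx u x))"
    by (simp add: dx_i Hinf_dx u)
  also have "\<dots> = - ip (dx u) (\<lambda>x. \<i> * dx u x)"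
    using ip_dx[OF u Hinf_cmult[OF Hinf_dx[OF u], of \<i>]] by simp
  finally show ?thesis by (simp add: ip_i_self)
qed

text \<open>The dispersive term is skew. The other one is twice \<open>\<langle>|q|\<^sup>2, w'\<rangle> = \<langle>w, w'\<rangle>\<close>, since \<open>w'\<close> has nonnegative
  frequencies, and this vanishes by parts.\<close>

lemma mass_rate_zero:
  assumes q: "q \<in> Hpos" and w: "w \<in> Hpos"
    and proj_w: "\<And>v. v \<in> Hpos \<Longrightarrow> ip v (\<lambda>x. q x * cnj (q x)) = ip v w"
  shows "ip q (\<lambda>x. \<i> * dx (dx q) x + 2 * (q x * dx w x)) = 0"
proof -
  have q': "q \<in> Hinf" and w': "w \<in> Hinf" using q w by (auto intro: Hpos_Hinf)
  have "ip q (\<lambda>x. \<i> * dx (dx q) x + of_real 2 * (q x * dx w x)) = ip q (\<lambda>x. \<i> * dx (dx q) x) + ip q (\<lambda>x. of_real 2 * (q x * dx w x))"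
    by (intro ip_add_right Hinf_sqint Hinf_cmult Hinf_mult Hinf_dx q' w')
  also have "ip q (\<lambda>x. of_real 2 * (q x * dx w x)) = 2 * ip q (\<lambda>x. q x * dx w x)" by (rule ip_scale_right)
  also have "ip q (\<lambda>x. q x * dx w x) = ip (dx w) (\<lambda>x. q x * cnj (q x))"
    by (rule ip_cong) (simp add: algebra_simps)
  also have "\<dots> = ip (dx w) w" by (intro proj_w Hpos_dx w)
  also have "\<dots> = 0" using ip_dx_self[OF w'] by (simp add: ip_commute)
  finally show ?thesis using ip_i_dx_dx[OF q'] by simp
qed

text \<open>Here \<open>q\<close> is the state, \<open>f\<close> the resolvent \<open>(L\<^sub>q + \<kappa>)\<^sup>-\<^sup>1 q\<close>, \<open>h = C\<^sub>+(cnj q f)\<close> and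
  \<open>w = C\<^sub>+(|q|\<^sup>2)\<close>. The resolvent equation reads \<open>q (1 + h) = - \<i> f' + \<kappa> f\<close>, and the projections enter only
  through their pairings with functions in the Hardy space.\<close>

locale lax_identity =
  fixes q f h w :: "real \<Rightarrow> complex" and \<kappa> :: real
  assumes q: "q \<in> Hpos" and f: "f \<in> Hpos" and h: "h \<in> Hpos" and w: "w \<in> Hpos"
    and eq: "\<And>x. q x + q x * h x = - \<i> * dx f x + of_real \<kappa> * f x"
    and proj_h: "\<And>v. v \<in> Hpos \<Longrightarrow> ip v (\<lambda>x. cnj (q x) * f x) = ip v h"
    and proj_w: "\<And>v. v \<in> Hpos \<Longrightarrow> ip v (\<lambda>x. q x * cnj (q x)) = ip v w"
    and dens: "\<And>x. q x * cnj (q x) = w x + cnj (w x)"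
begin

lemmas H = q f h w Hpos_Hinf[OF q] Hpos_Hinf[OF f] Hpos_Hinf[OF h] Hpos_Hinf[OF w]

lemmas HI = H Hpos_dx Hpos_mult Hpos_add Hpos_cmult Hinf_dx Hinf_mult Hinf_add Hinf_cmult Hinf_cnj

lemma ip_f_q:
  assumes v: "v \<in> Hpos" shows "ip f (\<lambda>x. q x * v x) = ip v h"
proof -
  have "ip f (\<lambda>x. q x * v x) = ip v (\<lambda>x. cnj (q x) * f x)"
    by (rule ip_cong) (simp add: algebra_simps)
  also have "\<dots> = ip v h" by (rule proj_h[OF v])
  finally show ?thesis .
qed

text \<open>By the resolvent equation the function differentiated twice is a combination of \<open>f'\<close> and \<open>f\<close>, and
  all the resulting pairings of \<open>f\<close> with its derivatives are skew.\<close>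

lemma dispersion_term: "ip f (\<lambda>x. \<i> * dx (dx (\<lambda>x. q x + q x * h x)) x) = 0"
proof -
  have m: "(\<lambda>x. q x + q x * h x) = (\<lambda>x. - \<i> * dx f x + of_real \<kappa> * f x)" using eq by auto
  have "dx (dx (\<lambda>x. q x + q x * h x)) = (\<lambda>x. - \<i> * dx (dx (dx f)) x + of_real \<kappa> * dx (dx f) x)"
    unfolding m dx_add[OF Hinf_cmult[OF Hinf_dx[OF H(6)]] Hinf_cmult[OF H(6)]]
      dx_cmult[OF Hinf_dx[OF H(6)]] dx_cmult[OF H(6)]
      dx_add[OF Hinf_cmult[OF Hinf_dx[OF Hinf_dx[OF H(6)]]] Hinf_cmult[OF Hinf_dx[OF H(6)]]]
      dx_cmult[OF Hinf_dx[OF Hinf_dx[OF H(6)]]] ..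
  then have "ip f (\<lambda>x. \<i> * dx (dx (\<lambda>x. q x + q x * h x)) x) = ip f (\<lambda>x. dx (dx (dx f)) x + of_real \<kappa> * (\<i> * dx (dx f) x))"
    by (intro ip_cong) (simp add: algebra_simps)
  also have "\<dots> = ip f (dx (dx (dx f))) + ip f (\<lambda>x. of_real \<kappa> * (\<i> * dx (dx f) x))"
    by (intro ip_add_right Hinf_sqint HI)
  also have "ip f (\<lambda>x. of_real \<kappa> * (\<i> * dx (dx f) x)) = \<kappa> * ip f (\<lambda>x. \<i> * dx (dx f) x)"
    by (rule ip_scale_right)
  also have "ip f (\<lambda>x. \<i> * dx (dx f) x) = 0" by (rule ip_i_dx_dx[OF H(6)])
  also have "ip f (dx (dx (dx f))) = - ip (dx f) (dx (dx f))"
    using ip_dx[OF H(6), of "dx (dx f)"] by (simp add: HI)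
  also have "ip (dx f) (dx (dx f)) = 0" by (intro ip_dx_self HI)
  finally show ?thesis by simp
qed

text \<open>After one integration by parts, \<open>f'\<close> is eliminated by the resolvent equation. The density
  \<open>r = |q|\<^sup>2 = w + cnj w\<close> then appears twice: in \<open>\<langle>r, h'\<rangle> = \<langle>w, h'\<rangle>\<close>, and in \<open>\<langle>r h, h'\<rangle>\<close>, which is minus one half
  of \<open>\<langle>r' h, h\<rangle>\<close>, that is, minus the real part of the integral of \<open>w' |h|\<^sup>2\<close>.\<close>

lemma commutator_term:
  "ip f (\<lambda>x. \<i> * dx (\<lambda>x. q x * dx h x) x) = - ip (dx h) w + ip h (\<lambda>x. h x * dx w x)"
proof -
  define r where "r x = q x * cnj (q x)" for x
  have r: "r \<in> Hinf" unfolding r_def[abs_def] by (intro HI)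
  have dr: "dx r = (\<lambda>x. dx w x + cnj (dx w x))"
  proof -
    have "r = (\<lambda>x. w x + cnj (w x))" using dens by (auto simp: r_def)
    then show ?thesis by (simp add: dx_add dx_cnj HI)
  qed
  have S: "2 * ip (\<lambda>x. r x * h x) (dx h) = - 2 * ip h (\<lambda>x. h x * dx w x)"
  proof -
    have "ip (\<lambda>x. r x * h x) (dx h) = - ip (dx (\<lambda>x. r x * h x)) h"
      using ip_dx[OF Hinf_mult[OF r H(7)] H(7)] by simp
    also have "ip (dx (\<lambda>x. r x * h x)) h = ip h (\<lambda>x. r x * dx h x + dx r x * h x)"
      unfolding dx_mult[OF r H(7)] by (rule ip_commute)
    also have "\<dots> = ip h (\<lambda>x. r x * dx h x) + ip h (\<lambda>x. dx r x * h x)"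
      by (intro ip_add_right Hinf_sqint HI r)
    also have "ip h (\<lambda>x. r x * dx h x) = ip (\<lambda>x. r x * h x) (dx h)"
      by (rule ip_cong) (simp add: r_def algebra_simps)
    also have "ip h (\<lambda>x. dx r x * h x) = ip h (\<lambda>x. of_real 2 * (h x * dx w x))"
      unfolding dr by (rule ip_cong) (simp add: algebra_simps)
    also have "\<dots> = 2 * ip h (\<lambda>x. h x * dx w x)" by (rule ip_scale_right)
    finally show ?thesis by simp
  qed
  have "ip f (\<lambda>x. \<i> * dx (\<lambda>x. q x * dx h x) x) = ip f (dx (\<lambda>x. \<i> * (q x * dx h x)))"
    by (simp add: dx_i HI)
  also have "\<dots> = - ip (dx f) (\<lambda>x. \<i> * (q x * dx h x))"
    using ip_dx[OF H(6), of "\<lambda>x. \<i> * (q x * dx h x)"] by (simp add: HI)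
  also have "ip (dx f) (\<lambda>x. \<i> * (q x * dx h x)) = ip (\<lambda>x. q x * dx h x) (\<lambda>x. (q x + q x * h x) + of_real (- \<kappa>) * f x)"
  proof (rule ip_cong)
    fix x
    have dxf: "dx f x = \<i> * ((q x + q x * h x) + of_real (- \<kappa>) * f x)" unfolding eq by (simp add: algebra_simps)
    have i: "Re (cnj (\<i> * a) * (\<i> * b)) = Re (cnj b * a)" for a b by (simp add: algebra_simps)
    show "Re (cnj (dx f x) * (\<i> * (q x * dx h x))) = Re (cnj (q x * dx h x) * ((q x + q x * h x) + of_real (- \<kappa>) * f x))"
      unfolding dxf by (rule i)
  qed
  also have "\<dots> = ip (\<lambda>x. q x * dx h x) (\<lambda>x. q x + q x * h x) + ip (\<lambda>x. q x * dx h x) (\<lambda>x. of_real (- \<kappa>) * f x)"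
    by (intro ip_add_right Hinf_sqint HI)
  also have "ip (\<lambda>x. q x * dx h x) (\<lambda>x. of_real (- \<kappa>) * f x) = - \<kappa> * ip (\<lambda>x. q x * dx h x) f"
    by (rule ip_scale_right)
  also have "ip (\<lambda>x. q x * dx h x) f = 0"
    using ip_f_q[OF Hpos_dx[OF h]] ip_dx_self[OF H(7)] by (simp add: ip_commute)
  also have "ip (\<lambda>x. q x * dx h x) (\<lambda>x. q x + q x * h x) = ip (\<lambda>x. q x * dx h x) q + ip (\<lambda>x. q x * dx h x) (\<lambda>x. q x * h x)"
    by (intro ip_add_right Hinf_sqint HI)
  also have "ip (\<lambda>x. q x * dx h x) q = ip (dx h) (\<lambda>x. q x * cnj (q x))"
    by (rule ip_cong) (simp add: algebra_simps)
  also have "\<dots> = ip (dx h) w" by (intro proj_w HI)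
  also have "ip (\<lambda>x. q x * dx h x) (\<lambda>x. q x * h x) = ip (\<lambda>x. r x * h x) (dx h)"
    by (rule ip_cong) (simp add: r_def algebra_simps)
  finally show ?thesis using S by simp
qed

text \<open>The left-hand side is \<open>\<langle>f, V (1 + h)\<rangle>\<close>, which is half of the derivative of the energy along \<open>V\<close>. With
  \<open>m = q (1 + h)\<close> one has \<open>q'' (1 + h) = m'' - 2 (q h')' + q h''\<close>. The terms with \<open>m''\<close> and \<open>q h''\<close> are skew; the
  remaining one, evaluated in \<open>commutator_term\<close>, cancels against the contribution of \<open>2 q w' (1 + h)\<close>.\<close>

lemma energy_identity:
  defines "V \<equiv> \<lambda>x. \<i> * dx (dx q) x + 2 * (q x * dx w x)"
  shows "ip V f + ip (\<lambda>x. cnj (V x) * f x) h = 0"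
proof -
  have V: "V \<in> Hpos" unfolding V_def by (intro HI)
  define m where "m x = q x + q x * h x" for x
  have m: "m \<in> Hinf" unfolding m_def[abs_def] by (intro HI)
  have d1: "dx m = (\<lambda>x. dx q x + (q x * dx h x + dx q x * h x))"
    unfolding m_def[abs_def] by (simp add: dx_add dx_mult HI)
  have d2: "dx (dx m) = (\<lambda>x. dx (dx q) x + ((q x * dx (dx h) x + dx q x * dx h x) + (dx q x * dx h x + dx (dx q) x * h x)))"
    unfolding d1 by (simp add: dx_add dx_mult HI)
  have d3: "dx (\<lambda>x. q x * dx h x) = (\<lambda>x. q x * dx (dx h) x + dx q x * dx h x)"
    by (simp add: dx_mult HI)
  have "ip V f + ip (\<lambda>x. cnj (V x) * f x) h = ip f V + ip f (\<lambda>x. V x * h x)"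
    unfolding ip_commute[of V f] by (intro arg_cong2[where f="(+)"] refl ip_cong) (simp add: algebra_simps)
  also have "\<dots> = ip f (\<lambda>x. V x + V x * h x)"
    by (intro ip_add_right[symmetric] Hinf_sqint HI Hpos_Hinf[OF V])
  also have "(\<lambda>x. V x + V x * h x) = (\<lambda>x. \<i> * dx (dx m) x + (of_real (- 2) * (\<i> * dx (\<lambda>x. q x * dx h x) x)
      + (q x * (\<i> * dx (dx h) x) + (of_real 2 * (q x * dx w x) + of_real 2 * (q x * (h x * dx w x))))))"
    unfolding V_def d2 d3 by (rule ext) (simp add: algebra_simps)
  also have "ip f \<dots> = ip f (\<lambda>x. \<i> * dx (dx m) x) + (ip f (\<lambda>x. of_real (- 2) * (\<i> * dx (\<lambda>x. q x * dx h x) x))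
      + (ip f (\<lambda>x. q x * (\<i> * dx (dx h) x)) + (ip f (\<lambda>x. of_real 2 * (q x * dx w x)) + ip f (\<lambda>x. of_real 2 * (q x * (h x * dx w x))))))"
    by (subst ip_add_right; (intro Hinf_sqint HI m)?)+ simp
  also have "ip f (\<lambda>x. \<i> * dx (dx m) x) = 0" using dispersion_term by (simp add: m_def[abs_def])
  also have "ip f (\<lambda>x. of_real (- 2) * (\<i> * dx (\<lambda>x. q x * dx h x) x)) = - 2 * (- ip (dx h) w + ip h (\<lambda>x. h x * dx w x))"
    unfolding ip_scale_right commutator_term by simp
  also have "ip f (\<lambda>x. q x * (\<i> * dx (dx h) x)) = 0"
    using ip_f_q[of "\<lambda>x. \<i> * dx (dx h) x"] ip_i_dx_dx[OF H(7)] by (simp add: HI ip_commute)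
  also have "ip f (\<lambda>x. of_real 2 * (q x * dx w x)) = 2 * ip (dx w) h"
    unfolding ip_scale_right by (simp add: ip_f_q HI)
  also have "ip f (\<lambda>x. of_real 2 * (q x * (h x * dx w x))) = 2 * ip h (\<lambda>x. h x * dx w x)"
    unfolding ip_scale_right using ip_f_q[of "\<lambda>x. h x * dx w x"] by (simp add: HI ip_commute)
  also have "ip (dx w) h = - ip (dx h) w"
    using ip_dx[OF H(8) H(7)] by (simp add: ip_commute)
  finally show ?thesis by simp
qed

end

lemma real_derivative_zero_const:
  assumes "\<And>t. ((f :: real \<Rightarrow> real) has_real_derivative 0) (at t)" shows "f t = f s"
  using DERIV_isconst_all[of f] assms by blast

theorem mass_conserved:
  assumes u: "is_solution u" shows "nrm (u t) = nrm (u s)"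
proof -
  have "((\<lambda>s. abs_ltwo (u s) \<bullet> abs_ltwo (u s)) has_real_derivative 0) (at t)" for t
  proof -
    obtain w where w: "u t \<in> Hpos" "w \<in> Hpos"
      "\<forall>v\<in>Hpos. ip v (\<lambda>x. u t x * cnj (u t x)) = ip v w"
      "\<forall>x. u t x * cnj (u t x) = w x + cnj (w x)"
      "((\<lambda>s. abs_ltwo (u s)) has_vector_derivative
        abs_ltwo (\<lambda>x. \<i> * dx (dx (u t)) x + 2 * (u t x * dx w x))) (at t)"
      by (rule solution_at[OF u, of t])
    let ?V = "\<lambda>x. \<i> * dx (dx (u t)) x + 2 * (u t x * dx w x)"
    have V: "?V \<in> Hpos" by (intro Hpos_add Hpos_cmult Hpos_mult Hpos_dx w)
    have "((\<lambda>s. abs_ltwo (u s) \<bullet> abs_ltwo (u s)) has_vector_derivative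
        (abs_ltwo (u t) \<bullet> abs_ltwo ?V + abs_ltwo ?V \<bullet> abs_ltwo (u t))) (at t)"
      by (rule bounded_bilinear.has_vector_derivative[OF bounded_bilinear_inner w(5) w(5)])
    moreover have "abs_ltwo (u t) \<bullet> abs_ltwo ?V = ip (u t) ?V"
      using ip_eq_inner[OF Hinf_sqint[OF Hpos_Hinf[OF w(1)]] Hinf_sqint[OF Hpos_Hinf[OF V]]] by simp
    moreover have "ip (u t) ?V = 0" by (rule mass_rate_zero[OF w(1,2) w(3)[rule_format]])
    ultimately show ?thesis by (simp add: inner_commute has_real_derivative_iff_has_vector_derivative)
  qed
  from real_derivative_zero_const[OF this, of t s]
  show ?thesis by (simp add: norm_eq_sqrt_inner)
qed

section \<open>Quadratic forms with a bounded factor\<close>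

text \<open>In the application \<open>G\<close> is \<open>(D + \<kappa>)\<^sup>-\<^sup>1\<^sup>/\<^sup>2\<close> and \<open>K q f\<close> is \<open>C\<^sub>+(cnj q G f)\<close>, so that \<open>1 - Kt q (K q \<cdot>)\<close> is
  \<open>G (L\<^sub>q + \<kappa>) G\<close>. The quantity \<open>G q \<bullet> f\<close>, with \<open>f\<close> the solution for \<open>q\<close>, is the energy.\<close>

locale factored_form =
  fixes K Kt :: "'a :: {real_inner, complete_space} \<Rightarrow> 'a \<Rightarrow> 'a" and G :: "'a \<Rightarrow> 'a" and m :: real
  assumes K_bilinear: "bounded_bilinear K" and G_linear: "bounded_linear G"
    and adjoint: "h \<bullet> K q f = Kt q h \<bullet> f"
    and K_bound: "norm (K q f) \<le> m * norm q * norm f" and m_nonneg: "m \<ge> 0"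
begin

definition solves :: "'a \<Rightarrow> 'a \<Rightarrow> bool" where
  "solves q f \<longleftrightarrow> f = G q + Kt q (K q f)"

lemma Kt_bound: "norm (Kt q h) \<le> m * norm q * norm h"
proof (cases "Kt q h = 0")
  case True then show ?thesis using m_nonneg by simp
next
  case False
  have "norm (Kt q h) * norm (Kt q h) = h \<bullet> K q (Kt q h)"
    unfolding adjoint by (simp add: power2_norm_eq_inner[symmetric] power2_eq_square)
  also have "\<dots> \<le> norm h * norm (K q (Kt q h))" by (rule norm_cauchy_schwarz)
  also have "\<dots> \<le> norm h * (m * norm q * norm (Kt q h))" by (intro mult_left_mono K_bound) simp
  finally show ?thesis using False by (simp add: mult_ac)
qed

text \<open>An adjoint inherits linearity in both arguments, because vectors are separated by inner products.\<close>

lemma Kt_bilinear: "bounded_bilinear Kt"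
proof
  note K = bounded_bilinear.add_left[OF K_bilinear] bounded_bilinear.scaleR_left[OF K_bilinear]
  have ext: "x = y" if "\<And>f. x \<bullet> f = y \<bullet> f" for x y :: 'a 
    using that[of "x - y"] by (metis cancel_comm_monoid_add_class.diff_cancel inner_diff_left inner_eq_zero_iff right_minus_eq)
  show "Kt (a + a') b = Kt a b + Kt a' b" for a a' b
    by (rule ext) (simp add: adjoint[symmetric] K inner_simps)
  show "Kt a (b + b') = Kt a b + Kt a b'" for a b b'
    by (rule ext) (simp add: adjoint[symmetric] inner_simps)
  show "Kt (r *\<^sub>R a) b = r *\<^sub>R Kt a b" for r a b
    by (rule ext) (simp add: adjoint[symmetric] K inner_simps)
  show "Kt a (r *\<^sub>R b) = r *\<^sub>R Kt a b" for r a b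
    by (rule ext) (simp add: adjoint[symmetric] inner_simps)
  show "\<exists>M. \<forall>a b. norm (Kt a b) \<le> norm a * norm b * M"
    using Kt_bound by (intro exI[of _ m]) (simp add: mult_ac)
qed

lemma exists_solution:
  assumes "m * norm q < 1"
  obtains f where "solves q f"
proof -
  have p: "0 \<le> m * norm q" using m_nonneg by simp
  have "dist (G q + Kt q (K q x)) (G q + Kt q (K q y)) \<le> (m * norm q)\<^sup>2 * dist x y" for x y
  proof -
    have "Kt q (K q x) - Kt q (K q y) = Kt q (K q (x - y))"
      using bounded_bilinear.diff_right[OF Kt_bilinear] bounded_bilinear.diff_right[OF K_bilinear] by simp
    then have "dist (G q + Kt q (K q x)) (G q + Kt q (K q y)) = norm (Kt q (K q (x - y)))"
      by (simp add: dist_norm)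
    also have "\<dots> \<le> m * norm q * norm (K q (x - y))" by (rule Kt_bound)
    also have "\<dots> \<le> m * norm q * (m * norm q * norm (x - y))"
      using p by (intro mult_left_mono K_bound)
    finally show ?thesis by (simp add: power2_eq_square dist_norm mult_ac)
  qed
  moreover have "(m * norm q)\<^sup>2 < 1" using assms p by (simp add: abs_square_less_1)
  ultimately have "\<exists>!f. G q + Kt q (K q f) = f"
    by (intro banach_fix_type[of "(m * norm q)\<^sup>2"]) auto
  then show ?thesis using that unfolding solves_def by metis
qed

lemma solves_weak: "solves q f \<Longrightarrow> v \<bullet> G q = v \<bullet> f - K q v \<bullet> K q f"
  unfolding solves_def using adjoint[of "K q f" q v]
  by (metis add_diff_cancel_right' inner_commute inner_add_right)

text \<open>The form \<open>v \<bullet> v - K q v \<bullet> K q v\<close> is nonnegative at \<open>v = f - G q\<close>.\<close>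

lemma solves_lower:
  assumes small: "m * norm q \<le> 1" and sol: "solves q f"
  shows "(norm (G q))\<^sup>2 \<le> G q \<bullet> f"
proof -
  have "norm (K q (f - G q)) \<le> 1 * norm (f - G q)"
    using K_bound[of q "f - G q"] mult_right_mono[OF small norm_ge_zero, of "f - G q"] by simp
  then have "(norm (K q (f - G q)))\<^sup>2 \<le> (norm (f - G q))\<^sup>2" by (intro power_mono) auto
  then have 1: "K q (f - G q) \<bullet> K q (f - G q) \<le> (f - G q) \<bullet> (f - G q)" by (simp add: power2_norm_eq_inner)
  have 2: "f \<bullet> G q = f \<bullet> f - K q f \<bullet> K q f" "G q \<bullet> G q = G q \<bullet> f - K q (G q) \<bullet> K q f"
    by (rule solves_weak[OF sol])+
  have 3: "K q f \<bullet> K q f - 2 * (K q (G q) \<bullet> K q f) + K q (G q) \<bullet> K q (G q) \<le> f \<bullet> f - 2 * (f \<bullet> G q) + G q \<bullet> G q"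
    using 1 unfolding bounded_bilinear.diff_right[OF K_bilinear]
    by (simp add: inner_diff_left inner_diff_right inner_commute)
  have "0 \<le> K q (G q) \<bullet> K q (G q)" by simp
  then show ?thesis
    unfolding power2_norm_eq_inner using 2 3 inner_commute[of f "G q"] by linarith
qed

context
  fixes q f :: "real \<Rightarrow> 'a" and t c :: real and q' :: 'a
  assumes deriv: "(q has_vector_derivative q') (at t)"
    and small: "\<And>s. (m * norm (q s))\<^sup>2 \<le> c" "c < 1"
    and sol: "\<And>s. solves (q s) (f s)"
begin

lemma q_tendsto: "(q \<longlongrightarrow> q t) (at t)"
  using has_vector_derivative_continuous[OF deriv] by (simp add: continuous_at)

text \<open>The form at time \<open>s\<close> is coercive with constant \<open>1 - c\<close>. Evaluated at \<open>f s - f t\<close>, it is the pairing of this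
  difference with the residual that \<open>f t\<close> leaves in the equation at time \<open>s\<close>, and that residual tends to zero.\<close>

lemma solution_tendsto: "(f \<longlongrightarrow> f t) (at t)"
proof -
  define r where "r s = norm (G (q s) - f t + Kt (q s) (K (q s) (f t)))" for s
  have "(r \<longlongrightarrow> norm (G (q t) - f t + Kt (q t) (K (q t) (f t)))) (at t)"
    unfolding r_def
    by (intro tendsto_intros bounded_linear.tendsto[OF G_linear] bounded_bilinear.tendsto[OF K_bilinear]
        bounded_bilinear.tendsto[OF Kt_bilinear] q_tendsto)
  moreover have "G (q t) - f t + Kt (q t) (K (q t) (f t)) = 0" using sol[of t, unfolded solves_def, symmetric] by (simp add: algebra_simps)
  ultimately have r: "(r \<longlongrightarrow> 0) (at t)" by simp
  have b: "norm (f s - f t) \<le> r s / (1 - c)" for s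
  proof -
    let ?d = "f s - f t"
    have "(norm (K (q s) ?d))\<^sup>2 \<le> (m * norm (q s) * norm ?d)\<^sup>2" by (intro power_mono K_bound) simp
    also have "\<dots> \<le> c * (norm ?d)\<^sup>2" using small(1)[of s] by (simp add: power_mult_distrib mult_right_mono)
    finally have k: "(norm (K (q s) ?d))\<^sup>2 \<le> c * (norm ?d)\<^sup>2" .
    have "(norm ?d)\<^sup>2 - (norm (K (q s) ?d))\<^sup>2 = (?d \<bullet> f s - K (q s) ?d \<bullet> K (q s) (f s)) - (?d \<bullet> f t - K (q s) ?d \<bullet> K (q s) (f t))"
      by (simp add: power2_norm_eq_inner bounded_bilinear.diff_right[OF K_bilinear] inner_simps)
    also have "\<dots> = ?d \<bullet> (G (q s) - f t + Kt (q s) (K (q s) (f t)))"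
      using solves_weak[OF sol, of ?d s] adjoint[of "K (q s) (f t)" "q s" ?d]
      by (simp add: inner_commute inner_add_right inner_diff_right)
    also have "\<dots> \<le> norm ?d * r s" unfolding r_def by (rule norm_cauchy_schwarz)
    finally have "(1 - c) * (norm ?d)\<^sup>2 \<le> norm ?d * r s" using k by (simp add: algebra_simps)
    then have "norm ?d * ((1 - c) * norm ?d) \<le> norm ?d * r s" by (simp add: power2_eq_square mult_ac)
    then have "(1 - c) * norm ?d \<le> r s"
      by (cases "norm ?d = 0") (auto simp: r_def mult_le_cancel_left)
    then show ?thesis using small(2) by (simp add: field_simps)
  qed
  have "((\<lambda>s. norm (f s - f t)) \<longlongrightarrow> 0) (at t)"
  proof (rule tendsto_sandwich[OF _ _ tendsto_const])
    show "((\<lambda>s. r s / (1 - c)) \<longlongrightarrow> 0) (at t)" using tendsto_divide[OF r tendsto_const, of "1 - c"] small(2) by simp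
  qed (use b in auto)
  then show ?thesis by (rule LIM_zero_cancel[OF tendsto_norm_zero_cancel])
qed

text \<open>The form is symmetric. Testing the equation at time \<open>s\<close> with \<open>f t\<close>, and the one at time \<open>t\<close> with
  \<open>f s\<close>, gives an expression \<open>D s\<close> for the difference quotient of the energy in which \<open>q\<close> enters through its own
  difference quotient and \<open>f\<close> only through its values. Continuity of \<open>f\<close> thus suffices.\<close>

lemma energy_derivative:
  "((\<lambda>s. G (q s) \<bullet> f s) has_real_derivative 2 * (G q' \<bullet> f t + K q' (f t) \<bullet> K (q t) (f t))) (at t)"
proof -
  define p where "p s = (q s - q t) /\<^sub>R (s - t)" for s
  have "((\<lambda>s. (q s - q t - (s - t) *\<^sub>R q') /\<^sub>R norm (s - t)) \<longlongrightarrow> 0) (at t)"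
    using deriv unfolding has_vector_derivative_def has_derivative_at_within by simp
  then have "((\<lambda>s. norm ((q s - q t - (s - t) *\<^sub>R q') /\<^sub>R norm (s - t))) \<longlongrightarrow> 0) (at t)"
    by (rule tendsto_norm_zero)
  moreover have "\<forall>\<^sub>F s in at t. norm ((q s - q t - (s - t) *\<^sub>R q') /\<^sub>R norm (s - t)) = norm (p s - q')"
    unfolding eventually_at_filter
  proof (rule always_eventually, intro allI impI)
    fix s assume "s \<noteq> t"
    then have "p s - q' = (q s - q t - (s - t) *\<^sub>R q') /\<^sub>R (s - t)" by (simp add: p_def scaleR_diff_right)
    then show "norm ((q s - q t - (s - t) *\<^sub>R q') /\<^sub>R norm (s - t)) = norm (p s - q')" by simp
  qed
  ultimately have "((\<lambda>s. norm (p s - q')) \<longlongrightarrow> 0) (at t)" by (rule Lim_transform_eventually)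
  then have p: "(p \<longlongrightarrow> q') (at t)" by (rule LIM_zero_cancel[OF tendsto_norm_zero_cancel])
  define D where "D s = G (p s) \<bullet> f s + G (p s) \<bullet> f t + K (p s) (f s) \<bullet> K (q s) (f t) + K (q t) (f s) \<bullet> K (p s) (f t)" for s
  have "(D \<longlongrightarrow> G q' \<bullet> f t + G q' \<bullet> f t + K q' (f t) \<bullet> K (q t) (f t) + K (q t) (f t) \<bullet> K q' (f t)) (at t)"
    unfolding D_def
    by (intro tendsto_intros bounded_linear.tendsto[OF G_linear] bounded_bilinear.tendsto[OF K_bilinear]
        q_tendsto p solution_tendsto)
  then have D: "(D \<longlongrightarrow> 2 * (G q' \<bullet> f t + K q' (f t) \<bullet> K (q t) (f t))) (at t)"
    by (simp add: inner_commute add.commute)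
  have "\<forall>\<^sub>F s in at t. D s = (G (q s) \<bullet> f s - G (q t) \<bullet> f t) / (s - t)"
    unfolding eventually_at_filter
  proof (rule always_eventually, intro allI impI)
    fix s assume s: "s \<noteq> t"
    have qp: "q s - q t = (s - t) *\<^sub>R p s" using s by (simp add: p_def)
    have Gp: "G (q s) - G (q t) = (s - t) *\<^sub>R G (p s)"
      using linear_diff[OF bounded_linear.linear[OF G_linear]] linear_scale[OF bounded_linear.linear[OF G_linear]] qp by metis
    have Kp: "K (q s) v - K (q t) v = (s - t) *\<^sub>R K (p s) v" for v
      using bounded_bilinear.diff_left[OF K_bilinear] bounded_bilinear.scaleR_left[OF K_bilinear] qp by metis
    have 1: "f t \<bullet> G (q s) = f t \<bullet> f s - K (q s) (f t) \<bullet> K (q s) (f s)"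
      and 2: "f s \<bullet> G (q t) = f s \<bullet> f t - K (q t) (f s) \<bullet> K (q t) (f t)"
      by (rule solves_weak[OF sol])+
    have "(s - t) * D s = (G (q s) - G (q t)) \<bullet> f s + (G (q s) - G (q t)) \<bullet> f t
        + (K (q s) (f s) - K (q t) (f s)) \<bullet> K (q s) (f t) + K (q t) (f s) \<bullet> (K (q s) (f t) - K (q t) (f t))"
      unfolding Gp Kp D_def by (simp add: algebra_simps)
    also have "\<dots> = G (q s) \<bullet> f s - G (q t) \<bullet> f t"
      using 1 2 by (simp add: inner_diff_left inner_diff_right inner_commute)
    finally show "D s = (G (q s) \<bullet> f s - G (q t) \<bullet> f t) / (s - t)" using s by (simp add: field_simps)
  qed
  then show ?thesis
    unfolding has_field_derivative_iff using D by (rule Lim_transform_eventually[rotated])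
qed

end

end

section \<open>The Lax operator\<close>

text \<open>The mass at frequencies from \<open>N\<close> on.\<close>

definition tail :: "real \<Rightarrow> (real \<Rightarrow> complex) \<Rightarrow> real" where
  "tail N g = (LBINT \<xi>. indicator {N..} \<xi> * (cmod (g \<xi>))\<^sup>2)"

lemma tail_integrable: "sqint g \<Longrightarrow> integrable lborel (\<lambda>\<xi>. indicator {N..} \<xi> * (cmod (g \<xi>))\<^sup>2)"
  using integrable_real_mult_indicator[OF _ sqint_integrable, of "{N..}" g] by (simp add: mult.commute)

context
  fixes \<kappa> :: real assumes \<kappa>: "\<kappa> > 0"
begin

text \<open>The symbol of \<open>(D + \<kappa>)\<^sup>-\<^sup>1\<^sup>/\<^sup>2\<close> on the Hardy space, extended by zero so that the operators below act on all
  of \<open>ltwo\<close>.\<close>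

definition rho :: "real \<Rightarrow> real" where
  "rho \<xi> = (if \<xi> \<ge> 0 then 1 / sqrt (\<xi> + \<kappa>) else 0)"

definition Gfun :: "(real \<Rightarrow> complex) \<Rightarrow> real \<Rightarrow> complex" where
  "Gfun f \<xi> = of_real (rho \<xi>) * f \<xi>"

text \<open>The map \<open>f \<mapsto> C\<^sub>+(cnj q (D + \<kappa>)\<^sup>-\<^sup>1\<^sup>/\<^sup>2 f)\<close> and its adjoint \<open>h \<mapsto> (D + \<kappa>)\<^sup>-\<^sup>1\<^sup>/\<^sup>2 (q h)\<close>.\<close>

definition Kfun :: "(real \<Rightarrow> complex) \<Rightarrow> (real \<Rightarrow> complex) \<Rightarrow> real \<Rightarrow> complex" where
  "Kfun q f = pos_part (conv (star (pos_part q)) (Gfun f))"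

definition Ktfun :: "(real \<Rightarrow> complex) \<Rightarrow> (real \<Rightarrow> complex) \<Rightarrow> real \<Rightarrow> complex" where
  "Ktfun q h = Gfun (conv (pos_part q) (pos_part h))"

lemma rho_measurable [measurable]: "rho \<in> borel_measurable borel"
  unfolding rho_def[abs_def] by measurable

lemma rho_nonneg: "0 \<le> rho \<xi>" using \<kappa> by (simp add: rho_def)

lemma rho_bound: "rho \<xi> \<le> 1 / sqrt \<kappa>"
  using \<kappa> by (auto simp: rho_def intro!: divide_left_mono)

lemma rho_square: "(rho \<xi>)\<^sup>2 = (if \<xi> \<ge> 0 then 1 / (\<xi> + \<kappa>) else 0)"
  using \<kappa> by (simp add: rho_def power_divide)

lemma Gfun_measurable [measurable]:
  assumes [measurable]: "f \<in> borel_measurable borel" shows "Gfun f \<in> borel_measurable borel"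
  unfolding Gfun_def[abs_def] by measurable

lemma sqint_Gfun: "sqint f \<Longrightarrow> sqint (Gfun f)"
  unfolding Gfun_def using rho_bound rho_nonneg
  by (intro sqint_bounded_mult[where C="1 / sqrt \<kappa>"]) auto

lemma norm_Gfun_le:
  assumes f: "sqint f" shows "nrm (Gfun f) \<le> 1 / sqrt \<kappa> * nrm f"
proof -
  have "(nrm (Gfun f))\<^sup>2 = (LBINT x. (cmod (Gfun f x))\<^sup>2)"
    by (rule norm_abs_ltwo[OF sqint_Gfun[OF f]])
  also have "\<dots> \<le> (LBINT x. (1 / sqrt \<kappa>)\<^sup>2 * (cmod (f x))\<^sup>2)"
  proof (intro integral_mono integrable_mult_right sqint_integrable sqint_Gfun f)
    fix x
    have "(rho x)\<^sup>2 \<le> (1 / sqrt \<kappa>)\<^sup>2" by (intro power_mono rho_bound rho_nonneg)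
    then show "(cmod (Gfun f x))\<^sup>2 \<le> (1 / sqrt \<kappa>)\<^sup>2 * (cmod (f x))\<^sup>2"
      by (simp add: Gfun_def norm_mult power_mult_distrib mult_right_mono)
  qed
  also have "\<dots> = (1 / sqrt \<kappa> * nrm f)\<^sup>2"
    by (simp add: norm_abs_ltwo[OF f] power_mult_distrib power_divide)
  finally show ?thesis using \<kappa> by (simp add: power2_le_iff_abs_le)
qed

lemma Kfun_measurable [measurable]:
  assumes [measurable]: "q \<in> borel_measurable borel" "f \<in> borel_measurable borel"
  shows "Kfun q f \<in> borel_measurable borel"
  unfolding Kfun_def by measurable

lemma Ktfun_measurable [measurable]:
  assumes [measurable]: "q \<in> borel_measurable borel" "f \<in> borel_measurable borel"
  shows "Ktfun q f \<in> borel_measurable borel"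
  unfolding Ktfun_def by measurable

text \<open>The function \<open>cnj q\<close> has no positive frequencies, so the value at \<open>\<xi>\<close> involves only the frequencies
  \<open>\<eta> \<ge> \<xi>\<close> of \<open>f\<close>. Keeping this restriction in Cauchy--Schwarz is what produces the factor
  \<open>\<eta>\<close> in the next bound.\<close>

lemma Kfun_pointwise:
  assumes q: "sqint q" and f: "sqint f" and "\<xi> \<ge> 0"
  shows "ennreal ((cmod (Kfun q f \<xi>))\<^sup>2) \<le> ennreal ((nrm q)\<^sup>2 / (2 * pi)) *
    (\<integral>\<^sup>+\<eta>. indicator {\<xi>..} \<eta> * ennreal ((cmod (Gfun f \<eta>))\<^sup>2) \<partial>lborel)"
proof -
  let ?q = "star (pos_part q)" and ?f = "\<lambda>\<eta>. indicator {\<xi>..} \<eta> * Gfun f \<eta>"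
  have sq: "sqint ?q" by (intro sqint_star sqint_pos_part q)
  have sf: "sqint ?f" by (intro sqint_restrict sqint_Gfun f) simp
  have "(LBINT \<eta>. ?q (\<xi> - \<eta>) * Gfun f \<eta>) = (LBINT \<eta>. ?q (\<xi> - \<eta>) * ?f \<eta>)"
    by (intro Bochner_Integration.integral_cong) (auto simp: star_def pos_part_def indicator_def)
  also have "cmod \<dots> \<le> (LBINT \<eta>. cmod (?q (\<xi> - \<eta>)) * cmod (?f \<eta>))"
    using integral_norm_bound[of lborel "\<lambda>\<eta>. ?q (\<xi> - \<eta>) * ?f \<eta>"] by (simp only: norm_mult)
  also have "\<dots> \<le> nrm ?q * nrm ?f" by (rule conv_abs_bound(2)[OF sq sf])
  also have "\<dots> \<le> nrm q * nrm ?f"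
    using norm_pos_part_le[OF q] sqint_star(2)[OF sqint_pos_part[OF q]] by (intro mult_right_mono) auto
  finally have "(cmod (LBINT \<eta>. ?q (\<xi> - \<eta>) * Gfun f \<eta>))\<^sup>2 \<le> (nrm q * nrm ?f)\<^sup>2"
    by (intro power_mono) auto
  then have "(cmod (Kfun q f \<xi>))\<^sup>2 \<le> (nrm q)\<^sup>2 / (2 * pi) * (nrm ?f)\<^sup>2"
    using assms(3)
    by (simp add: Kfun_def pos_part_def conv_def norm_mult norm_divide power_divide power_mult_distrib divide_right_mono)
  then have "ennreal ((cmod (Kfun q f \<xi>))\<^sup>2) \<le> ennreal ((nrm q)\<^sup>2 / (2 * pi)) * ennreal ((nrm ?f)\<^sup>2)"
    by (subst ennreal_mult[symmetric]) (auto intro!: ennreal_leI)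
  also have "ennreal ((nrm ?f)\<^sup>2) = (\<integral>\<^sup>+\<eta>. indicator {\<xi>..} \<eta> * ennreal ((cmod (Gfun f \<eta>))\<^sup>2) \<partial>lborel)"
    unfolding nn_integral_sqint[OF sf, symmetric] by (intro nn_integral_cong) (auto simp: indicator_def)
  finally show ?thesis .
qed

text \<open>Integrating the pointwise bound over \<open>\<xi> \<ge> 0\<close> with Tonelli's theorem, the frequency \<open>\<eta>\<close> is counted for
  all \<open>\<xi>\<close> in \<open>[0, \<eta>]\<close>, hence the factor \<open>\<eta>\<close>: with \<open>Gfun f\<close> in the place of \<open>f\<close>, this is the bound by
  \<open>\<parallel>q\<parallel>\<^sup>2 / (2\<pi>)\<close> times \<open>\<langle>f, D f\<rangle>\<close>.\<close>

lemma Kfun_bound: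
  assumes q: "sqint q" and f: "sqint f"
  shows "sqint (Kfun q f)"
    "(nrm (Kfun q f))\<^sup>2 \<le> (nrm q)\<^sup>2 / (2 * pi) * (LBINT \<eta>. \<eta> * (cmod (Gfun f \<eta>))\<^sup>2)"
    "integrable lborel (\<lambda>\<eta>. \<eta> * (cmod (Gfun f \<eta>))\<^sup>2)"
proof -
  have [measurable]: "q \<in> borel_measurable borel" "f \<in> borel_measurable borel"
    using q f by (auto intro: sqint_measurable)
  let ?C = "(nrm q)\<^sup>2 / (2 * pi)"
  have ge: "indicator {\<xi>..} \<eta> = (if \<xi> \<le> \<eta> then 1 else 0 :: ennreal)" for \<xi> \<eta> :: real by simp
  show i: "integrable lborel (\<lambda>\<eta>. \<eta> * (cmod (Gfun f \<eta>))\<^sup>2)"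
  proof (rule Bochner_Integration.integrable_bound[OF sqint_integrable[OF f]])
    show "AE \<eta> in lborel. norm (\<eta> * (cmod (Gfun f \<eta>))\<^sup>2) \<le> norm ((cmod (f \<eta>))\<^sup>2)"
    proof (rule AE_I2)
      fix \<eta>
      have "\<bar>\<eta>\<bar> * (rho \<eta>)\<^sup>2 \<le> 1" using \<kappa> by (auto simp: rho_square field_simps)
      then have "\<bar>\<eta>\<bar> * (rho \<eta>)\<^sup>2 * (cmod (f \<eta>))\<^sup>2 \<le> 1 * (cmod (f \<eta>))\<^sup>2" by (rule mult_right_mono) simp
      then show "norm (\<eta> * (cmod (Gfun f \<eta>))\<^sup>2) \<le> norm ((cmod (f \<eta>))\<^sup>2)"
        by (simp add: Gfun_def norm_mult power_mult_distrib abs_mult mult_ac)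
    qed
  qed measurable
  have n: "0 \<le> \<eta> * (cmod (Gfun f \<eta>))\<^sup>2" for \<eta> by (cases "\<eta> \<ge> 0") (auto simp: Gfun_def rho_def)
  have "(\<integral>\<^sup>+\<xi>. ennreal ((cmod (Kfun q f \<xi>))\<^sup>2) \<partial>lborel) \<le>
      (\<integral>\<^sup>+\<xi>. ennreal ?C * (\<integral>\<^sup>+\<eta>. indicator {0..} \<xi> * indicator {\<xi>..} \<eta> * ennreal ((cmod (Gfun f \<eta>))\<^sup>2) \<partial>lborel) \<partial>lborel)"
  proof (rule nn_integral_mono)
    fix \<xi>
    show "ennreal ((cmod (Kfun q f \<xi>))\<^sup>2) \<le> ennreal ?C * (\<integral>\<^sup>+\<eta>. indicator {0..} \<xi> * indicator {\<xi>..} \<eta> * ennreal ((cmod (Gfun f \<eta>))\<^sup>2) \<partial>lborel)"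
      using Kfun_pointwise[OF q f, of \<xi>] by (cases "\<xi> \<ge> 0") (auto simp: Kfun_def pos_part_def)
  qed
  also have "\<dots> = ennreal ?C * (\<integral>\<^sup>+\<xi>. (\<integral>\<^sup>+\<eta>. indicator {0..} \<xi> * indicator {\<xi>..} \<eta> * ennreal ((cmod (Gfun f \<eta>))\<^sup>2) \<partial>lborel) \<partial>lborel)"
  proof (rule nn_integral_cmult)
    show "(\<lambda>\<xi>. \<integral>\<^sup>+\<eta>. indicator {0..} \<xi> * indicator {\<xi>..} \<eta> * ennreal ((cmod (Gfun f \<eta>))\<^sup>2) \<partial>lborel) \<in> borel_measurable lborel"
      unfolding ge by measurable
  qed
  also have "(\<integral>\<^sup>+\<xi>. (\<integral>\<^sup>+\<eta>. indicator {0..} \<xi> * indicator {\<xi>..} \<eta> * ennreal ((cmod (Gfun f \<eta>))\<^sup>2) \<partial>lborel) \<partial>lborel)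
    = (\<integral>\<^sup>+\<eta>. (\<integral>\<^sup>+\<xi>. indicator {0..} \<xi> * indicator {\<xi>..} \<eta> * ennreal ((cmod (Gfun f \<eta>))\<^sup>2) \<partial>lborel) \<partial>lborel)"
  proof (rule lborel_pair.Fubini')
    show "(\<lambda>(\<eta>, \<xi>). indicator {0..} \<xi> * indicator {\<xi>..} \<eta> * ennreal ((cmod (Gfun f \<eta>))\<^sup>2)) \<in> borel_measurable (lborel \<Otimes>\<^sub>M lborel)"
      unfolding ge by measurable
  qed
  also have "\<dots> = (\<integral>\<^sup>+\<eta>. ennreal (\<eta> * (cmod (Gfun f \<eta>))\<^sup>2) \<partial>lborel)"
  proof (rule nn_integral_cong)
    fix \<eta> :: real
    have "(\<integral>\<^sup>+\<xi>. indicator {0..} \<xi> * indicator {\<xi>..} \<eta> * ennreal ((cmod (Gfun f \<eta>))\<^sup>2) \<partial>lborel)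
      = (\<integral>\<^sup>+\<xi>. ennreal ((cmod (Gfun f \<eta>))\<^sup>2) * indicator {0..\<eta>} \<xi> \<partial>lborel)"
      by (intro nn_integral_cong) (auto simp: indicator_def)
    also have "\<dots> = ennreal ((cmod (Gfun f \<eta>))\<^sup>2) * emeasure lborel {0..\<eta>}"
      by (rule nn_integral_cmult_indicator) simp
    also have "\<dots> = ennreal (\<eta> * (cmod (Gfun f \<eta>))\<^sup>2)"
      by (cases "\<eta> \<ge> 0") (auto simp: emeasure_lborel_Icc_eq ennreal_mult'' mult.commute Gfun_def rho_def)
    finally show "(\<integral>\<^sup>+\<xi>. indicator {0..} \<xi> * indicator {\<xi>..} \<eta> * ennreal ((cmod (Gfun f \<eta>))\<^sup>2) \<partial>lborel)
      = ennreal (\<eta> * (cmod (Gfun f \<eta>))\<^sup>2)" .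
  qed
  also have "\<dots> = ennreal (LBINT \<eta>. \<eta> * (cmod (Gfun f \<eta>))\<^sup>2)"
    by (rule nn_integral_eq_integral[OF i]) (simp add: n)
  also have "ennreal ?C * \<dots> = ennreal (?C * (LBINT \<eta>. \<eta> * (cmod (Gfun f \<eta>))\<^sup>2))"
    by (rule ennreal_mult[symmetric]) (auto intro: Bochner_Integration.integral_nonneg n)
  finally have b: "(\<integral>\<^sup>+\<xi>. ennreal ((cmod (Kfun q f \<xi>))\<^sup>2) \<partial>lborel) \<le> ennreal (?C * (LBINT \<eta>. \<eta> * (cmod (Gfun f \<eta>))\<^sup>2))" .
  have "(\<integral>\<^sup>+\<xi>. ennreal ((cmod (Kfun q f \<xi>))\<^sup>2) \<partial>lborel) < \<infinity>" by (rule le_less_trans[OF b]) simp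
  moreover have "Kfun q f \<in> borel_measurable borel" by measurable
  ultimately show s: "sqint (Kfun q f)" unfolding sqint_iff_nn_integral by blast
  have p: "0 \<le> ?C * (LBINT \<eta>. \<eta> * (cmod (Gfun f \<eta>))\<^sup>2)"
    by (intro mult_nonneg_nonneg Bochner_Integration.integral_nonneg n) simp
  show "(nrm (Kfun q f))\<^sup>2 \<le> ?C * (LBINT \<eta>. \<eta> * (cmod (Gfun f \<eta>))\<^sup>2)"
    using b[unfolded nn_integral_sqint[OF s]] ennreal_le_iff[OF p] by blast
qed

text \<open>The convolution at \<open>\<xi>\<close> is an integral over \<open>[0, \<xi>]\<close>. Cauchy--Schwarz against the constant \<open>1\<close> there costs
  a factor \<open>\<xi>\<close>, which the square of \<open>rho\<close> absorbs. The integral on the right may be infinite for some \<open>\<xi>\<close>.\<close>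

lemma Ktfun_pointwise:
  assumes q: "sqint q" and h: "sqint h"
  shows "ennreal ((cmod (Ktfun q h \<xi>))\<^sup>2) \<le> (\<integral>\<^sup>+\<eta>. ennreal ((cmod (q (\<xi> - \<eta>)))\<^sup>2 * (cmod (h \<eta>))\<^sup>2) \<partial>lborel)"
proof (cases "\<xi> \<ge> 0")
  case False
  then show ?thesis by (simp add: Ktfun_def Gfun_def rho_def)
next
  case True
  have [measurable]: "q \<in> borel_measurable borel" "h \<in> borel_measurable borel"
    using q h by (auto intro: sqint_measurable)
  define a where "a \<eta> = pos_part q (\<xi> - \<eta>) * pos_part h \<eta>" for \<eta>
  have [measurable]: "a \<in> borel_measurable borel" unfolding a_def by measurable
  have le: "(\<integral>\<^sup>+\<eta>. ennreal ((cmod (a \<eta>))\<^sup>2) \<partial>lborel) \<le> (\<integral>\<^sup>+\<eta>. ennreal ((cmod (q (\<xi> - \<eta>)))\<^sup>2 * (cmod (h \<eta>))\<^sup>2) \<partial>lborel)"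
    by (intro nn_integral_mono ennreal_leI) (auto simp: a_def pos_part_def norm_mult power_mult_distrib)
  show ?thesis
  proof (cases "(\<integral>\<^sup>+\<eta>. ennreal ((cmod (a \<eta>))\<^sup>2) \<partial>lborel) < \<infinity>")
    case False
    then have "(\<integral>\<^sup>+\<eta>. ennreal ((cmod (q (\<xi> - \<eta>)))\<^sup>2 * (cmod (h \<eta>))\<^sup>2) \<partial>lborel) = \<infinity>"
      using le by (simp add: less_top[symmetric] top_unique)
    then show ?thesis by simp
  next
    case fin: True
    have sa: "sqint a" using fin unfolding sqint_iff_nn_integral by simp
    have si: "sqint (\<lambda>\<eta>. indicator {0..\<xi>} \<eta>)"
      by (rule sqint_bounded_support[of _ 1 0 \<xi>]) (auto simp: indicator_def)
    have ni: "(nrm (\<lambda>\<eta>. indicator {0..\<xi>} \<eta>))\<^sup>2 = \<xi>"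
    proof -
      have "(cmod (indicator {0..\<xi>} \<eta>))\<^sup>2 = indicator {0..\<xi>} \<eta>" for \<eta> by (simp add: indicator_def)
      then show ?thesis unfolding norm_abs_ltwo[OF si] using True by simp
    qed
    have "cmod (LBINT \<eta>. a \<eta>) \<le> (LBINT \<eta>. cmod (a \<eta>))" by (rule integral_norm_bound)
    also have "\<dots> = (LBINT \<eta>. cmod (indicator {0..\<xi>} \<eta>) * cmod (a \<eta>))"
      by (intro Bochner_Integration.integral_cong) (auto simp: a_def pos_part_def indicator_def)
    also have "\<dots> \<le> nrm (\<lambda>\<eta>. indicator {0..\<xi>} \<eta>) * nrm a"
      by (rule Cauchy_Schwarz_sqint[OF si sa])
    finally have "(cmod (LBINT \<eta>. a \<eta>))\<^sup>2 \<le> (nrm (\<lambda>\<eta>. indicator {0..\<xi>} \<eta>) * nrm a)\<^sup>2"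
      by (intro power_mono) auto
    then have I: "(cmod (LBINT \<eta>. a \<eta>))\<^sup>2 \<le> \<xi> * (nrm a)\<^sup>2" by (simp add: power_mult_distrib ni)
    have "(cmod (Ktfun q h \<xi>))\<^sup>2 = (rho \<xi>)\<^sup>2 * (1 / (2 * pi)) * (cmod (LBINT \<eta>. a \<eta>))\<^sup>2"
      by (simp add: Ktfun_def Gfun_def conv_def a_def[abs_def] norm_mult norm_divide power_mult_distrib power_divide)
    also have "\<dots> \<le> (rho \<xi>)\<^sup>2 * 1 * (\<xi> * (nrm a)\<^sup>2)"
      using I pi_ge_two by (intro mult_mono) auto
    also have "\<dots> = ((rho \<xi>)\<^sup>2 * \<xi>) * (nrm a)\<^sup>2" by simp
    also have "\<dots> \<le> 1 * (nrm a)\<^sup>2"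
      using True \<kappa> by (intro mult_right_mono) (auto simp: rho_square)
    finally have "ennreal ((cmod (Ktfun q h \<xi>))\<^sup>2) \<le> ennreal ((nrm a)\<^sup>2)" by (intro ennreal_leI) simp
    also have "\<dots> = (\<integral>\<^sup>+\<eta>. ennreal ((cmod (a \<eta>))\<^sup>2) \<partial>lborel)" using nn_integral_sqint[OF sa] by simp
    finally show ?thesis using le by simp
  qed
qed

lemma sqint_Ktfun:
  assumes q: "sqint q" and h: "sqint h"
  shows "sqint (Ktfun q h)"
proof -
  have [measurable]: "q \<in> borel_measurable borel" "h \<in> borel_measurable borel"
    using q h by (auto intro: sqint_measurable)
  have "(\<integral>\<^sup>+\<xi>. ennreal ((cmod (Ktfun q h \<xi>))\<^sup>2) \<partial>lborel)
    \<le> (\<integral>\<^sup>+\<xi>. \<integral>\<^sup>+\<eta>. ennreal ((cmod (q (\<xi> - \<eta>)))\<^sup>2 * (cmod (h \<eta>))\<^sup>2) \<partial>lborel \<partial>lborel)"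
    by (intro nn_integral_mono Ktfun_pointwise q h)
  also have "\<dots> = (\<integral>\<^sup>+\<eta>. \<integral>\<^sup>+\<xi>. ennreal ((cmod (q (\<xi> - \<eta>)))\<^sup>2 * (cmod (h \<eta>))\<^sup>2) \<partial>lborel \<partial>lborel)"
    by (rule lborel_pair.Fubini') measurable
  also have "\<dots> = (\<integral>\<^sup>+\<eta>. ennreal ((nrm q)\<^sup>2) * ennreal ((cmod (h \<eta>))\<^sup>2) \<partial>lborel)"
  proof (rule nn_integral_cong)
    fix \<eta> :: real
    have "(\<integral>\<^sup>+\<xi>. ennreal ((cmod (q (\<xi> - \<eta>)))\<^sup>2 * (cmod (h \<eta>))\<^sup>2) \<partial>lborel)
      = (\<integral>\<^sup>+\<xi>. ennreal ((cmod (q (\<xi> + - \<eta>)))\<^sup>2) * ennreal ((cmod (h \<eta>))\<^sup>2) \<partial>lborel)"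
      by (intro nn_integral_cong) (auto simp: ennreal_mult)
    also have "\<dots> = (\<integral>\<^sup>+\<xi>. ennreal ((cmod (q (\<xi> + - \<eta>)))\<^sup>2) \<partial>lborel) * ennreal ((cmod (h \<eta>))\<^sup>2)"
      by (rule nn_integral_multc) measurable
    also have "(\<integral>\<^sup>+\<xi>. ennreal ((cmod (q (\<xi> + - \<eta>)))\<^sup>2) \<partial>lborel) = ennreal ((nrm q)\<^sup>2)"
      unfolding nn_integral_sqint[OF sqint_translate(1)[OF q]] sqint_translate(2)[OF q] ..
    finally show "(\<integral>\<^sup>+\<xi>. ennreal ((cmod (q (\<xi> - \<eta>)))\<^sup>2 * (cmod (h \<eta>))\<^sup>2) \<partial>lborel)
      = ennreal ((nrm q)\<^sup>2) * ennreal ((cmod (h \<eta>))\<^sup>2)" .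
  qed
  also have "\<dots> = ennreal ((nrm q)\<^sup>2) * (\<integral>\<^sup>+\<eta>. ennreal ((cmod (h \<eta>))\<^sup>2) \<partial>lborel)"
    by (rule nn_integral_cmult) measurable
  also have "\<dots> < \<infinity>" unfolding nn_integral_sqint[OF h] by (simp add: ennreal_mult_less_top)
  finally have "(\<integral>\<^sup>+\<xi>. ennreal ((cmod (Ktfun q h \<xi>))\<^sup>2) \<partial>lborel) < \<infinity>" .
  moreover have "Ktfun q h \<in> borel_measurable borel" by measurable
  ultimately show ?thesis unfolding sqint_iff_nn_integral by blast
qed

text \<open>Fubini's theorem. Absolute convergence of the double integral is the bound on \<open>Kfun\<close> for the
  moduli of \<open>q\<close> and \<open>f\<close>.\<close>

lemma Kfun_adjoint:
  assumes q: "sqint q" and h: "sqint h" and f: "sqint f"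
  shows "ip h (Kfun q f) = ip (Ktfun q h) f"
proof -
  have [measurable]: "q \<in> borel_measurable borel" "h \<in> borel_measurable borel" "f \<in> borel_measurable borel"
    using q h f by (auto intro: sqint_measurable)
  let ?c = "complex_of_real (1 / sqrt (2 * pi))"
  define \<Phi> where "\<Phi> \<xi> \<eta> = cnj (pos_part h \<xi>) * (star (pos_part q) (\<xi> - \<eta>) * Gfun f \<eta>)" for \<xi> \<eta>
  have sq: "sqint (star (pos_part q))" by (intro sqint_star sqint_pos_part q)
  define q' f' where "q' x = complex_of_real (cmod (q x))" and "f' x = complex_of_real (cmod (f x))" for x
  have s': "sqint q'" "sqint f'" using q f unfolding q'_def f'_def sqint_def by auto
  have A: "complex_of_real (1 / sqrt (2 * pi) * (LBINT \<eta>. cmod (\<Phi> \<xi> \<eta>))) = of_real (cmod (h \<xi>)) * Kfun q' f' \<xi>" for \<xi>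
  proof -
    have "(LBINT \<eta>. cmod (\<Phi> \<xi> \<eta>)) = cmod (pos_part h \<xi>) * (LBINT \<eta>. cmod (star (pos_part q) (\<xi> - \<eta>) * Gfun f \<eta>))"
      unfolding \<Phi>_def norm_mult by simp
    moreover have "complex_of_real (LBINT \<eta>. cmod (star (pos_part q) (\<xi> - \<eta>) * Gfun f \<eta>))
        = (LBINT \<eta>. star (pos_part q') (\<xi> - \<eta>) * Gfun f' \<eta>)"
      unfolding integral_complex_of_real[symmetric]
      by (intro Bochner_Integration.integral_cong)
         (auto simp: star_def pos_part_def q'_def f'_def Gfun_def norm_mult rho_nonneg)
    ultimately show ?thesis
      by (auto simp: Kfun_def pos_part_def conv_def)
  qed
  have "integrable lborel (\<lambda>\<xi>. of_real (cmod (h \<xi>)) * Kfun q' f' \<xi>)"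
    using h by (intro integrable_mult_sqint Kfun_bound s') (auto simp: sqint_def)
  then have "integrable lborel (\<lambda>\<xi>. 1 / sqrt (2 * pi) * (LBINT \<eta>. cmod (\<Phi> \<xi> \<eta>)))"
    unfolding A[symmetric] complex_of_real_integrable_eq .
  then have "integrable lborel (\<lambda>\<xi>. sqrt (2 * pi) * (1 / sqrt (2 * pi) * (LBINT \<eta>. cmod (\<Phi> \<xi> \<eta>))))"
    by (rule integrable_mult_right)
  then have o: "integrable lborel (\<lambda>\<xi>. LBINT \<eta>. cmod (\<Phi> \<xi> \<eta>))" by simp
  have i: "integrable (lborel \<Otimes>\<^sub>M lborel) (\<lambda>(\<xi>, \<eta>). \<Phi> \<xi> \<eta>)"
  proof (rule lborel_pair.Fubini_integrable)
    show "(\<lambda>(\<xi>, \<eta>). \<Phi> \<xi> \<eta>) \<in> borel_measurable (lborel \<Otimes>\<^sub>M lborel)" unfolding \<Phi>_def by measurable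
    show "integrable lborel (\<lambda>\<xi>. LBINT \<eta>. norm (case (\<xi>, \<eta>) of (\<xi>, \<eta>) \<Rightarrow> \<Phi> \<xi> \<eta>))" using o by simp
    show "AE \<xi> in lborel. integrable lborel (\<lambda>\<eta>. case (\<xi>, \<eta>) of (\<xi>, \<eta>) \<Rightarrow> \<Phi> \<xi> \<eta>)"
      unfolding \<Phi>_def prod.case
      by (intro AE_I2 integrable_mult_right conv_abs_bound(1) sq sqint_Gfun f)
  qed
  have "ip h (Kfun q f) = Re (LBINT \<xi>. cnj (h \<xi>) * Kfun q f \<xi>)"
    unfolding ip_def by (intro integral_Re integrable_mult_sqint sqint_cnj h Kfun_bound q f)
  also have "(LBINT \<xi>. cnj (h \<xi>) * Kfun q f \<xi>) = ?c * (LBINT \<xi>. LBINT \<eta>. \<Phi> \<xi> \<eta>)"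
  proof -
    have "cnj (h \<xi>) * Kfun q f \<xi> = ?c * (LBINT \<eta>. \<Phi> \<xi> \<eta>)" for \<xi>
      unfolding \<Phi>_def integral_mult_right_zero by (simp add: Kfun_def pos_part_def conv_def)
    then show ?thesis by simp
  qed
  also have "(LBINT \<xi>. LBINT \<eta>. \<Phi> \<xi> \<eta>) = (LBINT \<eta>. LBINT \<xi>. \<Phi> \<xi> \<eta>)"
    by (rule lborel_pair.Fubini_integral[OF i, symmetric])
  also have "?c * \<dots> = (LBINT \<eta>. cnj (Ktfun q h \<eta>) * f \<eta>)"
  proof -
    have "cnj (Ktfun q h \<eta>) * f \<eta> = ?c * (LBINT \<xi>. \<Phi> \<xi> \<eta>)" for \<eta>
    proof -
      have "(LBINT \<xi>. \<Phi> \<xi> \<eta>) = (LBINT \<xi>. cnj (pos_part q (\<eta> - \<xi>) * pos_part h \<xi>) * Gfun f \<eta>)"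
        by (intro Bochner_Integration.integral_cong) (auto simp: \<Phi>_def star_def)
      also have "\<dots> = (LBINT \<xi>. cnj (pos_part q (\<eta> - \<xi>) * pos_part h \<xi>)) * Gfun f \<eta>"
        by (rule integral_mult_left_zero)
      also have "(LBINT \<xi>. cnj (pos_part q (\<eta> - \<xi>) * pos_part h \<xi>)) = cnj (LBINT \<xi>. pos_part q (\<eta> - \<xi>) * pos_part h \<xi>)"
        by (rule Bochner_Integration.integral_cnj)
      finally show ?thesis by (simp add: Ktfun_def Gfun_def conv_def)
    qed
    then show ?thesis by simp
  qed
  also have "Re \<dots> = ip (Ktfun q h) f"
    unfolding ip_def by (intro integral_Re[symmetric] integrable_mult_sqint sqint_cnj f sqint_Ktfun q h)
  finally show ?thesis .
qed

definition Gop :: "ltwo \<Rightarrow> ltwo" where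
  "Gop q = abs_ltwo (Gfun (rep_ltwo q))"

definition Kop :: "ltwo \<Rightarrow> ltwo \<Rightarrow> ltwo" where
  "Kop q f = abs_ltwo (Kfun (rep_ltwo q) (rep_ltwo f))"

definition Ktop :: "ltwo \<Rightarrow> ltwo \<Rightarrow> ltwo" where
  "Ktop q h = abs_ltwo (Ktfun (rep_ltwo q) (rep_ltwo h))"

lemma pos_part_AE: "AE x in lborel. f x = g x \<Longrightarrow> AE x in lborel. pos_part f x = pos_part g x"
  by (auto simp: pos_part_def elim: eventually_mono)

lemma star_AE:
  assumes "sqint f" "sqint g" "AE x in lborel. f x = g x"
  shows "AE x in lborel. star f x = star g x"
proof -
  have "nrm (star (\<lambda>x. f x - g x)) = nrm (\<lambda>x. f x - g x)"
    by (intro sqint_star sqint_diff assms)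
  moreover have "star (\<lambda>x. f x - g x) = (\<lambda>x. star f x - star g x)" by (auto simp: star_def)
  ultimately have "norm (abs_ltwo (star f) - abs_ltwo (star g)) = norm (abs_ltwo f - abs_ltwo g)"
    using assms by (simp add: abs_ltwo_diff sqint_star)
  then show ?thesis using assms by (simp add: abs_ltwo_eq_iff[symmetric] sqint_star)
qed

lemma Gfun_AE: "AE x in lborel. f x = g x \<Longrightarrow> AE x in lborel. Gfun f x = Gfun g x"
  by (auto simp: Gfun_def elim: eventually_mono)

lemma Gop_abs: "sqint f \<Longrightarrow> Gop (abs_ltwo f) = abs_ltwo (Gfun f)"
  unfolding Gop_def by (simp add: abs_ltwo_eq_iff sqint_Gfun Gfun_AE rep_abs_ltwo)

lemma Kfun_cong_AE:
  assumes "sqint q" "sqint q'" "AE x in lborel. q x = q' x" "sqint f" "sqint f'" "AE x in lborel. f x = f' x"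
  shows "Kfun q f = Kfun q' f'"
  unfolding Kfun_def using assms
  by (intro arg_cong[where f=pos_part] conv_cong_AE star_AE pos_part_AE Gfun_AE sqint_star sqint_pos_part sqint_Gfun)

lemma Kop_abs: "sqint q \<Longrightarrow> sqint f \<Longrightarrow> Kop (abs_ltwo q) (abs_ltwo f) = abs_ltwo (Kfun q f)"
  unfolding Kop_def
  by (rule arg_cong[where f=abs_ltwo], rule Kfun_cong_AE) (simp_all add: rep_abs_ltwo)

lemma Ktop_abs: "sqint q \<Longrightarrow> sqint h \<Longrightarrow> Ktop (abs_ltwo q) (abs_ltwo h) = abs_ltwo (Ktfun q h)"
  unfolding Ktop_def Ktfun_def
  by (rule arg_cong[where f="\<lambda>x. abs_ltwo (Gfun x)"], rule conv_cong_AE)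
     (simp_all add: sqint_pos_part pos_part_AE rep_abs_ltwo)

text \<open>The sharp form is kept besides the operator norm bound: its gain of \<open>\<xi> / (\<xi> + \<kappa>)\<close> over \<open>1\<close> at low
  frequencies is essential in \<open>energy_upper\<close>.\<close>

lemma Kop_bound:
  "(norm (Kop q f))\<^sup>2 \<le> (norm q)\<^sup>2 / (2 * pi) * (LBINT \<eta>. \<eta> * (cmod (Gfun (rep_ltwo f) \<eta>))\<^sup>2)"
  using Kfun_bound(2)[of "rep_ltwo q" "rep_ltwo f"] by (simp add: Kop_def)

lemma Gop_linear: "bounded_linear Gop"
proof (rule bounded_linear_intro)
  have G: "Gop (abs_ltwo f + abs_ltwo g) = Gop (abs_ltwo f) + Gop (abs_ltwo g)"
    "Gop (r *\<^sub>R abs_ltwo f) = r *\<^sub>R Gop (abs_ltwo f)"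
    "norm (Gop (abs_ltwo f)) \<le> nrm f * (1 / sqrt \<kappa>)" if "sqint f" "sqint g" for f g r
  proof -
    have "Gfun (\<lambda>x. f x + g x) = (\<lambda>x. Gfun f x + Gfun g x)" "Gfun (\<lambda>x. of_real r * f x) = (\<lambda>x. of_real r * Gfun f x)"
      by (auto simp: Gfun_def distrib_left)
    then show "Gop (abs_ltwo f + abs_ltwo g) = Gop (abs_ltwo f) + Gop (abs_ltwo g)"
      "Gop (r *\<^sub>R abs_ltwo f) = r *\<^sub>R Gop (abs_ltwo f)"
      using that by (simp_all add: abs_ltwo_add[symmetric] abs_ltwo_scaleR[symmetric] Gop_abs sqint_add sqint_cmult sqint_Gfun)
    show "norm (Gop (abs_ltwo f)) \<le> nrm f * (1 / sqrt \<kappa>)"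
      using norm_Gfun_le[OF that(1)] by (simp add: Gop_abs that)
  qed
  show "Gop (x + y) = Gop x + Gop y" for x y using G(1)[of "rep_ltwo x" "rep_ltwo y"] by simp
  show "Gop (r *\<^sub>R x) = r *\<^sub>R Gop x" for r x using G(2)[of "rep_ltwo x" "rep_ltwo x"] by simp
  show "norm (Gop x) \<le> norm x * (1 / sqrt \<kappa>)" for x using G(3)[of "rep_ltwo x" "rep_ltwo x"] by simp
qed

lemma Kop_norm: "norm (Kop q f) \<le> 1 / sqrt (2 * pi) * norm q * norm f"
proof -
  have "(LBINT \<eta>. \<eta> * (cmod (Gfun (rep_ltwo f) \<eta>))\<^sup>2) \<le> (LBINT \<eta>. (cmod (rep_ltwo f \<eta>))\<^sup>2)"
  proof (intro integral_mono Kfun_bound(3)[OF sqint_rep sqint_rep] sqint_integrable sqint_rep)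
    fix \<eta>
    have "\<eta> * (rho \<eta>)\<^sup>2 \<le> 1" using \<kappa> by (auto simp: rho_square field_simps)
    then have "\<eta> * (rho \<eta>)\<^sup>2 * (cmod (rep_ltwo f \<eta>))\<^sup>2 \<le> 1 * (cmod (rep_ltwo f \<eta>))\<^sup>2" by (rule mult_right_mono) simp
    then show "\<eta> * (cmod (Gfun (rep_ltwo f) \<eta>))\<^sup>2 \<le> (cmod (rep_ltwo f \<eta>))\<^sup>2"
      by (simp add: Gfun_def norm_mult power_mult_distrib mult_ac)
  qed
  then have "(norm q)\<^sup>2 / (2 * pi) * (LBINT \<eta>. \<eta> * (cmod (Gfun (rep_ltwo f) \<eta>))\<^sup>2) \<le> (norm q)\<^sup>2 / (2 * pi) * (norm f)\<^sup>2"
    unfolding norm_ltwo_rep[of f] by (intro mult_left_mono) auto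
  then have "(norm (Kop q f))\<^sup>2 \<le> (1 / sqrt (2 * pi) * norm q * norm f)\<^sup>2"
    using Kop_bound[of q f] by (simp add: power_mult_distrib power_divide)
  then show ?thesis by (rule power2_le_imp_le) simp
qed

lemma Kop_bilinear: "bounded_bilinear Kop"
proof
  have K: "Kop (abs_ltwo q + abs_ltwo q') (abs_ltwo f) = Kop (abs_ltwo q) (abs_ltwo f) + Kop (abs_ltwo q') (abs_ltwo f)"
    "Kop (abs_ltwo q) (abs_ltwo f + abs_ltwo f') = Kop (abs_ltwo q) (abs_ltwo f) + Kop (abs_ltwo q) (abs_ltwo f')"
    "Kop (r *\<^sub>R abs_ltwo q) (abs_ltwo f) = r *\<^sub>R Kop (abs_ltwo q) (abs_ltwo f)"
    "Kop (abs_ltwo q) (r *\<^sub>R abs_ltwo f) = r *\<^sub>R Kop (abs_ltwo q) (abs_ltwo f)"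
    if s: "sqint q" "sqint q'" "sqint f" "sqint f'" for q q' f f' r
  proof -
    have 0: "star (pos_part (\<lambda>x. q x + q' x)) = (\<lambda>x. star (pos_part q) x + star (pos_part q') x)"
      "star (pos_part (\<lambda>x. of_real r * q x)) = (\<lambda>x. of_real r * star (pos_part q) x)"
      "Gfun (\<lambda>x. f x + f' x) = (\<lambda>x. Gfun f x + Gfun f' x)"
      "Gfun (\<lambda>x. of_real r * f x) = (\<lambda>x. of_real r * Gfun f x)"
      "pos_part (\<lambda>x. a x + b x) = (\<lambda>x. pos_part a x + pos_part b x)"
      "pos_part (\<lambda>x. of_real r * a x) = (\<lambda>x. of_real r * pos_part a x)" for a b
      by (auto simp: star_def pos_part_def Gfun_def distrib_left)
    have t: "sqint (star (pos_part q))" "sqint (star (pos_part q'))" "sqint (Gfun f)" "sqint (Gfun f')"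
      using s by (auto intro: sqint_star sqint_pos_part sqint_Gfun)
    have "Kfun (\<lambda>x. q x + q' x) f = (\<lambda>x. Kfun q f x + Kfun q' f x)"
      "Kfun q (\<lambda>x. f x + f' x) = (\<lambda>x. Kfun q f x + Kfun q f' x)"
      "Kfun (\<lambda>x. of_real r * q x) f = (\<lambda>x. of_real r * Kfun q f x)"
      "Kfun q (\<lambda>x. of_real r * f x) = (\<lambda>x. of_real r * Kfun q f x)"
      unfolding Kfun_def 0(1-4) conv_linear[OF t] unfolding 0(5,6) by (rule refl)+
    then show "Kop (abs_ltwo q + abs_ltwo q') (abs_ltwo f) = Kop (abs_ltwo q) (abs_ltwo f) + Kop (abs_ltwo q') (abs_ltwo f)"
      "Kop (abs_ltwo q) (abs_ltwo f + abs_ltwo f') = Kop (abs_ltwo q) (abs_ltwo f) + Kop (abs_ltwo q) (abs_ltwo f')"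
      "Kop (r *\<^sub>R abs_ltwo q) (abs_ltwo f) = r *\<^sub>R Kop (abs_ltwo q) (abs_ltwo f)"
      "Kop (abs_ltwo q) (r *\<^sub>R abs_ltwo f) = r *\<^sub>R Kop (abs_ltwo q) (abs_ltwo f)"
      using s by (simp_all add: abs_ltwo_add[symmetric] abs_ltwo_scaleR[symmetric] Kop_abs sqint_add sqint_cmult Kfun_bound)
  qed
  show "Kop (a + a') b = Kop a b + Kop a' b" for a a' b
    using K(1)[of "rep_ltwo a" "rep_ltwo a'" "rep_ltwo b" "rep_ltwo b"] by simp
  show "Kop a (b + b') = Kop a b + Kop a b'" for a b b'
    using K(2)[of "rep_ltwo a" "rep_ltwo a" "rep_ltwo b" "rep_ltwo b'"] by simp
  show "Kop (r *\<^sub>R a) b = r *\<^sub>R Kop a b" for r a b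
    using K(3)[of "rep_ltwo a" "rep_ltwo a" "rep_ltwo b" "rep_ltwo b" r] by simp
  show "Kop a (r *\<^sub>R b) = r *\<^sub>R Kop a b" for r a b
    using K(4)[of "rep_ltwo a" "rep_ltwo a" "rep_ltwo b" "rep_ltwo b" r] by simp
  show "\<exists>M. \<forall>a b. norm (Kop a b) \<le> norm a * norm b * M"
    using Kop_norm by (intro exI[of _ "1 / sqrt (2 * pi)"]) (simp add: mult_ac)
qed

lemma Kop_adjoint: "h \<bullet> Kop q f = Ktop q h \<bullet> f"
proof -
  have "h \<bullet> Kop q f = ip (rep_ltwo h) (Kfun (rep_ltwo q) (rep_ltwo f))"
    using ip_eq_inner[OF sqint_rep Kfun_bound(1)[OF sqint_rep sqint_rep]] by (simp add: Kop_def)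
  also have "\<dots> = ip (Ktfun (rep_ltwo q) (rep_ltwo h)) (rep_ltwo f)" by (intro Kfun_adjoint sqint_rep)
  also have "\<dots> = Ktop q h \<bullet> f"
    using ip_eq_inner[OF sqint_Ktfun[OF sqint_rep sqint_rep] sqint_rep] by (simp add: Ktop_def)
  finally show ?thesis .
qed

interpretation L: factored_form Kop Ktop Gop "1 / sqrt (2 * pi)"
  by (intro factored_form.intro Kop_bilinear Gop_linear Kop_adjoint Kop_norm) simp

text \<open>The resolvent splits as \<open>\<phi> = \<phi>1 + \<phi>2\<close>, where \<open>\<phi>1\<close> is rapid and \<open>\<phi>2\<close> is the transform of
  \<open>(D + \<kappa>)\<^sup>-\<^sup>1 (q h)\<close>. Suppose that the transform of \<open>h = C\<^sub>+(cnj q f)\<close> decays like the power \<open>- n\<close>. Multiplication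
  by \<open>q\<close> preserves this, \<open>(D + \<kappa>)\<^sup>-\<^sup>1\<close> gains one power for \<open>\<phi>2\<close>, and multiplication by \<open>cnj q\<close> preserves that, so
  \<open>h\<close> decays like the power \<open>- n - 1\<close>.\<close>

lemma resolvent_regular:
  assumes g: "rapid g" and g0: "\<And>\<xi>. \<xi> < 0 \<Longrightarrow> g \<xi> = 0"
    and sol: "L.solves (abs_ltwo g) F"
  obtains \<phi> h where "rapid \<phi>" "\<forall>\<xi><0. \<phi> \<xi> = 0" "rapid h"
    "h = pos_part (conv (star g) \<phi>)"
    "\<forall>\<xi>. of_real (\<xi> + \<kappa>) * \<phi> \<xi> = g \<xi> + conv g h \<xi>"
    "AE \<xi> in lborel. Gfun (rep_ltwo F) \<xi> = \<phi> \<xi>"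
    "Kop (abs_ltwo g) F = abs_ltwo h"
proof -
  have sg: "sqint g" using g by (rule rapid_sqint)
  have pg: "pos_part g = g" using g0 by (auto simp: pos_part_def fun_eq_iff)
  have [measurable]: "g \<in> borel_measurable borel" using g by (rule rapid_measurable)
  define h where "h = Kfun g (rep_ltwo F)"
  have sh: "sqint h" unfolding h_def by (intro Kfun_bound \<kappa> sg sqint_rep)
  have [measurable]: "h \<in> borel_measurable borel" using sh by (rule sqint_measurable)
  have ph: "pos_part h = h" unfolding h_def Kfun_def by (simp add: pos_part_def fun_eq_iff)
  define \<phi>1 where "\<phi>1 \<xi> = of_real ((rho \<xi>)\<^sup>2) * g \<xi>" for \<xi>
  define \<phi>2 where "\<phi>2 \<xi> = of_real ((rho \<xi>)\<^sup>2) * conv g h \<xi>" for \<xi>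
  define \<phi> where "\<phi> \<xi> = \<phi>1 \<xi> + \<phi>2 \<xi>" for \<xi>
  have r2: "(rho \<xi>)\<^sup>2 \<le> 1 / \<kappa>" for \<xi>
    using \<kappa> by (auto simp: rho_square intro!: divide_left_mono)
  have \<phi>1: "rapid \<phi>1"
    unfolding \<phi>1_def by (rule rapid_bounded_mult[OF g, of _ "1/\<kappa>" 0]) (use r2 in \<open>auto simp: norm_power\<close>)
  have m2 [measurable]: "\<phi>2 \<in> borel_measurable borel" unfolding \<phi>2_def by measurable
  have "\<phi>2 = Gfun (Ktfun g h)"
    by (auto simp: \<phi>2_def Ktfun_def Gfun_def pg ph power2_eq_square)
  then have s\<phi>2: "sqint \<phi>2" using sqint_Gfun[OF sqint_Ktfun[OF sg sh]] by simp
  have KF: "Kop (abs_ltwo g) F = abs_ltwo h"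
    using Kop_abs[OF sg sqint_rep, of F] by (simp add: h_def)
  have "F = Gop (abs_ltwo g) + Ktop (abs_ltwo g) (abs_ltwo h)"
    using sol KF unfolding L.solves_def by simp
  also have "\<dots> = abs_ltwo (\<lambda>\<xi>. Gfun g \<xi> + Ktfun g h \<xi>)"
    by (simp only: Gop_abs[OF sg] Ktop_abs[OF sg sh] abs_ltwo_add[OF sqint_Gfun[OF sg] sqint_Ktfun[OF sg sh]])
  finally have "AE \<xi> in lborel. rep_ltwo F \<xi> = Gfun g \<xi> + Ktfun g h \<xi>"
    using rep_abs_ltwo[OF sqint_add[OF sqint_Gfun[OF sg] sqint_Ktfun[OF sg sh]]] by simp
  then have GF: "AE \<xi> in lborel. Gfun (rep_ltwo F) \<xi> = \<phi> \<xi>"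
    by eventually_elim (simp add: \<phi>_def \<phi>1_def \<phi>2_def Ktfun_def Gfun_def pg ph power2_eq_square algebra_simps)
  have s\<phi>: "sqint \<phi>" unfolding \<phi>_def by (intro sqint_add rapid_sqint \<phi>1 s\<phi>2)
  have h_eq: "h = pos_part (conv (star g) \<phi>)"
  proof -
    have "conv (star g) (Gfun (rep_ltwo F)) = conv (star g) \<phi>"
      by (rule conv_cong_AE) (use GF in \<open>auto intro: sqint_star sg sqint_Gfun s\<phi>\<close>)
    then show ?thesis unfolding h_def Kfun_def pg by simp
  qed
  also have "conv (star g) \<phi> = (\<lambda>\<xi>. conv (star g) \<phi>1 \<xi> + conv (star g) \<phi>2 \<xi>)"
    unfolding \<phi>_def by (rule conv_linear(2)) (auto intro: sqint_star sg rapid_sqint \<phi>1 s\<phi>2)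
  finally have h_split: "h = pos_part (\<lambda>\<xi>. conv (star g) \<phi>1 \<xi> + conv (star g) \<phi>2 \<xi>)" .
  have decay: "\<exists>C. \<forall>\<xi>. wt n \<xi> * cmod (h \<xi>) \<le> C" for n
  proof (induction n)
    case 0
    have "cmod (h \<xi>) \<le> nrm (star g) * nrm \<phi>" for \<xi>
      unfolding h_eq using conv_abs_bound(3)[OF sqint_star(1)[OF sg] s\<phi>, of \<xi>]
      by (auto simp: pos_part_def)
    then show ?case by auto
  next
    case (Suc n)
    then obtain C where "\<And>\<xi>. wt n \<xi> * cmod (h \<xi>) \<le> C" by blast
    then obtain C1 where C1: "\<And>\<xi>. wt n \<xi> * cmod (conv g h \<xi>) \<le> C1"
      using conv_weight_bounded[OF g, of h n C] by auto
    have "wt (Suc n) \<xi> * cmod (\<phi>2 \<xi>) \<le> (1 + 1 / \<kappa>) * C1" for \<xi>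
    proof -
      have 1: "(1 + \<bar>\<xi>\<bar>) * (rho \<xi>)\<^sup>2 \<le> 1 + 1 / \<kappa>"
      proof (cases "\<xi> \<ge> 0")
        case True
        have "(1 + 1 / \<kappa>) * (\<xi> + \<kappa>) = \<xi> + \<kappa> + \<xi> / \<kappa> + 1" using \<kappa> by (simp add: field_simps)
        then have "1 + \<xi> \<le> (1 + 1 / \<kappa>) * (\<xi> + \<kappa>)" using True \<kappa> by simp
        then have "(1 + \<xi>) / (\<xi> + \<kappa>) \<le> 1 + 1 / \<kappa>" using True \<kappa> by (simp add: pos_divide_le_eq)
        then show ?thesis using True by (simp add: rho_square)
      next
        case False
        then show ?thesis using \<kappa> by (simp add: rho_square)
      qed
      have "wt (Suc n) \<xi> * cmod (\<phi>2 \<xi>) = ((1 + \<bar>\<xi>\<bar>) * (rho \<xi>)\<^sup>2) * (wt n \<xi> * cmod (conv g h \<xi>))"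
        by (simp add: \<phi>2_def norm_mult norm_power)
      also have "\<dots> \<le> (1 + 1 / \<kappa>) * C1"
        using \<kappa> by (intro mult_mono 1 C1) auto
      finally show ?thesis .
    qed
    then obtain C2 where C2: "\<And>\<xi>. wt (Suc n) \<xi> * cmod (conv (star g) \<phi>2 \<xi>) \<le> C2"
      using conv_weight_bounded[OF rapid_star[OF g] m2] by blast
    obtain C3 where C3: "\<And>\<xi>. wt (Suc n) \<xi> * cmod (conv (star g) \<phi>1 \<xi>) \<le> C3"
      using rapid_conv_bounded[OF rapid_star[OF g] \<phi>1] by blast
    have "wt (Suc n) \<xi> * cmod (h \<xi>) \<le> C3 + C2" for \<xi>
    proof -
      have "cmod (h \<xi>) \<le> cmod (conv (star g) \<phi>1 \<xi>) + cmod (conv (star g) \<phi>2 \<xi>)"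
        unfolding h_split by (auto simp: pos_part_def norm_triangle_ineq)
      then have "wt (Suc n) \<xi> * cmod (h \<xi>) \<le> wt (Suc n) \<xi> * (cmod (conv (star g) \<phi>1 \<xi>) + cmod (conv (star g) \<phi>2 \<xi>))"
        by (rule mult_left_mono) simp
      also have "\<dots> \<le> C3 + C2" using C2[of \<xi>] C3[of \<xi>] by (simp only: distrib_left)
      finally show ?thesis .
    qed
    then show ?case by blast
  qed
  have rh: "rapid h" by (rule rapidI_bounded) (use decay in auto)
  have \<phi>_eq: "\<phi> \<xi> = of_real ((rho \<xi>)\<^sup>2) * (g \<xi> + conv g h \<xi>)" for \<xi>
    by (simp add: \<phi>_def \<phi>1_def \<phi>2_def algebra_simps)
  have r\<phi>: "rapid \<phi>"
    unfolding \<phi>_eq[abs_def] by (rule rapid_bounded_mult[of _ _ "1/\<kappa>" 0]) (use r2 in \<open>auto simp: norm_power intro: rapid_add rapid_conv g rh\<close>)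
  have hpos: "h \<xi> = 0" if "\<xi> < 0" for \<xi> unfolding h_eq using that by (simp add: pos_part_def)
  have mul: "of_real (\<xi> + \<kappa>) * \<phi> \<xi> = g \<xi> + conv g h \<xi>" for \<xi>
  proof (cases "\<xi> \<ge> 0")
    case True
    then have "(\<xi> + \<kappa>) * (rho \<xi>)\<^sup>2 = 1" using \<kappa> by (simp add: rho_square)
    then show ?thesis unfolding \<phi>_eq mult.assoc[symmetric] of_real_mult[symmetric] by simp
  next
    case False
    then show ?thesis using conv_pos[of g h \<xi>, OF g0 hpos] g0[of \<xi>] by (simp add: \<phi>_eq)
  qed
  have \<phi>0: "\<phi> \<xi> = 0" if "\<xi> < 0" for \<xi> using that by (simp add: \<phi>_eq rho_def)
  show ?thesis by (rule that[OF r\<phi> _ rh h_eq _ GF KF]) (use mul \<phi>0 in auto)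
qed

text \<open>The derivative given by \<open>energy_derivative\<close>, carried back from the Fourier side by Plancherel's theorem,
  is the left-hand side of \<open>energy_identity\<close> up to the factor \<open>2\<close>.\<close>

theorem energy_conserved:
  assumes u: "is_solution u" and small: "(nrm (u 0))\<^sup>2 < 2 * pi"
    and sol: "\<And>s. L.solves (four (abs_ltwo (u s))) (F s)"
  shows "Gop (four (abs_ltwo (u t))) \<bullet> F t = Gop (four (abs_ltwo (u s))) \<bullet> F s"
proof (rule real_derivative_zero_const[where f = "\<lambda>s. Gop (four (abs_ltwo (u s))) \<bullet> F s"])
  fix t
  obtain w where w: "u t \<in> Hpos" "w \<in> Hpos"
    "\<forall>v\<in>Hpos. ip v (\<lambda>x. u t x * cnj (u t x)) = ip v w"
    "\<forall>x. u t x * cnj (u t x) = w x + cnj (w x)"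
    "((\<lambda>s. abs_ltwo (u s)) has_vector_derivative
        abs_ltwo (\<lambda>x. \<i> * dx (dx (u t)) x + 2 * (u t x * dx w x))) (at t)"
    by (rule solution_at[OF u, of t])
  define V where "V = (\<lambda>x. \<i> * dx (dx (u t)) x + 2 * (u t x * dx w x))"
  have V: "V \<in> Hpos" unfolding V_def by (intro Hpos_add Hpos_cmult Hpos_mult Hpos_dx w)
  obtain v where v: "rapid v" "\<forall>\<xi><0. v \<xi> = 0" "V = invft v"
    using V unfolding Hpos_def by auto
  obtain g where g: "rapid g" "\<forall>\<xi><0. g \<xi> = 0" "u t = invft g"
    using w(1) unfolding Hpos_def by auto
  have fg: "four (abs_ltwo (u t)) = abs_ltwo g" "four (abs_ltwo V) = abs_ltwo v"
    unfolding g(3) v(3) by (intro four_invft rapid_integrable rapid_sqint g v)+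
  have bl: "bounded_linear four"
    using linear_four by (intro bounded_linear_intro[of _ 1]) (auto simp: linear_add linear_scale)
  have der: "((\<lambda>s. four (abs_ltwo (u s))) has_vector_derivative abs_ltwo v) (at t)"
    using bounded_linear.has_vector_derivative[OF bl w(5)] unfolding V_def[symmetric] fg(2) .
  define c where "c = (nrm (u 0))\<^sup>2 / (2 * pi)"
  have c: "c < 1" using small by (simp add: c_def)
  have sm: "(1 / sqrt (2 * pi) * norm (four (abs_ltwo (u s))))\<^sup>2 \<le> c" for s
    using mass_conserved[OF u, of s 0] by (simp add: c_def power_mult_distrib power_divide)
  have "((\<lambda>s. Gop (four (abs_ltwo (u s))) \<bullet> F s) has_real_derivative
      2 * (Gop (abs_ltwo v) \<bullet> F t + Kop (abs_ltwo v) (F t) \<bullet> Kop (abs_ltwo g) (F t))) (at t)"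
    using L.energy_derivative[OF der sm c sol] fg(1) by simp
  moreover have "Gop (abs_ltwo v) \<bullet> F t + Kop (abs_ltwo v) (F t) \<bullet> Kop (abs_ltwo g) (F t) = 0"
  proof -
    obtain \<phi> h where p: "rapid \<phi>" "\<forall>\<xi><0. \<phi> \<xi> = 0" "rapid h"
      "h = pos_part (conv (star g) \<phi>)"
      "\<forall>\<xi>. of_real (\<xi> + \<kappa>) * \<phi> \<xi> = g \<xi> + conv g h \<xi>"
      "AE \<xi> in lborel. Gfun (rep_ltwo (F t)) \<xi> = \<phi> \<xi>"
      "Kop (abs_ltwo g) (F t) = abs_ltwo h"
      by (rule resolvent_regular[OF g(1) g(2)[rule_format] sol[of t, unfolded fg(1)]])
    have h0: "h \<xi> = 0" if "\<xi> < 0" for \<xi> using that unfolding p(4) by (simp add: pos_part_def)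
    have fH: "invft \<phi> \<in> Hpos" and hH: "invft h \<in> Hpos"
      using HposI[OF p(1) p(2)[rule_format] refl] HposI[OF p(3) h0 refl] by auto
    have cs: "invft (conv (star k) \<phi>) = (\<lambda>x. cnj (invft k x) * invft \<phi> x)" if "rapid k" for k
      using invft_conv[OF rapid_star[OF that] p(1)] by (simp add: invft_star)
    interpret I: lax_identity "u t" "invft \<phi>" "invft h" w \<kappa>
    proof
      show "u t x + u t x * invft h x = - \<i> * dx (invft \<phi>) x + of_real \<kappa> * invft \<phi> x" for x
      proof -
        have "invft (\<lambda>\<xi>. g \<xi> + conv g h \<xi>) = (\<lambda>x. u t x + u t x * invft h x)"
          using invft_add[OF g(1) rapid_conv[OF g(1) p(3)]] invft_conv[OF g(1) p(3)] g(3) by simp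
        moreover have "invft (\<lambda>\<xi>. - \<i> * (\<i> * of_real \<xi> * \<phi> \<xi>) + of_real \<kappa> * \<phi> \<xi>)
          = (\<lambda>x. - \<i> * dx (invft \<phi>) x + of_real \<kappa> * invft \<phi> x)"
          unfolding invft_add[OF rapid_cmult[OF rapid_times[OF p(1)]] rapid_cmult[OF p(1)]]
            invft_cmult[OF rapid_times[OF p(1)]] invft_cmult[OF p(1)] dx_invft[OF p(1)] ..
        moreover have "(\<lambda>\<xi>. - \<i> * (\<i> * of_real \<xi> * \<phi> \<xi>) + of_real \<kappa> * \<phi> \<xi>) = (\<lambda>\<xi>. g \<xi> + conv g h \<xi>)"
          using p(5) by (auto simp: fun_eq_iff algebra_simps)
        ultimately show ?thesis by (metis (no_types))
      qed
      show "ip v (\<lambda>x. cnj (u t x) * invft \<phi> x) = ip v (invft h)" if "v \<in> Hpos" for v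
        unfolding p(4) ip_pos_part[OF that rapid_conv[OF rapid_star[OF g(1)] p(1)]] cs[OF g(1)] g(3) ..
    qed (use w fH hH in auto)
    have [measurable]: "\<phi> \<in> borel_measurable borel" using p(1) by (rule rapid_measurable)
    have "Gop (abs_ltwo v) \<bullet> F t = ip (Gfun v) (rep_ltwo (F t))"
      using ip_eq_inner[OF sqint_Gfun[OF rapid_sqint[OF v(1)]] sqint_rep, of "F t"]
      by (simp add: Gop_abs[OF rapid_sqint[OF v(1)]])
    also have "\<dots> = ip v (Gfun (rep_ltwo (F t)))"
      by (rule ip_cong) (simp add: Gfun_def algebra_simps)
    also have "\<dots> = ip v \<phi>"
      using p(6) rapid_sqint[OF v(1)] rapid_sqint[OF p(1)] sqint_Gfun[OF sqint_rep, of "F t"]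
      by (simp add: ip_eq_inner abs_ltwo_eq_iff[symmetric])
    also have "\<dots> = ip V (invft \<phi>)" unfolding v(3) by (rule ip_invft[symmetric, OF v(1) p(1)])
    finally have 1: "Gop (abs_ltwo v) \<bullet> F t = ip V (invft \<phi>)" .
    have pv: "pos_part v = v" using v(2) by (auto simp: pos_part_def fun_eq_iff)
    have "conv (star v) (Gfun (rep_ltwo (F t))) = conv (star v) \<phi>"
      by (rule conv_cong_AE)
         (use p(6) in \<open>auto intro: sqint_star rapid_sqint v(1) p(1) sqint_Gfun[OF sqint_rep]\<close>)
    then have Kv: "Kop (abs_ltwo v) (F t) = abs_ltwo (pos_part (conv (star v) \<phi>))"
      using Kop_abs[OF rapid_sqint[OF v(1)] sqint_rep, of "F t"] by (simp add: Kfun_def pv)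
    have rc: "rapid (conv (star v) \<phi>)" by (intro rapid_conv rapid_star v(1) p(1))
    have "Kop (abs_ltwo v) (F t) \<bullet> Kop (abs_ltwo g) (F t) = ip (pos_part (conv (star v) \<phi>)) h"
      unfolding Kv p(7) using ip_eq_inner[OF rapid_sqint[OF rapid_pos_part[OF rc]] rapid_sqint[OF p(3)]] by simp
    also have "\<dots> = ip (invft (pos_part (conv (star v) \<phi>))) (invft h)"
      by (rule ip_invft[symmetric, OF rapid_pos_part[OF rc] p(3)])
    also have "\<dots> = ip (invft (conv (star v) \<phi>)) (invft h)"
      using ip_pos_part[OF hH rc] by (simp add: ip_commute)
    also have "\<dots> = ip (\<lambda>x. cnj (V x) * invft \<phi> x) (invft h)" unfolding cs[OF v(1)] v(3) ..
    finally show ?thesis using I.energy_identity 1 by (simp add: V_def)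
  qed
  ultimately show "((\<lambda>s. Gop (four (abs_ltwo (u s))) \<bullet> F s) has_real_derivative 0) (at t)" by simp
qed

text \<open>Since \<open>L\<^sub>q \<le> D\<close>, the energy is at least \<open>\<langle>q, (D + \<kappa>)\<^sup>-\<^sup>1 q\<rangle>\<close>. What remains of the mass is weighted by
  \<open>\<xi> / (\<xi> + \<kappa>)\<close>, which is at most \<open>N / \<kappa>\<close> below \<open>N\<close> and at most \<open>1\<close> above.\<close>

lemma energy_lower:
  assumes g: "sqint g" "\<And>\<xi>. \<xi> < 0 \<Longrightarrow> g \<xi> = 0" and small: "(nrm g)\<^sup>2 < 2 * pi"
    and sol: "L.solves (abs_ltwo g) F" and N: "N \<ge> 0"
  shows "(nrm g)\<^sup>2 - \<kappa> * (Gop (abs_ltwo g) \<bullet> F) \<le> N / \<kappa> * (nrm g)\<^sup>2 + tail N g"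
proof -
  have "nrm g \<le> sqrt (2 * pi)" using small by (intro real_le_rsqrt) simp
  then have "1 / sqrt (2 * pi) * nrm g \<le> 1" by simp
  then have "(norm (Gop (abs_ltwo g)))\<^sup>2 \<le> Gop (abs_ltwo g) \<bullet> F" using sol by (rule L.solves_lower)
  then have "(nrm g)\<^sup>2 - \<kappa> * (Gop (abs_ltwo g) \<bullet> F) \<le> (nrm g)\<^sup>2 - \<kappa> * (nrm (Gfun g))\<^sup>2"
    using \<kappa> by (simp add: Gop_abs[OF g(1)])
  also have "\<dots> = (LBINT \<xi>. (cmod (g \<xi>))\<^sup>2 - \<kappa> * (cmod (Gfun g \<xi>))\<^sup>2)"
    by (simp add: norm_abs_ltwo g sqint_Gfun sqint_integrable)
  also have "\<dots> \<le> (LBINT \<xi>. N / \<kappa> * (cmod (g \<xi>))\<^sup>2 + indicator {N..} \<xi> * (cmod (g \<xi>))\<^sup>2)"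
  proof (rule integral_mono)
    show "integrable lborel (\<lambda>\<xi>. (cmod (g \<xi>))\<^sup>2 - \<kappa> * (cmod (Gfun g \<xi>))\<^sup>2)"
      by (intro Bochner_Integration.integrable_diff integrable_mult_right sqint_integrable g sqint_Gfun)
    show "integrable lborel (\<lambda>\<xi>. N / \<kappa> * (cmod (g \<xi>))\<^sup>2 + indicator {N..} \<xi> * (cmod (g \<xi>))\<^sup>2)"
      by (intro Bochner_Integration.integrable_add integrable_mult_right sqint_integrable g tail_integrable)
    fix \<xi>
    show "(cmod (g \<xi>))\<^sup>2 - \<kappa> * (cmod (Gfun g \<xi>))\<^sup>2 \<le> N / \<kappa> * (cmod (g \<xi>))\<^sup>2 + indicator {N..} \<xi> * (cmod (g \<xi>))\<^sup>2"
    proof (cases "\<xi> < 0")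
      case True
      then show ?thesis using g(2) by (simp add: Gfun_def)
    next
      case False
      have "1 - \<kappa> * (rho \<xi>)\<^sup>2 = \<xi> / (\<xi> + \<kappa>)" using False \<kappa> by (simp add: rho_square field_simps)
      also have "\<dots> \<le> N / \<kappa> + indicator {N..} \<xi>"
      proof (cases "\<xi> \<ge> N")
        case True
        then have "\<xi> / (\<xi> + \<kappa>) \<le> 1" using \<kappa> False by simp
        then show ?thesis using True \<kappa> N by (simp add: add_increasing)
      next
        case F: False
        then have "\<xi> / (\<xi> + \<kappa>) \<le> N / \<kappa>" using \<kappa> False N by (intro frac_le) auto
        then show ?thesis using F by simp
      qed
      finally have "(1 - \<kappa> * (rho \<xi>)\<^sup>2) * (cmod (g \<xi>))\<^sup>2 \<le> (N / \<kappa> + indicator {N..} \<xi>) * (cmod (g \<xi>))\<^sup>2"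
        by (rule mult_right_mono) simp
      then show ?thesis
        by (simp add: Gfun_def norm_mult power_mult_distrib left_diff_distrib distrib_right)
    qed
  qed
  also have "\<dots> = N / \<kappa> * (nrm g)\<^sup>2 + tail N g"
    by (simp add: norm_abs_ltwo g sqint_integrable tail_def tail_integrable)
  finally show ?thesis .
qed

text \<open>Since \<open>L\<^sub>q \<ge> (1 - c) D\<close>, the energy is at most \<open>\<langle>q, ((1 - c) D + \<kappa>)\<^sup>-\<^sup>1 q\<rangle>\<close>: it equals twice its linear part
  minus its quadratic part, and on the Fourier side this concave expression can be maximised at each
  frequency. What remains of the mass is weighted by \<open>1 - \<kappa> / d\<close> with \<open>d = (1 - c) \<xi> + \<kappa>\<close>, which is at
  least \<open>1/2\<close> where \<open>(1 - c) \<xi> \<ge> \<kappa>\<close>.\<close>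

lemma energy_upper:
  assumes g: "sqint g" "\<And>\<xi>. \<xi> < 0 \<Longrightarrow> g \<xi> = 0"
    and c: "(nrm g)\<^sup>2 \<le> 2 * pi * c" "c < 1"
    and sol: "L.solves (abs_ltwo g) F"
  shows "tail (\<kappa> / (1 - c)) g \<le> 2 * ((nrm g)\<^sup>2 - \<kappa> * (Gop (abs_ltwo g) \<bullet> F))"
proof -
  let ?F = "rep_ltwo F" and ?G = "Gfun g" and ?N = "\<kappa> / (1 - c)"
  have sG: "sqint ?G" by (rule sqint_Gfun[OF g(1)])
  have c0: "c \<ge> 0"
  proof -
    have "0 \<le> 2 * pi * c" using c(1) by (rule order_trans[rotated]) simp
    then show ?thesis using pi_gt_zero by (auto simp: zero_le_mult_iff)
  qed
  have iK: "integrable lborel (\<lambda>\<xi>. \<xi> * (cmod (Gfun ?F \<xi>))\<^sup>2)"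
    by (rule Kfun_bound(3)[OF g(1) sqint_rep])
  have n: "0 \<le> \<xi> * (cmod (Gfun ?F \<xi>))\<^sup>2" for \<xi>
    by (cases "\<xi> \<ge> 0") (auto simp: Gfun_def rho_def)
  have "(norm (Kop (abs_ltwo g) F))\<^sup>2 \<le> (nrm g)\<^sup>2 / (2 * pi) * (LBINT \<xi>. \<xi> * (cmod (Gfun ?F \<xi>))\<^sup>2)"
    by (rule Kop_bound)
  also have "\<dots> \<le> c * (LBINT \<xi>. \<xi> * (cmod (Gfun ?F \<xi>))\<^sup>2)"
    using c(1) by (intro mult_right_mono Bochner_Integration.integral_nonneg n) (simp add: field_simps)
  finally have K: "(norm (Kop (abs_ltwo g) F))\<^sup>2 \<le> c * (LBINT \<xi>. \<xi> * (cmod (Gfun ?F \<xi>))\<^sup>2)" .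
  have GF: "Gop (abs_ltwo g) \<bullet> F = (LBINT \<xi>. Re (cnj (?G \<xi>) * ?F \<xi>))"
    using inner_abs_ltwo[OF sG sqint_rep, of F] by (simp add: Gop_abs[OF g(1)])
  have "F \<bullet> Gop (abs_ltwo g) = F \<bullet> F - Kop (abs_ltwo g) F \<bullet> Kop (abs_ltwo g) F"
    by (rule L.solves_weak[OF sol])
  then have "Gop (abs_ltwo g) \<bullet> F = 2 * (Gop (abs_ltwo g) \<bullet> F) - (norm F)\<^sup>2 + (norm (Kop (abs_ltwo g) F))\<^sup>2"
    by (simp add: power2_norm_eq_inner inner_commute)
  also have "\<dots> \<le> 2 * (Gop (abs_ltwo g) \<bullet> F) - (norm F)\<^sup>2 + c * (LBINT \<xi>. \<xi> * (cmod (Gfun ?F \<xi>))\<^sup>2)"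
    using K by simp
  also have "\<dots> = (LBINT \<xi>. 2 * Re (cnj (?G \<xi>) * ?F \<xi>) - (cmod (?F \<xi>))\<^sup>2 + c * (\<xi> * (cmod (Gfun ?F \<xi>))\<^sup>2))"
  proof -
    have "2 * (LBINT \<xi>. A \<xi>) - (LBINT \<xi>. B \<xi>) + c * (LBINT \<xi>. C \<xi>)
      = (LBINT \<xi>. 2 * A \<xi> - B \<xi> + c * C \<xi>)"
      if "integrable lborel A" "integrable lborel B" "integrable lborel C" for A B C :: "real \<Rightarrow> real"
      using that by simp
    from this[OF integrable_inner_sqint[OF sG sqint_rep] sqint_integrable[OF sqint_rep] iK]
    show ?thesis unfolding GF norm_ltwo_rep .
  qed
  finally have E: "\<kappa> * (Gop (abs_ltwo g) \<bullet> F) \<le> \<kappa> * (LBINT \<xi>. 2 * Re (cnj (?G \<xi>) * ?F \<xi>) - (cmod (?F \<xi>))\<^sup>2 + c * (\<xi> * (cmod (Gfun ?F \<xi>))\<^sup>2))"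
    using \<kappa> by simp
  have pt: "\<kappa> * (2 * Re (cnj (?G \<xi>) * ?F \<xi>) - (cmod (?F \<xi>))\<^sup>2 + c * (\<xi> * (cmod (Gfun ?F \<xi>))\<^sup>2))
    \<le> (cmod (g \<xi>))\<^sup>2 - 1/2 * (indicator {?N..} \<xi> * (cmod (g \<xi>))\<^sup>2)" for \<xi>
  proof (cases "\<xi> < 0")
    case True
    then show ?thesis using g(2) \<kappa> by (simp add: Gfun_def rho_def)
  next
    case False
    define d where "d = (1 - c) * \<xi> + \<kappa>"
    have d: "d > 0" using False c(2) \<kappa> by (simp add: d_def add_nonneg_pos)
    have s: "\<xi> + \<kappa> > 0" using False \<kappa> by simp
    \<comment> \<open>In these variables the integrand is at most \<open>2 a y - d y\<^sup>2\<close>, whose maximum over \<open>y\<close> is \<open>a\<^sup>2 / d\<close>.\<close>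
    define a y where "a = cmod (g \<xi>)" and "y = rho \<xi> * cmod (?F \<xi>)"
    have y2: "(cmod (?F \<xi>))\<^sup>2 = (\<xi> + \<kappa>) * y\<^sup>2"
      using False s by (simp add: y_def power_mult_distrib rho_square)
    have "Re (cnj (?G \<xi>) * ?F \<xi>) \<le> cmod (cnj (?G \<xi>) * ?F \<xi>)" by (rule complex_Re_le_cmod)
    also have "\<dots> = a * y" using rho_nonneg[of \<xi>] by (simp add: Gfun_def norm_mult a_def y_def)
    finally have r: "Re (cnj (?G \<xi>) * ?F \<xi>) \<le> a * y" .
    have "2 * Re (cnj (?G \<xi>) * ?F \<xi>) - (cmod (?F \<xi>))\<^sup>2 + c * (\<xi> * (cmod (Gfun ?F \<xi>))\<^sup>2)
      \<le> 2 * (a * y) - (\<xi> + \<kappa>) * y\<^sup>2 + c * (\<xi> * y\<^sup>2)"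
      using r y2 rho_nonneg[of \<xi>] by (simp add: Gfun_def norm_mult y_def)
    also have "\<dots> = 2 * (a * y) - d * y\<^sup>2" by (simp add: d_def algebra_simps)
    also have "\<dots> \<le> a\<^sup>2 / d"
    proof -
      have "0 \<le> (a - d * y)\<^sup>2 / d" using d by simp
      also have "\<dots> = a\<^sup>2 / d - (2 * (a * y) - d * y\<^sup>2)" using d by (simp add: power2_eq_square field_simps)
      finally show ?thesis by simp
    qed
    finally have "\<kappa> * (2 * Re (cnj (?G \<xi>) * ?F \<xi>) - (cmod (?F \<xi>))\<^sup>2 + c * (\<xi> * (cmod (Gfun ?F \<xi>))\<^sup>2))
      \<le> \<kappa> * (a\<^sup>2 / d)" using \<kappa> by (intro mult_left_mono) auto
    also have "\<dots> = (\<kappa> / d) * a\<^sup>2" by simp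
    also have "\<dots> \<le> (1 - 1/2 * indicator {?N..} \<xi>) * a\<^sup>2"
    proof (rule mult_right_mono)
      show "\<kappa> / d \<le> 1 - 1/2 * indicator {?N..} \<xi>"
      proof (cases "\<xi> \<ge> ?N")
        case True
        then have "\<kappa> \<le> (1 - c) * \<xi>" using c(2) by (simp add: field_simps)
        then show ?thesis using True d by (simp add: d_def field_simps)
      next
        case F: False
        have "0 \<le> (1 - c) * \<xi>" using c(2) False by simp
        then have "\<kappa> / d \<le> 1" using d by (simp add: d_def)
        then show ?thesis using F by simp
      qed
    qed simp
    finally show ?thesis by (simp add: a_def algebra_simps)
  qed
  have "\<kappa> * (Gop (abs_ltwo g) \<bullet> F) \<le> (LBINT \<xi>. (cmod (g \<xi>))\<^sup>2 - 1/2 * (indicator {?N..} \<xi> * (cmod (g \<xi>))\<^sup>2))"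
  proof (rule order_trans[OF E], subst integral_mult_right_zero[symmetric], rule integral_mono[OF _ _ pt])
    show "integrable lborel (\<lambda>\<xi>. \<kappa> * (2 * Re (cnj (?G \<xi>) * ?F \<xi>) - (cmod (?F \<xi>))\<^sup>2 + c * (\<xi> * (cmod (Gfun ?F \<xi>))\<^sup>2)))"
      by (intro integrable_mult_right Bochner_Integration.integrable_add Bochner_Integration.integrable_diff
          integrable_inner_sqint sG sqint_rep sqint_integrable iK)
    show "integrable lborel (\<lambda>\<xi>. (cmod (g \<xi>))\<^sup>2 - 1/2 * (indicator {?N..} \<xi> * (cmod (g \<xi>))\<^sup>2))"
      by (intro Bochner_Integration.integrable_diff integrable_mult_right sqint_integrable g tail_integrable)
  qed
  also have "\<dots> = (nrm g)\<^sup>2 - 1/2 * tail ?N g"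
  proof -
    have "(LBINT \<xi>. A \<xi> - 1/2 * B \<xi>) = (LBINT \<xi>. A \<xi>) - 1/2 * (LBINT \<xi>. B \<xi>)"
      if "integrable lborel A" "integrable lborel B" for A B :: "real \<Rightarrow> real"
      using that by simp
    from this[OF sqint_integrable[OF g(1)] tail_integrable[OF g(1)]]
    show ?thesis unfolding tail_def norm_abs_ltwo[OF g(1)] .
  qed
  finally show ?thesis by simp
qed

theorem tail_propagation:
  assumes u: "is_solution u" and c: "(nrm (u 0))\<^sup>2 \<le> 2 * pi * c" "c < 1" and N: "N \<ge> 0"
    and g: "rapid g" "\<forall>\<xi><0. g \<xi> = 0" "u t = invft g"
    and k: "rapid k" "\<forall>\<xi><0. k \<xi> = 0" "u 0 = invft k"
  shows "tail (\<kappa> / (1 - c)) g \<le> 2 * (N / \<kappa> * (2 * pi) + tail N k)"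
proof -
  have c2: "2 * pi * c < 2 * pi" using c(2) by simp
  have small: "(nrm (u s))\<^sup>2 < 2 * pi" for s
    unfolding mass_conserved[OF u, of s 0] using c(1) c2 by linarith
  have "\<exists>F. L.solves (four (abs_ltwo (u s))) F" for s
  proof -
    have "nrm (u s) < sqrt (2 * pi)" using small[of s] by (simp add: real_less_rsqrt)
    then have "1 / sqrt (2 * pi) * norm (four (abs_ltwo (u s))) < 1" by simp
    then show ?thesis by (rule L.exists_solution) auto
  qed
  then obtain F where F: "\<And>s. L.solves (four (abs_ltwo (u s))) (F s)" by metis
  have fg: "four (abs_ltwo (u t)) = abs_ltwo g" "four (abs_ltwo (u 0)) = abs_ltwo k"
    unfolding g(3) k(3) by (intro four_invft rapid_integrable rapid_sqint g k)+
  have ng: "nrm g = nrm (u 0)" "nrm k = nrm (u 0)"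
    using fg[symmetric] mass_conserved[OF u, of t 0] by simp_all
  have E: "Gop (abs_ltwo g) \<bullet> F t = Gop (abs_ltwo k) \<bullet> F 0"
    using energy_conserved[OF u small F, of t 0] fg by simp
  have "tail (\<kappa> / (1 - c)) g \<le> 2 * ((nrm g)\<^sup>2 - \<kappa> * (Gop (abs_ltwo g) \<bullet> F t))"
    by (rule energy_upper[OF rapid_sqint[OF g(1)] g(2)[rule_format] _ c(2) F[of t, unfolded fg(1)]])
       (use c(1) ng in simp_all)
  also have "\<dots> = 2 * ((nrm k)\<^sup>2 - \<kappa> * (Gop (abs_ltwo k) \<bullet> F 0))" unfolding E ng ..
  also have "\<dots> \<le> 2 * (N / \<kappa> * (nrm k)\<^sup>2 + tail N k)"
    using energy_lower[OF rapid_sqint[OF k(1)] k(2)[rule_format] _ F[of 0, unfolded fg(2)] N] small[of 0] ng by simp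
  also have "\<dots> \<le> 2 * (N / \<kappa> * (2 * pi) + tail N k)"
    using small[of 0] ng N \<kappa> by (intro mult_left_mono add_mono) auto
  finally show ?thesis .
qed

end

section \<open>Equicontinuity and tails\<close>

lemma cmod_exp_minus_one: "(cmod (iexp t - 1))\<^sup>2 = 2 - 2 * cos t"
proof -
  have "(cmod (iexp t - 1))\<^sup>2 = (cos t - 1)\<^sup>2 + (sin t)\<^sup>2"
    by (simp add: cmod_power2 Re_exp Im_exp)
  also have "\<dots> = 2 - 2 * cos t" using sin_cos_squared_add[of t] by (simp add: power2_diff)
  finally show ?thesis .
qed

lemma norm_translate_diff:
  assumes g: "rapid g"
  shows "(nrm (\<lambda>x. invft g (x + y) - invft g x))\<^sup>2
    = (LBINT \<xi>. (2 - 2 * cos (y * \<xi>)) * (cmod (g \<xi>))\<^sup>2)"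
    "integrable lborel (\<lambda>\<xi>. (2 - 2 * cos (y * \<xi>)) * (cmod (g \<xi>))\<^sup>2)"
    "sqint (\<lambda>x. invft g (x + y) - invft g x)"
proof -
  let ?k = "\<lambda>\<xi>. (iexp (y * \<xi>) - 1) * g \<xi>"
  have [measurable]: "g \<in> borel_measurable borel" using g by (rule rapid_measurable)
  have e: "rapid (\<lambda>\<xi>. iexp (y * \<xi>) * g \<xi>)"
    by (rule rapid_bounded_mult[OF g, of _ 1 0]) (auto simp: norm_exp_eq_Re)
  have k_eq: "?k = (\<lambda>\<xi>. iexp (y * \<xi>) * g \<xi> + (-1) * g \<xi>)" by (simp add: algebra_simps)
  have k: "rapid ?k" unfolding k_eq by (intro rapid_add rapid_cmult e g)
  have i: "(\<lambda>x. invft g (x + y) - invft g x) = invft ?k"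
    unfolding k_eq invft_add[OF e rapid_cmult[OF g]] invft_cmult[OF g] invft_translate by simp
  show "sqint (\<lambda>x. invft g (x + y) - invft g x)"
    unfolding i by (intro invft_sqint rapid_integrable rapid_sqint k)
  have sq: "(cmod (?k \<xi>))\<^sup>2 = (2 - 2 * cos (y * \<xi>)) * (cmod (g \<xi>))\<^sup>2" for \<xi>
    unfolding norm_mult power_mult_distrib cmod_exp_minus_one ..
  show "integrable lborel (\<lambda>\<xi>. (2 - 2 * cos (y * \<xi>)) * (cmod (g \<xi>))\<^sup>2)"
    using sqint_integrable[OF rapid_sqint[OF k]] unfolding sq .
  show "(nrm (\<lambda>x. invft g (x + y) - invft g x))\<^sup>2
    = (LBINT \<xi>. (2 - 2 * cos (y * \<xi>)) * (cmod (g \<xi>))\<^sup>2)"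
    unfolding i invft_sqint(2)[OF rapid_integrable[OF k] rapid_sqint[OF k]] norm_abs_ltwo[OF rapid_sqint[OF k]] sq ..
qed

text \<open>The factor \<open>|exp (\<i> y \<xi>) - 1|\<close> is at most \<open>|y \<xi>|\<close>, which is used below \<open>M\<close>, and at most \<open>2\<close>.\<close>

lemma translate_le_tail:
  assumes g: "rapid g" "\<And>\<xi>. \<xi> < 0 \<Longrightarrow> g \<xi> = 0" and y: "\<bar>y\<bar> \<le> \<delta>" and M: "M \<ge> 0"
  shows "(nrm (\<lambda>x. invft g (x + y) - invft g x))\<^sup>2 \<le> (\<delta> * M)\<^sup>2 * (nrm g)\<^sup>2 + 4 * tail M g"
proof -
  have s: "sqint g" using g(1) by (rule rapid_sqint)
  have "(LBINT \<xi>. (2 - 2 * cos (y * \<xi>)) * (cmod (g \<xi>))\<^sup>2)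
    \<le> (LBINT \<xi>. (\<delta> * M)\<^sup>2 * (cmod (g \<xi>))\<^sup>2 + 4 * (indicator {M..} \<xi> * (cmod (g \<xi>))\<^sup>2))"
  proof (rule integral_mono[OF norm_translate_diff(2)[OF g(1)]])
    show "integrable lborel (\<lambda>\<xi>. (\<delta> * M)\<^sup>2 * (cmod (g \<xi>))\<^sup>2 + 4 * (indicator {M..} \<xi> * (cmod (g \<xi>))\<^sup>2))"
      by (intro Bochner_Integration.integrable_add integrable_mult_right sqint_integrable tail_integrable s)
    fix \<xi>
    have "2 - 2 * cos (y * \<xi>) \<le> (\<delta> * M)\<^sup>2 + 4 * indicator {M..} \<xi>" if "\<xi> \<ge> 0"
    proof (cases "\<xi> \<ge> M")
      case True
      have "2 - 2 * cos (y * \<xi>) \<le> 4" using cos_ge_minus_one[of "y * \<xi>"] by linarith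
      then show ?thesis using True by (simp add: add_increasing)
    next
      case False
      have "cmod (iexp (y * \<xi>) - 1) \<le> \<bar>y * \<xi>\<bar>"
        using iexp_approx1[of "y * \<xi>" 0] by simp
      also have "\<dots> \<le> \<delta> * M" using y False that unfolding abs_mult by (intro mult_mono) auto
      finally have "(cmod (iexp (y * \<xi>) - 1))\<^sup>2 \<le> (\<delta> * M)\<^sup>2" by (intro power_mono) auto
      then show ?thesis unfolding cmod_exp_minus_one using False by simp
    qed
    then have "(2 - 2 * cos (y * \<xi>)) * (cmod (g \<xi>))\<^sup>2 \<le> ((\<delta> * M)\<^sup>2 + 4 * indicator {M..} \<xi>) * (cmod (g \<xi>))\<^sup>2" if "\<xi> \<ge> 0"
      using that by (intro mult_right_mono) auto
    then show "(2 - 2 * cos (y * \<xi>)) * (cmod (g \<xi>))\<^sup>2 \<le> (\<delta> * M)\<^sup>2 * (cmod (g \<xi>))\<^sup>2 + 4 * (indicator {M..} \<xi> * (cmod (g \<xi>))\<^sup>2)"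
      using g(2)[of \<xi>] by (cases "\<xi> < 0") (auto simp: distrib_right)
  qed
  also have "\<dots> = (\<delta> * M)\<^sup>2 * (nrm g)\<^sup>2 + 4 * tail M g"
    by (simp add: norm_abs_ltwo[OF s] sqint_integrable s tail_def tail_integrable)
  finally show ?thesis unfolding norm_translate_diff(1)[OF g(1)] .
qed

text \<open>No single translation sees all high frequencies, but their average over \<open>y\<close> in \<open>[0, \<delta>]\<close> does: the mean
  of \<open>2 - 2 cos (y \<xi>)\<close> is \<open>2 - 2 sin (\<delta> \<xi>) / (\<delta> \<xi>)\<close>, which is at least \<open>1\<close> once \<open>\<delta> \<xi> \<ge> 2\<close>.\<close>

lemma tail_le_translate:
  assumes g: "rapid g" and \<delta>: "\<delta> > 0" and e: "e \<ge> 0"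
    and b: "\<And>y. \<bar>y\<bar> \<le> \<delta> \<Longrightarrow> (nrm (\<lambda>x. invft g (x + y) - invft g x))\<^sup>2 \<le> e"
  shows "tail (2 / \<delta>) g \<le> e"
proof -
  have s: "sqint g" using g by (rule rapid_sqint)
  have [measurable]: "g \<in> borel_measurable borel" using g by (rule rapid_measurable)
  let ?I = "\<lambda>y \<xi>. ennreal (2 - 2 * cos (y * \<xi>)) * indicator {0..\<delta>} y * ennreal ((cmod (g \<xi>))\<^sup>2)"
  have c: "0 \<le> 2 - 2 * cos t" for t :: real using cos_le_one[of t] by linarith
  have "ennreal (\<delta> * tail (2 / \<delta>) g) = (\<integral>\<^sup>+\<xi>. ennreal (\<delta> * (indicator {2 / \<delta>..} \<xi> * (cmod (g \<xi>))\<^sup>2)) \<partial>lborel)"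
    unfolding tail_def
    by (subst nn_integral_eq_integral) (use \<delta> in \<open>auto intro: tail_integrable s integrable_mult_right\<close>)
  also have "\<dots> \<le> (\<integral>\<^sup>+\<xi>. \<integral>\<^sup>+y. ?I y \<xi> \<partial>lborel \<partial>lborel)"
  proof (rule nn_integral_mono)
    fix \<xi> :: real
    show "ennreal (\<delta> * (indicator {2 / \<delta>..} \<xi> * (cmod (g \<xi>))\<^sup>2)) \<le> (\<integral>\<^sup>+y. ?I y \<xi> \<partial>lborel)"
    proof (cases "\<xi> \<ge> 2 / \<delta>")
      case True
      then have \<xi>: "\<xi> > 0" using \<delta> by (meson divide_pos_pos less_le_trans zero_less_numeral)
      have "(\<integral>\<^sup>+y. ?I y \<xi> \<partial>lborel) = (\<integral>\<^sup>+y. ennreal (2 - 2 * cos (y * \<xi>)) * indicator {0..\<delta>} y \<partial>lborel) * ennreal ((cmod (g \<xi>))\<^sup>2)"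
        by (rule nn_integral_multc) measurable
      also have "(\<integral>\<^sup>+y. ennreal (2 - 2 * cos (y * \<xi>)) * indicator {0..\<delta>} y \<partial>lborel)
        = ennreal ((2 * \<delta> - 2 * sin (\<delta> * \<xi>) / \<xi>) - (2 * 0 - 2 * sin (0 * \<xi>) / \<xi>))"
        by (rule nn_integral_FTC_Icc) (use \<delta> \<xi> c in \<open>auto intro!: derivative_eq_intros\<close>)
      also have "\<dots> * ennreal ((cmod (g \<xi>))\<^sup>2) \<ge> ennreal \<delta> * ennreal ((cmod (g \<xi>))\<^sup>2)"
      proof (intro mult_right_mono ennreal_leI)
        have "2 \<le> \<delta> * \<xi>" using True \<delta> by (simp add: field_simps)
        then have "2 * sin (\<delta> * \<xi>) \<le> \<delta> * \<xi>" using sin_le_one[of "\<delta> * \<xi>"] by linarith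
        then have "2 * sin (\<delta> * \<xi>) / \<xi> \<le> \<delta>" using \<xi> by (simp add: field_simps)
        then show "\<delta> \<le> (2 * \<delta> - 2 * sin (\<delta> * \<xi>) / \<xi>) - (2 * 0 - 2 * sin (0 * \<xi>) / \<xi>)" by simp
      qed simp
      finally show ?thesis using True \<delta> by (simp add: ennreal_mult)
    qed simp
  qed
  also have "\<dots> = (\<integral>\<^sup>+y. \<integral>\<^sup>+\<xi>. ?I y \<xi> \<partial>lborel \<partial>lborel)"
    by (rule lborel_pair.Fubini'[symmetric]) measurable
  also have "\<dots> \<le> (\<integral>\<^sup>+y. ennreal e * indicator {0..\<delta>} y \<partial>lborel)"
  proof (rule nn_integral_mono)
    fix y :: real
    show "(\<integral>\<^sup>+\<xi>. ?I y \<xi> \<partial>lborel) \<le> ennreal e * indicator {0..\<delta>} y"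
    proof (cases "y \<in> {0..\<delta>}")
      case True
      then have "(\<integral>\<^sup>+\<xi>. ?I y \<xi> \<partial>lborel) = (\<integral>\<^sup>+\<xi>. ennreal ((2 - 2 * cos (y * \<xi>)) * (cmod (g \<xi>))\<^sup>2) \<partial>lborel)"
        by (intro nn_integral_cong) (simp add: ennreal_mult c)
      also have "\<dots> = ennreal (LBINT \<xi>. (2 - 2 * cos (y * \<xi>)) * (cmod (g \<xi>))\<^sup>2)"
        by (rule nn_integral_eq_integral[OF norm_translate_diff(2)[OF g]]) (simp add: c)
      also have "\<dots> \<le> ennreal e"
        using b[of y] True unfolding norm_translate_diff(1)[OF g] by (intro ennreal_leI) auto
      finally show ?thesis using True by simp
    qed simp
  qed
  also have "\<dots> = ennreal e * emeasure lborel {0..\<delta>}" by (rule nn_integral_cmult_indicator) simp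
  also have "\<dots> = ennreal (e * \<delta>)" using \<delta> e by (simp add: ennreal_mult)
  finally have "\<delta> * tail (2 / \<delta>) g \<le> e * \<delta>" using e \<delta> by (simp add: ennreal_le_iff)
  then show ?thesis using \<delta> by (simp add: mult.commute)
qed

lemma equicontinuous_uniform_tail:
  assumes Q: "equicontinuous_L2 Q" and e: "e > 0"
  obtains N where "N \<ge> 0" "\<And>g. rapid g \<Longrightarrow> invft g \<in> Q \<Longrightarrow> tail N g \<le> e"
proof -
  let ?\<Phi> = "\<lambda>\<delta>. SUP q\<in>Q. SUP y\<in>{y. \<bar>y\<bar> < \<delta>}. L2_norm (\<lambda>x. q (x + y) - q x)"
  have "Limsup (at_right (0::real)) ?\<Phi> < ennreal (sqrt e)" using Q e by (simp add: equicontinuous_L2_def)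
  then have "eventually (\<lambda>\<delta>. ?\<Phi> \<delta> < ennreal (sqrt e)) (at_right 0)" by (rule Limsup_lessD)
  then obtain b where b: "b > 0" "\<And>\<delta>. 0 < \<delta> \<Longrightarrow> \<delta> < b \<Longrightarrow> ?\<Phi> \<delta> < ennreal (sqrt e)"
    unfolding eventually_at_right_field by auto
  have "tail (2 / (b / 4)) g \<le> e" if g: "rapid g" "invft g \<in> Q" for g
  proof (rule tail_le_translate[OF g(1)])
    fix y :: real assume y: "\<bar>y\<bar> \<le> b / 4"
    have "L2_norm (\<lambda>x. invft g (x + y) - invft g x) \<le> ?\<Phi> (b / 2)"
      by (rule SUP_upper2[OF g(2)], rule SUP_upper) (use y b(1) in auto)
    also have "\<dots> < ennreal (sqrt e)" by (rule b(2)) (use b(1) in auto)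
    finally have "ennreal (nrm (\<lambda>x. invft g (x + y) - invft g x)) < ennreal (sqrt e)"
      by (simp add: L2_norm_eq norm_translate_diff(3)[OF g(1)])
    then have "nrm (\<lambda>x. invft g (x + y) - invft g x) < sqrt e" by (simp add: ennreal_less_iff)
    then have "(nrm (\<lambda>x. invft g (x + y) - invft g x))\<^sup>2 \<le> (sqrt e)\<^sup>2" by (intro power_mono) auto
    then show "(nrm (\<lambda>x. invft g (x + y) - invft g x))\<^sup>2 \<le> e" using e by simp
  qed (use b e in auto)
  then show ?thesis using that[of "2 / (b / 4)"] b(1) by auto
qed

lemma uniform_tail_equicontinuous:
  assumes bound: "\<And>q. q \<in> Q \<Longrightarrow> (nrm q)\<^sup>2 \<le> B"
    and tails: "\<And>e. e > 0 \<Longrightarrow> \<exists>M\<ge>0. \<forall>q\<in>Q. \<exists>g. rapid g \<and> (\<forall>\<xi><0. g \<xi> = 0) \<and> q = invft g \<and> tail M g \<le> e"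
  shows "Limsup (at_right (0::real)) (\<lambda>\<delta>. SUP q\<in>Q. SUP y\<in>{y. \<bar>y\<bar> < \<delta>}. L2_norm (\<lambda>x. q (x + y) - q x)) = 0"
proof -
  let ?\<Phi> = "\<lambda>\<delta>. SUP q\<in>Q. SUP y\<in>{y. \<bar>y\<bar> < \<delta>}. L2_norm (\<lambda>x. q (x + y) - q x)"
  have "Limsup (at_right (0::real)) ?\<Phi> \<le> 0"
  proof (rule ennreal_le_epsilon)
    fix e :: real assume e: "e > 0"
    obtain M where M: "M \<ge> 0"
      "\<forall>q\<in>Q. \<exists>g. rapid g \<and> (\<forall>\<xi><0. g \<xi> = 0) \<and> q = invft g \<and> tail M g \<le> e\<^sup>2 / 8"
      using tails[of "e\<^sup>2 / 8"] e by auto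
    \<comment> \<open>The summand \<open>1\<close> keeps the denominator in \<open>\<delta>0\<close> positive when \<open>M = 0\<close>.\<close>
    define D where "D = M\<^sup>2 * \<bar>B\<bar> + 1"
    have D: "D > 0" by (simp add: D_def add_nonneg_pos)
    define \<delta>0 where "\<delta>0 = e / sqrt (2 * D)"
    have \<delta>0: "\<delta>0 > 0" using e D by (simp add: \<delta>0_def)
    have "?\<Phi> \<delta> \<le> ennreal e" if \<delta>: "0 < \<delta>" "\<delta> < \<delta>0" for \<delta>
    proof (intro SUP_least)
      fix q y assume q: "q \<in> Q" and "y \<in> {y. \<bar>y\<bar> < \<delta>}"
      then have y: "\<bar>y\<bar> \<le> \<delta>0" using \<delta> by simp
      obtain g where g: "rapid g" "\<forall>\<xi><0. g \<xi> = 0" "q = invft g" "tail M g \<le> e\<^sup>2 / 8" using M(2) q by auto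
      have ng: "(nrm g)\<^sup>2 \<le> \<bar>B\<bar>"
        using bound[OF q] invft_sqint(2)[OF rapid_integrable[OF g(1)] rapid_sqint[OF g(1)]] g(3) by simp
      have "(nrm (\<lambda>x. q (x + y) - q x))\<^sup>2 \<le> (\<delta>0 * M)\<^sup>2 * (nrm g)\<^sup>2 + 4 * tail M g"
        unfolding g(3) by (rule translate_le_tail[OF g(1) g(2)[rule_format] y M(1)])
      also have "\<dots> \<le> (\<delta>0 * M)\<^sup>2 * \<bar>B\<bar> + e\<^sup>2 / 2"
        using ng g(4) by (intro add_mono mult_left_mono) auto
      also have "\<dots> \<le> \<delta>0\<^sup>2 * D + e\<^sup>2 / 2"
        by (simp add: D_def power_mult_distrib algebra_simps)
      also have "\<dots> = e\<^sup>2" using D by (simp add: \<delta>0_def power_divide)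
      finally have "nrm (\<lambda>x. q (x + y) - q x) \<le> e" using e by (simp add: power2_le_iff_abs_le)
      then show "L2_norm (\<lambda>x. q (x + y) - q x) \<le> ennreal e"
        using norm_translate_diff(3)[OF g(1), of y] unfolding g(3) by (simp add: L2_norm_eq ennreal_leI)
    qed
    then have "Limsup (at_right (0::real)) ?\<Phi> \<le> ennreal e"
      by (intro Limsup_bounded) (auto simp: eventually_at_right_field intro!: exI[of _ \<delta>0] \<delta>0)
    then show "Limsup (at_right (0::real)) ?\<Phi> \<le> 0 + ennreal e" by simp
  qed
  then show ?thesis by simp
qed

theorem theorem1p4:
  fixes Q :: "(real \<Rightarrow> complex) set"
  assumes "Q \<subseteq> Hinf_plus"
    and "(SUP q\<in>Q. (L2_norm q)\<^sup>2) < ennreal (2 * pi)"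
    and "equicontinuous_L2 Q"
  shows "bounded_L2 (orbits Q) \<and> equicontinuous_L2 (orbits Q)"
proof -
  define c where "c = enn2real (SUP q\<in>Q. (L2_norm q)\<^sup>2) / (2 * pi)"
  have S: "(SUP q\<in>Q. (L2_norm q)\<^sup>2) = ennreal (2 * pi * c)" "c \<ge> 0"
    using ennreal_enn2real[OF less_trans[OF assms(2) ennreal_less_top]] by (simp_all add: c_def)
  have c: "c < 1"
    using assms(2) S(2) unfolding S(1) by (subst (asm) ennreal_less_iff) auto
  have mass: "sqint q \<and> (nrm q)\<^sup>2 \<le> 2 * pi * c" if "q \<in> Q" for q
  proof
    show s: "sqint q" using that assms(1) by (auto intro: Hinf_sqint Hpos_Hinf Hinf_plus_Hpos)
    have "(L2_norm q)\<^sup>2 \<le> ennreal (2 * pi * c)" unfolding S(1)[symmetric] by (rule SUP_upper[OF that])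
    then show "(nrm q)\<^sup>2 \<le> 2 * pi * c" using S(2) by (simp add: L2_norm_eq s ennreal_power)
  qed
  have sol: "is_solution u \<Longrightarrow> u t \<in> Hinf_plus" for u t by (simp add: is_solution_def)
  have sub: "orbits Q \<subseteq> Hinf_plus" using sol by (auto simp: orbits_def)
  have sq: "sqint q" if "q \<in> orbits Q" for q
    using that sub by (auto intro: Hinf_sqint Hpos_Hinf Hinf_plus_Hpos)
  have mass': "(nrm q)\<^sup>2 \<le> 2 * pi * c" if "q \<in> orbits Q" for q
  proof -
    obtain u t where u: "q = u t" "is_solution u" "u 0 \<in> Q" using \<open>q \<in> orbits Q\<close> by (auto simp: orbits_def)
    show ?thesis using mass[OF u(3)] mass_conserved[OF u(2), of t 0] u(1) by simp
  qed
  have bdd: "bounded_L2 (orbits Q)"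
  proof -
    have "L2_norm q \<le> ennreal (sqrt (2 * pi * c))" if "q \<in> orbits Q" for q
      using mass'[OF that] by (simp add: L2_norm_eq sq[OF that] real_le_rsqrt ennreal_leI)
    then have "(SUP q\<in>orbits Q. L2_norm q) \<le> ennreal (sqrt (2 * pi * c))" by (rule SUP_least)
    also have "\<dots> < \<infinity>" by simp
    finally show ?thesis using sq by (auto simp: bounded_L2_def L2_iff_sqint)
  qed
  have plus: "orbits Q \<subseteq> L2_plus"
  proof
    fix q assume "q \<in> orbits Q"
    then have "q \<in> H_plus 1" using sub by (auto simp: Hinf_plus_def)
    then show "q \<in> L2_plus" by (simp add: H_plus_def L2_plus_def)
  qed
  have "\<exists>M\<ge>0. \<forall>q\<in>orbits Q. \<exists>g. rapid g \<and> (\<forall>\<xi><0. g \<xi> = 0) \<and> q = invft g \<and> tail M g \<le> e" if e: "e > 0" for e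
  proof -
    obtain N where N: "N \<ge> 0" "\<And>g. rapid g \<Longrightarrow> invft g \<in> Q \<Longrightarrow> tail N g \<le> e / 4"
      using equicontinuous_uniform_tail[OF assms(3), of "e/4"] e by auto
    \<comment> \<open>So large that the low frequencies contribute at most \<open>e / 4\<close> in \<open>tail_propagation\<close>; \<open>N + 1\<close> rather than \<open>N\<close> keeps it positive.\<close>
    define \<kappa> where "\<kappa> = (N + 1) * (2 * pi) * 4 / e"
    have \<kappa>: "\<kappa> > 0" using N(1) e by (simp add: \<kappa>_def)
    have "N / \<kappa> * (2 * pi) \<le> e / 4"
    proof -
      have "N / ((N + 1) * p * 4 / e) * p = (N / (N + 1)) * (e / 4)" if "p > 0" for p
        using that e by simp
      from this[of "2 * pi"] have "N / \<kappa> * (2 * pi) = (N / (N + 1)) * (e / 4)" by (simp only: \<kappa>_def) simp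
      also have "\<dots> \<le> 1 * (e / 4)" using N(1) e by (intro mult_right_mono) auto
      finally show ?thesis by simp
    qed
    note Nk = this
    have "\<exists>g. rapid g \<and> (\<forall>\<xi><0. g \<xi> = 0) \<and> q = invft g \<and> tail (\<kappa> / (1 - c)) g \<le> e" if q: "q \<in> orbits Q" for q
    proof -
      obtain u t where u: "q = u t" "is_solution u" "u 0 \<in> Q" using q by (auto simp: orbits_def)
      obtain g where g: "rapid g" "\<forall>\<xi><0. g \<xi> = 0" "u t = invft g"
        using Hinf_plus_Hpos[OF sol[OF u(2)]] unfolding Hpos_def by auto
      obtain k where k: "rapid k" "\<forall>\<xi><0. k \<xi> = 0" "u 0 = invft k"
        using Hinf_plus_Hpos[OF sol[OF u(2)]] unfolding Hpos_def by auto
      have "tail (\<kappa> / (1 - c)) g \<le> 2 * (N / \<kappa> * (2 * pi) + tail N k)"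
        by (rule tail_propagation[OF \<kappa> u(2) _ c N(1) g k]) (use mass[OF u(3)] in simp)
      also have "\<dots> \<le> 2 * (e / 4 + e / 4)"
        using Nk N(2)[OF k(1)] u(3) k(3) by (intro mult_left_mono add_mono) auto
      finally show ?thesis using g u(1) by auto
    qed
    then show ?thesis using \<kappa> c by (intro exI[of _ "\<kappa> / (1 - c)"]) auto
  qed
  then have "equicontinuous_L2 (orbits Q)"
    unfolding equicontinuous_L2_def using plus bdd uniform_tail_equicontinuous[OF mass'] by blast
  then show ?thesis using bdd by blast
qed

end
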